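(* Let $M$ be a screen generic lightlike submanifold of a locally bronze semi-Riemannian manifold $(\bar M,\bar g,\bar J)$ with an $(l,m)$-type connection $\bar\Omega$. Then the distribution $B=B_o\perp\mathrm{Rad}\,TM$ is integrable if and only if $$\bar g(\Omega_X\bar JY,fZ)+\bar g(\bar h^{s}(X,\bar JY),\bar JZ)+3\bar g(\Omega_Y\bar JX,Z)=\bar g(\Omega_Y\bar JX,fZ)+\bar g(\bar h^{s}(Y,\bar JX),\bar JZ)+3\bar g(\Omega_X\bar JY,Z)$$ for all $X,Y\in\Gamma(B)$ and $Z\in\Gamma(B')$.
   Context: Bronze manifold: a semi-Riemannian manifold $(\bar M,\bar g)$ (of constant index $q$, $1\le q\le \dim\bar M-1$) with a $(1,1)$-tensor field $\bar J$ satisfying $\bar J^2=3\bar J+I$ and $\bar g(\bar JX,Y)=\bar g(X,\bar JY)$; it is locally bronze if $\bar\nabla\bar J=0$ for the Levi-Civita connection $\bar\nabla$. Lightlike submanifold: $M\subset\bar M$ such that $\mathrm{Rad}\,TM=TM\cap TM^\perp$ is a distribution of constant rank $r>0$; $g$ is the induced metric. One fixes $S(TM)$, $S(TM^\perp)$ with $TM=\mathrm{Rad}\,TM\perp S(TM)$, $TM^\perp=\mathrm{Rad}\,TM\perp S(TM^\perp)$, and a lightlike transversal bundle $\mathrm{ltr}(TM)$ (locally spanned by $N_1,\dots,N_r$ in $S(TM^\perp)^\perp$, orthogonal to $S(TM)$, with $\bar g(N_i,\xi_j)=\delta_{ij}$, $\bar g(N_i,N_j)=0$ for a local basis $\xi_1,\dots,\xi_r$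 of $\mathrm{Rad}\,TM$). Then $T\bar M|_M=TM\oplus \mathrm{tr}(TM)$ with $\mathrm{tr}(TM)=\mathrm{ltr}(TM)\perp S(TM^\perp)$. For $X\in\Gamma(TM)$ write $\bar JX=fX+wX$ with $fX$ tangential and $wX\in\Gamma(\mathrm{tr}(TM))$. Screen generic: $M$ is screen generic if $\bar J(\mathrm{Rad}\,TM)=\mathrm{Rad}\,TM$ and $B_o=\bar J(S(TM))\cap S(TM)$ is a non-degenerate distribution; $B'$ denotes the complementary (orthogonal) non-degenerate distribution in $S(TM)$, so $S(TM)=B_o\oplus B'$, with (when $B'\neq\{0\}$) $\bar J(B')\not\subseteq S(TM)$ and $\bar J(B')\not\subseteq S(TM^\perp)$, and $fY\in\Gamma(B')$, $wY\in\Gamma(S(TM^\perp))$ for $Y\in\Gamma(B')$. The distribution $B=B_o\perp\mathrm{Rad}\,TM$ is $\bar J$-invariant. $(l,m)$-type connection: let $l,m$ be smooth functions on $\bar M$, $(l,m)\ne(0,0)$, $\eta$ a smooth unit spacelike vector field on $\bar M$, $\theta(X)=\bar g(X,\eta)$. Then $\bar\Omega_XY=\bar\nabla_XY+\theta(Y)\{lX+m\bar JX\}$. Induced objects: for $X,Y\in\Gamma(TM)$, $\bar\Omega_XY=\Omega_XY+\bar h^{l}(X,Y)+\bar h^{s}(X,Y)$ with components in $TM$, $\mathrm{ltr}(TM)$, $S(TM^\perp)$ respectively. A distribution is integrable if it is closed under the Lie bracket of its sections. *)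

theory Defs
  imports "HOL-Analysis.Analysis" "HOL-Library.Function_Algebras"
begin

section \<open>Real-valued functions as a real vector space\<close>

instantiation "fun" :: (type, real_vector) real_vector
begin

definition scaleR_fun :: "real \<Rightarrow> ('a \<Rightarrow> 'b) \<Rightarrow> 'a \<Rightarrow> 'b" where
  "scaleR_fun c f = (\<lambda>x. c *\<^sub>R f x)"

instance
  by standard (auto simp: scaleR_fun_def plus_fun_def fun_eq_iff algebra_simps)

end

section \<open>Smooth manifolds\<close>

text \<open>The set S is meant to be open in the next two definitions.\<close>

primrec Ck_on :: "nat \<Rightarrow> 'b::euclidean_space set \<Rightarrow> ('b \<Rightarrow> 'c::real_normed_vector) \<Rightarrow> bool" where
  "Ck_on 0 S f \<longleftrightarrow> continuous_on S f"
| "Ck_on (Suc k) S f \<longleftrightarrow> (\<forall>x\<in>S. f differentiable (at x)) \<and>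
     (\<forall>v. Ck_on k S (\<lambda>x. frechet_derivative f (at x) v))"

definition smooth_on :: "'b::euclidean_space set \<Rightarrow> ('b \<Rightarrow> 'c::real_normed_vector) \<Rightarrow> bool" where
  "smooth_on S f \<longleftrightarrow> (\<forall>k. Ck_on k S f)"

type_synonym ('a, 'b) chart = "'a set \<times> ('a \<Rightarrow> 'b)"
type_synonym ('a, 'b) atlas = "('a, 'b) chart set"

definition is_chart :: "('a::topological_space, 'b::euclidean_space) chart \<Rightarrow> bool" where
  "is_chart c \<longleftrightarrow> (case c of (U, \<phi>) \<Rightarrow>
     open U \<and> open (\<phi> ` U) \<and> (\<exists>\<psi>. homeomorphism U (\<phi> ` U) \<phi> \<psi>))"

definition smooth_transition ::
  "('a::topological_space, 'b::euclidean_space) chart \<Rightarrow> ('a, 'b) chart \<Rightarrow> bool" where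
  "smooth_transition c d \<longleftrightarrow> (case (c, d) of ((U, \<phi>), (V, \<psi>)) \<Rightarrow>
     smooth_on (\<phi> ` (U \<inter> V)) (\<psi> \<circ> inv_into U \<phi>))"

text \<open>The underlying manifold is the whole type \<open>'a\<close>, of dimension \<open>DIM('b)\<close>; the Hausdorff and
  second countability axioms are carried by the type class constraints.\<close>

definition smooth_manifold ::
  "('a::{t2_space, second_countable_topology}, 'b::euclidean_space) atlas \<Rightarrow> bool" where
  "smooth_manifold A \<longleftrightarrow> (\<Union>c\<in>A. fst c) = UNIV \<and> (\<forall>c\<in>A. is_chart c) \<and>
     (\<forall>c\<in>A. \<forall>d\<in>A. smooth_transition c d)"

text \<open>Membership in the maximal atlas generated by \<open>A\<close>.\<close>

definition smooth_chart ::
  "('a::topological_space, 'b::euclidean_space) atlas \<Rightarrow> ('a, 'b) chart \<Rightarrow> bool" where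
  "smooth_chart A c \<longleftrightarrow> is_chart c \<and>
     (\<forall>d\<in>A. smooth_transition c d \<and> smooth_transition d c)"

text \<open>Regular (embedded) submanifolds of dimension \<open>n\<close>: near each of its points \<open>M\<close> is the common
  zero set of all but \<open>n\<close> of the coordinate functions of an adapted chart.\<close>

definition submanifold ::
  "('a::topological_space, 'b::euclidean_space) atlas \<Rightarrow> nat \<Rightarrow> 'a set \<Rightarrow> bool" where
  "submanifold A n M \<longleftrightarrow> (\<forall>p\<in>M. \<exists>U \<phi> I. smooth_chart A (U, \<phi>) \<and> p \<in> U \<and>
     I \<subseteq> Basis \<and> card I = n \<and> (\<forall>q\<in>U. q \<in> M \<longleftrightarrow> (\<forall>b\<in>Basis - I. \<phi> q \<bullet> b = 0)))"

text \<open>\<open>smooth_funs A N\<close> is the algebra \<open>C\<^sup>\<infinity>(N)\<close> for \<open>N\<close> an open subset of the manifold or of an embedded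
  submanifold: near each point of \<open>N\<close>, the function agrees on \<open>N\<close> with a smooth function of
  ambient coordinates. Functions are total; their values off \<open>N\<close> are irrelevant.\<close>

definition smooth_funs ::
  "('a::topological_space, 'b::euclidean_space) atlas \<Rightarrow> 'a set \<Rightarrow> ('a \<Rightarrow> real) set" where
  "smooth_funs A N = {f. \<forall>p\<in>N. \<exists>U \<phi> F. smooth_chart A (U, \<phi>) \<and> p \<in> U \<and>
     smooth_on (\<phi> ` U) F \<and> (\<forall>q\<in>U \<inter> N. f q = F (\<phi> q))}"

section \<open>Tangent vectors and vector fields\<close>

type_synonym 'a tvec = "('a \<Rightarrow> real) \<Rightarrow> real"
type_synonym 'a vfield = "'a \<Rightarrow> 'a tvec"

text \<open>\<open>T\<^sub>pN\<close> as the space of derivations of \<open>C\<^sup>\<infinity>(N)\<close> at \<open>p\<close>. The value 0 outside \<open>C\<^sup>\<infinity>(N)\<close> makes the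
  representing function unique.\<close>

definition tangent_space ::
  "('a::topological_space, 'b::euclidean_space) atlas \<Rightarrow> 'a set \<Rightarrow> 'a \<Rightarrow> 'a tvec set" where
  "tangent_space A N p = {v.
     (\<forall>f. f \<notin> smooth_funs A N \<longrightarrow> v f = 0) \<and>
     (\<forall>f\<in>smooth_funs A N. \<forall>h\<in>smooth_funs A N. (\<forall>q\<in>N. f q = h q) \<longrightarrow> v f = v h) \<and>
     (\<forall>f\<in>smooth_funs A N. \<forall>h\<in>smooth_funs A N. \<forall>c d.
        v (\<lambda>q. c * f q + d * h q) = c * v f + d * v h) \<and>
     (\<forall>f\<in>smooth_funs A N. \<forall>h\<in>smooth_funs A N.
        v (\<lambda>q. f q * h q) = v f * h p + f p * v h)}"

text \<open>The differential of the inclusion of a submanifold \<open>N\<close> into the ambient manifold: a derivation of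
  \<open>C\<^sup>\<infinity>(N)\<close> is precomposed with the restriction of ambient smooth functions to \<open>N\<close>.\<close>

definition incl_diff ::
  "('a::topological_space, 'b::euclidean_space) atlas \<Rightarrow> 'a tvec \<Rightarrow> 'a tvec" where
  "incl_diff A v = (\<lambda>f. if f \<in> smooth_funs A UNIV then v f else 0)"

definition tangent_bundle ::
  "('a::topological_space, 'b::euclidean_space) atlas \<Rightarrow> 'a set \<Rightarrow> 'a \<Rightarrow> 'a tvec set" where
  "tangent_bundle A M p = incl_diff A ` tangent_space A M p"

text \<open>Smooth sections over \<open>N\<close> of the ambient tangent bundle restricted to \<open>N\<close>.\<close>

definition smooth_sections ::
  "('a::topological_space, 'b::euclidean_space) atlas \<Rightarrow> 'a set \<Rightarrow> 'a vfield set" where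
  "smooth_sections A N = {X. (\<forall>p\<in>N. X p \<in> tangent_space A UNIV p) \<and>
     (\<forall>f\<in>smooth_funs A UNIV. (\<lambda>p. X p f) \<in> smooth_funs A N)}"

abbreviation vector_fields ::
  "('a::topological_space, 'b::euclidean_space) atlas \<Rightarrow> 'a vfield set" where
  "vector_fields A \<equiv> smooth_sections A UNIV"

definition sections_of ::
  "('a::topological_space, 'b::euclidean_space) atlas \<Rightarrow> 'a set \<Rightarrow> ('a \<Rightarrow> 'a tvec set) \<Rightarrow> 'a vfield set"
  where "sections_of A M E = {X \<in> smooth_sections A M. \<forall>p\<in>M. X p \<in> E p}"

text \<open>Smooth rank \<open>k\<close> subbundles, over \<open>M\<close>, of the ambient tangent bundle restricted to \<open>M\<close>.\<close>

definition subbundle ::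
  "('a::topological_space, 'b::euclidean_space) atlas \<Rightarrow> 'a set \<Rightarrow> nat \<Rightarrow> ('a \<Rightarrow> 'a tvec set) \<Rightarrow> bool"
  where "subbundle A M k E \<longleftrightarrow> (\<forall>p\<in>M. dim (E p) = k) \<and>
     (\<forall>p\<in>M. \<exists>V X. open V \<and> p \<in> V \<and> (\<forall>i<k. X i \<in> smooth_sections A (M \<inter> V)) \<and>
        (\<forall>q\<in>M \<inter> V. E q = span ((\<lambda>i. X i q) ` {..<k})))"

definition bundle_sum ::
  "('a \<Rightarrow> 'a tvec set) \<Rightarrow> ('a \<Rightarrow> 'a tvec set) \<Rightarrow> 'a \<Rightarrow> 'a tvec set" where
  "bundle_sum E F p = {v + w | v w. v \<in> E p \<and> w \<in> F p}"

definition lie_bracket ::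
  "('a::topological_space, 'b::euclidean_space) atlas \<Rightarrow> 'a set \<Rightarrow> 'a vfield \<Rightarrow> 'a vfield \<Rightarrow> 'a vfield"
  where "lie_bracket A N X Y p = (\<lambda>f. if f \<in> smooth_funs A N
     then X p (\<lambda>q. Y q f) - Y p (\<lambda>q. X q f) else 0)"

text \<open>The bracket of sections of \<open>TM\<close>, where these take values in the ambient tangent spaces: it is formed
  on \<open>M\<close>, after identifying \<open>d\<iota>(T\<^sub>pM)\<close> with the space \<open>T\<^sub>pM\<close> of derivations of \<open>C\<^sup>\<infinity>(M)\<close>.\<close>

definition intrinsic ::
  "('a::topological_space, 'b::euclidean_space) atlas \<Rightarrow> 'a set \<Rightarrow> 'a vfield \<Rightarrow> 'a vfield" where
  "intrinsic A M X p = (THE v. v \<in> tangent_space A M p \<and> incl_diff A v = X p)"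

definition sub_bracket ::
  "('a::topological_space, 'b::euclidean_space) atlas \<Rightarrow> 'a set \<Rightarrow> 'a vfield \<Rightarrow> 'a vfield \<Rightarrow> 'a vfield"
  where "sub_bracket A M X Y p =
     incl_diff A (lie_bracket A M (intrinsic A M X) (intrinsic A M Y) p)"

definition integrable_distribution ::
  "('a::topological_space, 'b::euclidean_space) atlas \<Rightarrow> 'a set \<Rightarrow> ('a \<Rightarrow> 'a tvec set) \<Rightarrow> bool" where
  "integrable_distribution A M E \<longleftrightarrow>
     (\<forall>X\<in>sections_of A M E. \<forall>Y\<in>sections_of A M E. sub_bracket A M X Y \<in> sections_of A M E)"

section \<open>Semi-Riemannian metrics and connections\<close>

type_synonym 'a form = "'a \<Rightarrow> 'a tvec \<Rightarrow> 'a tvec \<Rightarrow> real"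
type_synonym 'a endo = "'a \<Rightarrow> 'a tvec \<Rightarrow> 'a tvec"
type_synonym 'a connection = "'a vfield \<Rightarrow> 'a vfield \<Rightarrow> 'a vfield"

definition nondegenerate_on :: "('v::real_vector \<Rightarrow> 'v \<Rightarrow> real) \<Rightarrow> 'v set \<Rightarrow> bool" where
  "nondegenerate_on b W \<longleftrightarrow> (\<forall>v\<in>W. (\<forall>w\<in>W. b v w = 0) \<longrightarrow> v = 0)"

text \<open>The index of \<open>b\<close> on \<open>T\<close>: the largest dimension of a negative definite subspace.\<close>

definition has_index :: "('v::real_vector \<Rightarrow> 'v \<Rightarrow> real) \<Rightarrow> 'v set \<Rightarrow> nat \<Rightarrow> bool" where
  "has_index b T q \<longleftrightarrow>
     (\<exists>W. subspace W \<and> W \<subseteq> T \<and> (\<forall>v\<in>W. v \<noteq> 0 \<longrightarrow> b v v < 0) \<and> dim W = q) \<and>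
     (\<forall>W. subspace W \<and> W \<subseteq> T \<and> (\<forall>v\<in>W. v \<noteq> 0 \<longrightarrow> b v v < 0) \<longrightarrow> dim W \<le> q)"

definition semi_riemannian_metric ::
  "('a::topological_space, 'b::euclidean_space) atlas \<Rightarrow> nat \<Rightarrow> 'a form \<Rightarrow> bool" where
  "semi_riemannian_metric A q g \<longleftrightarrow>
     (\<forall>p. (\<forall>u\<in>tangent_space A UNIV p. \<forall>v\<in>tangent_space A UNIV p.
             g p u v = g p v u \<and>
             (\<forall>w\<in>tangent_space A UNIV p. \<forall>c d. g p (c *\<^sub>R u + d *\<^sub>R v) w = c * g p u w + d * g p v w)) \<and>
          nondegenerate_on (g p) (tangent_space A UNIV p) \<and>
          has_index (g p) (tangent_space A UNIV p) q) \<and>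
     (\<forall>X\<in>vector_fields A. \<forall>Y\<in>vector_fields A. (\<lambda>p. g p (X p) (Y p)) \<in> smooth_funs A UNIV)"

definition smooth_endomorphism ::
  "('a::topological_space, 'b::euclidean_space) atlas \<Rightarrow> 'a endo \<Rightarrow> bool" where
  "smooth_endomorphism A J \<longleftrightarrow>
     (\<forall>p. \<forall>u\<in>tangent_space A UNIV p. J p u \<in> tangent_space A UNIV p \<and>
        (\<forall>v\<in>tangent_space A UNIV p. \<forall>c d. J p (c *\<^sub>R u + d *\<^sub>R v) = c *\<^sub>R J p u + d *\<^sub>R J p v)) \<and>
     (\<forall>X\<in>vector_fields A. (\<lambda>p. J p (X p)) \<in> vector_fields A)"

definition affine_connection ::
  "('a::topological_space, 'b::euclidean_space) atlas \<Rightarrow> 'a connection \<Rightarrow> bool" where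
  "affine_connection A D \<longleftrightarrow>
     (\<forall>X\<in>vector_fields A. \<forall>Y\<in>vector_fields A. D X Y \<in> vector_fields A \<and>
        (\<forall>Z\<in>vector_fields A. D (X + Y) Z = D X Z + D Y Z \<and> D X (Y + Z) = D X Y + D X Z) \<and>
        (\<forall>f\<in>smooth_funs A UNIV.
           D (\<lambda>p. f p *\<^sub>R X p) Y = (\<lambda>p. f p *\<^sub>R D X Y p) \<and>
           D X (\<lambda>p. f p *\<^sub>R Y p) = (\<lambda>p. X p f *\<^sub>R Y p + f p *\<^sub>R D X Y p)))"

definition levi_civita ::
  "('a::topological_space, 'b::euclidean_space) atlas \<Rightarrow> 'a form \<Rightarrow> 'a connection \<Rightarrow> bool" where
  "levi_civita A g D \<longleftrightarrow> affine_connection A D \<and>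
     (\<forall>X\<in>vector_fields A. \<forall>Y\<in>vector_fields A. D X Y - D Y X = lie_bracket A UNIV X Y) \<and>
     (\<forall>X\<in>vector_fields A. \<forall>Y\<in>vector_fields A. \<forall>Z\<in>vector_fields A. \<forall>p.
        X p (\<lambda>x. g x (Y x) (Z x)) = g p (D X Y p) (Z p) + g p (Y p) (D X Z p))"

text \<open>For \<open>X\<close> and \<open>Y\<close> defined along \<open>M\<close> only, with \<open>X\<close> tangent to \<open>M\<close>, the covariant derivative at
  \<open>p \<in> M\<close> is that of any ambient vector fields agreeing with \<open>X\<close> and \<open>Y\<close> on \<open>M\<close> near \<open>p\<close>.\<close>

definition extends_at ::
  "('a::topological_space, 'b::euclidean_space) atlas \<Rightarrow> 'a set \<Rightarrow> 'a \<Rightarrow> 'a vfield \<Rightarrow> 'a vfield \<Rightarrow> bool"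
  where "extends_at A M p X X' \<longleftrightarrow> X' \<in> vector_fields A \<and>
     (\<exists>V. open V \<and> p \<in> V \<and> (\<forall>q\<in>M \<inter> V. X' q = X q))"

definition connection_along ::
  "('a::topological_space, 'b::euclidean_space) atlas \<Rightarrow> 'a set \<Rightarrow> 'a connection \<Rightarrow> 'a connection"
  where "connection_along A M D X Y p =
     D (SOME X'. extends_at A M p X X') (SOME Y'. extends_at A M p Y Y') p"

section \<open>Bronze manifolds and connections of type \<open>(l, m)\<close>\<close>

definition bronze_manifold ::
  "('a::{t2_space, second_countable_topology}, 'b::euclidean_space) atlas \<Rightarrow>
   nat \<Rightarrow> 'a form \<Rightarrow> 'a endo \<Rightarrow> bool" where
  "bronze_manifold A q g J \<longleftrightarrow> smooth_manifold A \<and> 1 \<le> q \<and> q \<le> DIM('b) - 1 \<and>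
     semi_riemannian_metric A q g \<and> smooth_endomorphism A J \<and>
     (\<forall>p. \<forall>u\<in>tangent_space A UNIV p. J p (J p u) = 3 *\<^sub>R J p u + u \<and>
        (\<forall>v\<in>tangent_space A UNIV p. g p (J p u) v = g p u (J p v)))"

definition locally_bronze ::
  "('a::{t2_space, second_countable_topology}, 'b::euclidean_space) atlas \<Rightarrow>
   nat \<Rightarrow> 'a form \<Rightarrow> 'a endo \<Rightarrow> 'a connection \<Rightarrow> bool" where
  "locally_bronze A q g J D \<longleftrightarrow> bronze_manifold A q g J \<and> levi_civita A g D \<and>
     (\<forall>X\<in>vector_fields A. \<forall>Y\<in>vector_fields A. \<forall>p. D X (\<lambda>x. J x (Y x)) p = J p (D X Y p))"

definition lm_data ::
  "('a::topological_space, 'b::euclidean_space) atlas \<Rightarrow> 'a form \<Rightarrow>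
   ('a \<Rightarrow> real) \<Rightarrow> ('a \<Rightarrow> real) \<Rightarrow> 'a vfield \<Rightarrow> bool" where
  "lm_data A g l m \<eta> \<longleftrightarrow> l \<in> smooth_funs A UNIV \<and> m \<in> smooth_funs A UNIV \<and>
     \<not> ((\<forall>p. l p = 0) \<and> (\<forall>p. m p = 0)) \<and>
     \<eta> \<in> vector_fields A \<and> (\<forall>p. g p (\<eta> p) (\<eta> p) = 1)"

definition lm_connection ::
  "'a form \<Rightarrow> 'a endo \<Rightarrow> 'a connection \<Rightarrow> ('a \<Rightarrow> real) \<Rightarrow> ('a \<Rightarrow> real) \<Rightarrow> 'a vfield \<Rightarrow> 'a connection"
  where "lm_connection g J D l m \<eta> X Y p =
     D X Y p + g p (Y p) (\<eta> p) *\<^sub>R (l p *\<^sub>R X p + m p *\<^sub>R J p (X p))"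

section \<open>Lightlike and screen generic submanifolds\<close>

definition normal_bundle ::
  "('a::topological_space, 'b::euclidean_space) atlas \<Rightarrow> 'a form \<Rightarrow> 'a set \<Rightarrow> 'a \<Rightarrow> 'a tvec set" where
  "normal_bundle A g M p =
     {v \<in> tangent_space A UNIV p. \<forall>u\<in>tangent_bundle A M p. g p u v = 0}"

definition radical_bundle ::
  "('a::topological_space, 'b::euclidean_space) atlas \<Rightarrow> 'a form \<Rightarrow> 'a set \<Rightarrow> 'a \<Rightarrow> 'a tvec set" where
  "radical_bundle A g M p = tangent_bundle A M p \<inter> normal_bundle A g M p"

definition lightlike_submanifold ::
  "('a::topological_space, 'b::euclidean_space) atlas \<Rightarrow> 'a form \<Rightarrow> nat \<Rightarrow> nat \<Rightarrow> 'a set \<Rightarrow> bool" where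
  "lightlike_submanifold A g n r M \<longleftrightarrow> submanifold A n M \<and> r > 0 \<and>
     subbundle A M r (radical_bundle A g M)"

text \<open>\<open>F = E \<perp> E'\<close>, as an orthogonal direct sum of bundles over \<open>M\<close>.\<close>

definition orthogonal_sum ::
  "'a form \<Rightarrow> 'a set \<Rightarrow> ('a \<Rightarrow> 'a tvec set) \<Rightarrow> ('a \<Rightarrow> 'a tvec set) \<Rightarrow> ('a \<Rightarrow> 'a tvec set) \<Rightarrow> bool"
  where "orthogonal_sum g M F E E' \<longleftrightarrow> (\<forall>p\<in>M. F p = bundle_sum E E' p \<and> E p \<inter> E' p = {0} \<and>
     (\<forall>u\<in>E p. \<forall>v\<in>E' p. g p u v = 0))"

text \<open>\<open>S\<close>, \<open>S'\<close> and \<open>L\<close> stand for \<open>S(TM)\<close>, \<open>S(TM\<^sup>\<perp>)\<close> and \<open>ltr(TM)\<close>.\<close>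

definition lightlike_frame_choice ::
  "('a::topological_space, 'b::euclidean_space) atlas \<Rightarrow> 'a form \<Rightarrow> nat \<Rightarrow> 'a set \<Rightarrow>
   ('a \<Rightarrow> 'a tvec set) \<Rightarrow> ('a \<Rightarrow> 'a tvec set) \<Rightarrow> ('a \<Rightarrow> 'a tvec set) \<Rightarrow> bool" where
  "lightlike_frame_choice A g r M S S' L \<longleftrightarrow>
     (\<exists>k. subbundle A M k S) \<and> orthogonal_sum g M (tangent_bundle A M) (radical_bundle A g M) S \<and>
     (\<exists>k. subbundle A M k S') \<and> orthogonal_sum g M (normal_bundle A g M) (radical_bundle A g M) S' \<and>
     subbundle A M r L \<and>
     (\<forall>p\<in>M. \<exists>V \<xi> N. open V \<and> p \<in> V \<and>
        (\<forall>i<r. \<xi> i \<in> smooth_sections A (M \<inter> V) \<and> N i \<in> smooth_sections A (M \<inter> V)) \<and>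
        (\<forall>q\<in>M \<inter> V.
           radical_bundle A g M q = span ((\<lambda>i. \<xi> i q) ` {..<r}) \<and>
           L q = span ((\<lambda>i. N i q) ` {..<r}) \<and>
           (\<forall>i<r. (\<forall>u\<in>S q. g q (N i q) u = 0) \<and> (\<forall>u\<in>S' q. g q (N i q) u = 0) \<and>
              (\<forall>j<r. g q (N i q) (\<xi> j q) = (if i = j then 1 else 0) \<and>
                      g q (N i q) (N j q) = 0))))"

text \<open>Components of an ambient tangent vector at \<open>p \<in> M\<close> with respect to
  \<open>TM \<oplus> ltr(TM) \<oplus> S(TM\<^sup>\<perp>)\<close>.\<close>

definition lightlike_components ::
  "('a::topological_space, 'b::euclidean_space) atlas \<Rightarrow> 'a set \<Rightarrow> ('a \<Rightarrow> 'a tvec set) \<Rightarrow>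
   ('a \<Rightarrow> 'a tvec set) \<Rightarrow> 'a \<Rightarrow> 'a tvec \<Rightarrow> 'a tvec \<times> 'a tvec \<times> 'a tvec" where
  "lightlike_components A M L S' p v = (THE (t, a, b).
     t \<in> tangent_bundle A M p \<and> a \<in> L p \<and> b \<in> S' p \<and> v = t + a + b)"

definition tan_part ::
  "('a::topological_space, 'b::euclidean_space) atlas \<Rightarrow> 'a set \<Rightarrow> ('a \<Rightarrow> 'a tvec set) \<Rightarrow>
   ('a \<Rightarrow> 'a tvec set) \<Rightarrow> 'a vfield \<Rightarrow> 'a vfield" where
  "tan_part A M L S' W p = fst (lightlike_components A M L S' p (W p))"

definition ltr_part ::
  "('a::topological_space, 'b::euclidean_space) atlas \<Rightarrow> 'a set \<Rightarrow> ('a \<Rightarrow> 'a tvec set) \<Rightarrow>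
   ('a \<Rightarrow> 'a tvec set) \<Rightarrow> 'a vfield \<Rightarrow> 'a vfield" where
  "ltr_part A M L S' W p = fst (snd (lightlike_components A M L S' p (W p)))"

definition str_part ::
  "('a::topological_space, 'b::euclidean_space) atlas \<Rightarrow> 'a set \<Rightarrow> ('a \<Rightarrow> 'a tvec set) \<Rightarrow>
   ('a \<Rightarrow> 'a tvec set) \<Rightarrow> 'a vfield \<Rightarrow> 'a vfield" where
  "str_part A M L S' W p = snd (snd (lightlike_components A M L S' p (W p)))"

definition app :: "'a endo \<Rightarrow> 'a vfield \<Rightarrow> 'a vfield" where
  "app J X = (\<lambda>p. J p (X p))"

text \<open>\<open>f_part\<close> and \<open>w_part\<close> are the operators \<open>f\<close> and \<open>w\<close> in \<open>J X = f X + w X\<close>.\<close>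

definition f_part ::
  "('a::topological_space, 'b::euclidean_space) atlas \<Rightarrow> 'a endo \<Rightarrow> 'a set \<Rightarrow> ('a \<Rightarrow> 'a tvec set) \<Rightarrow>
   ('a \<Rightarrow> 'a tvec set) \<Rightarrow> 'a vfield \<Rightarrow> 'a vfield" where
  "f_part A J M L S' X = tan_part A M L S' (app J X)"

definition w_part ::
  "('a::topological_space, 'b::euclidean_space) atlas \<Rightarrow> 'a endo \<Rightarrow> 'a set \<Rightarrow> ('a \<Rightarrow> 'a tvec set) \<Rightarrow>
   ('a \<Rightarrow> 'a tvec set) \<Rightarrow> 'a vfield \<Rightarrow> 'a vfield" where
  "w_part A J M L S' X = ltr_part A M L S' (app J X) + str_part A M L S' (app J X)"

definition Bo :: "'a endo \<Rightarrow> ('a \<Rightarrow> 'a tvec set) \<Rightarrow> 'a \<Rightarrow> 'a tvec set" where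
  "Bo J S p = J p ` S p \<inter> S p"

text \<open>Here \<open>B'\<close> is the orthogonal complement of \<open>Bo J S\<close> in \<open>S\<close>. Non-inclusion of bundles is
  failure of inclusion of the fibres at some point.\<close>

definition screen_generic ::
  "('a::topological_space, 'b::euclidean_space) atlas \<Rightarrow> 'a form \<Rightarrow> 'a endo \<Rightarrow> 'a set \<Rightarrow>
   ('a \<Rightarrow> 'a tvec set) \<Rightarrow> ('a \<Rightarrow> 'a tvec set) \<Rightarrow> ('a \<Rightarrow> 'a tvec set) \<Rightarrow> ('a \<Rightarrow> 'a tvec set) \<Rightarrow> bool"
  where "screen_generic A g J M S S' L B' \<longleftrightarrow>
     (\<forall>p\<in>M. J p ` radical_bundle A g M p = radical_bundle A g M p) \<and>
     (\<exists>k. subbundle A M k (Bo J S)) \<and> (\<forall>p\<in>M. nondegenerate_on (g p) (Bo J S p)) \<and>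
     (\<exists>k. subbundle A M k B') \<and> (\<forall>p\<in>M. nondegenerate_on (g p) (B' p)) \<and>
     orthogonal_sum g M S (Bo J S) B' \<and>
     ((\<exists>p\<in>M. B' p \<noteq> {0}) \<longrightarrow>
        (\<exists>p\<in>M. \<not> J p ` B' p \<subseteq> S p) \<and> (\<exists>p\<in>M. \<not> J p ` B' p \<subseteq> S' p)) \<and>
     (\<forall>Y\<in>sections_of A M B'. f_part A J M L S' Y \<in> sections_of A M B' \<and>
        w_part A J M L S' Y \<in> sections_of A M S')"

section \<open>Induced objects\<close>

definition induced_connection ::
  "('a::topological_space, 'b::euclidean_space) atlas \<Rightarrow> 'a set \<Rightarrow> ('a \<Rightarrow> 'a tvec set) \<Rightarrow>
   ('a \<Rightarrow> 'a tvec set) \<Rightarrow> 'a connection \<Rightarrow> 'a connection" where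
  "induced_connection A M L S' D X Y = tan_part A M L S' (connection_along A M D X Y)"

definition induced_hs ::
  "('a::topological_space, 'b::euclidean_space) atlas \<Rightarrow> 'a set \<Rightarrow> ('a \<Rightarrow> 'a tvec set) \<Rightarrow>
   ('a \<Rightarrow> 'a tvec set) \<Rightarrow> 'a connection \<Rightarrow> 'a connection" where
  "induced_hs A M L S' D X Y = str_part A M L S' (connection_along A M D X Y)"

end

(* A screen generic lightlike submanifold splits TM into B and the non-degenerate bundle B', which
   is orthogonal to B, so B is integrable iff g([X,Y],Z) = 0 for all X, Y in B and Z in B'. Since B is
   J-invariant and orthogonal to B', the correction term of the (l,m)-type connection is invisible when
   paired with Z or JZ. With nabla J = 0 and J^2 = 3J + I one gets, for the ambient (l,m)-connection,
     g(Omega_X JY, JZ) = 3 g(J nabla_X Y, Z) + g(nabla_X Y, Z)  and  g(Omega_X JY, Z) = g(J nabla_X Y, Z),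
   so the displayed condition says exactly g(nabla_X Y - nabla_Y X, Z) = 0.

   Tangent vectors being derivations, that sections along M extend locally to ambient vector fields
   rests on bump functions and on Hadamard's lemma; that the tangential, ltr and S(TM^perp) components
   exist rests on the double orthogonal complement of TM. *)

theory Submission
  imports Defs
begin

section \<open>Calculus of smooth maps\<close>

text \<open>The factor 3 in the displayed condition is the 3 of J^2 = 3J + I: writing E and E' for
  the covariant derivatives of Y along X and of X along Y, the left side is 3 g(JE,Z) + g(E,Z) + 3
  g(JE',Z) and the right side is the same with E and E' exchanged, so the terms in J cancel
  crosswise. The obstacle is that \<open>connection_along\<close> evaluates D on extensions picked
  by \<open>SOME\<close>, and the one picked for \<open>app J Y\<close> need not be J applied to the
  one picked for Y. Only the second argument is affected, and only pairings with ambient fields have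
  to be compared, which is less than full locality of D. The same extensions of X and Y serve for
  both orders, so torsion-freeness applies to them directly. The condition quantifies over sections
  of B', whereas non-degeneracy concerns one fibre; sections with a prescribed value at a point
  bridge the two. The components are found by linear algebra in a single fibre without counting
  dimensions: projections and double complements both come from representing linear functionals by
  vectors of a finite span.\<close>

lemma Ck_on_cong:
  assumes "open S" "\<And>x. x \<in> S \<Longrightarrow> f x = g x" "Ck_on k S f"
  shows "Ck_on k S g"
  using assms(2,3)
proof (induction k arbitrary: f g)
  case 0
  then show ?case using continuous_on_cong[of S S f g] by (simp only: Ck_on.simps)
next
  case (Suc k)
  have *: "(g has_derivative frechet_derivative f (at x)) (at x)" if x: "x \<in> S" for x
  proof -
    have "(f has_derivative frechet_derivative f (at x)) (at x)"
      using Suc.prems(2) x by (simp add: frechet_derivative_works)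
    then show ?thesis
      using has_derivative_transform_within_open[OF _ assms(1) x] Suc.prems(1) by blast
  qed
  have eq: "frechet_derivative f (at x) = frechet_derivative g (at x)" if "x \<in> S" for x
    by (rule frechet_derivative_at[OF *[OF that]])
  have "Ck_on k S (\<lambda>x. frechet_derivative g (at x) v)" for v
  proof (rule Suc.IH)
    show "Ck_on k S (\<lambda>x. frechet_derivative f (at x) v)" using Suc.prems(2) by simp
  qed (simp add: eq)
  then show ?case using * by (auto simp: differentiable_def)
qed

text \<open>Lets the inductions below exhibit a derivative in closed form instead of handling the
  chosen value \<open>frechet_derivative\<close>. Openness of \<open>S\<close> enters through
  \<open>Ck_on_cong\<close>: agreement on \<open>S\<close> has to give agreement of higher
  derivatives.\<close>

lemma Ck_on_has_derivativeI:
  assumes "open S" "\<And>x. x \<in> S \<Longrightarrow> (f has_derivative f' x) (at x)"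
    and "\<And>v. Ck_on k S (\<lambda>x. f' x v)"
  shows "Ck_on (Suc k) S f"
proof -
  have "f' x = frechet_derivative f (at x)" if "x \<in> S" for x
    using assms(2)[OF that] by (metis frechet_derivative_at)
  then have "Ck_on k S (\<lambda>x. frechet_derivative f (at x) v)" for v
    using Ck_on_cong[OF assms(1) _ assms(3)] by simp
  then show ?thesis
    using assms(2) by (auto simp: differentiable_def)
qed

lemma Ck_on_has_derivative:
  assumes "Ck_on (Suc k) S f" "x \<in> S"
  shows "(f has_derivative frechet_derivative f (at x)) (at x)"
  using assms by (simp add: frechet_derivative_works)

lemma Ck_on_imp_continuous_on:
  assumes "Ck_on k S f"
  shows "continuous_on S f"
proof (cases k)
  case (Suc j)
  then show ?thesis
    using assms by (auto intro!: continuous_at_imp_continuous_on differentiable_imp_continuous_within)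
qed (use assms in auto)

lemma Ck_on_SucD: "Ck_on (Suc k) S f \<Longrightarrow> Ck_on k S f"
proof (induction k arbitrary: f)
  case 0
  show ?case using Ck_on_imp_continuous_on[OF 0] by simp
next
  case (Suc k)
  have "Ck_on k S (\<lambda>x. frechet_derivative f (at x) v)" for v
    using Suc.prems by (intro Suc.IH) simp
  then show ?case using Suc.prems by simp
qed

lemma Ck_on_subset: "Ck_on k S f \<Longrightarrow> T \<subseteq> S \<Longrightarrow> Ck_on k T f"
proof (induction k arbitrary: f)
  case 0
  then show ?case using continuous_on_subset by simp blast
next
  case (Suc k)
  then show ?case by auto
qed

lemma Ck_on_locally:
  assumes "\<And>x. x \<in> S \<Longrightarrow> \<exists>T. open T \<and> x \<in> T \<and> Ck_on k T f"
  shows "Ck_on k S f"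
  using assms
proof (induction k arbitrary: f)
  case 0
  show ?case unfolding Ck_on.simps continuous_on_eq_continuous_within
  proof
    fix x assume "x \<in> S"
    from 0[OF this] obtain T where "open T" "x \<in> T" "continuous_on T f" by auto
    then show "continuous (at x within S) f"
      by (meson continuous_at_imp_continuous_at_within continuous_on_eq_continuous_at)
  qed
next
  case (Suc k)
  have "f differentiable (at x)" if "x \<in> S" for x
    using Suc.prems[OF that] by auto
  moreover have "Ck_on k S (\<lambda>x. frechet_derivative f (at x) v)" for v
  proof (rule Suc.IH)
    fix x assume "x \<in> S"
    from Suc.prems[OF this] show "\<exists>T. open T \<and> x \<in> T \<and> Ck_on k T (\<lambda>x. frechet_derivative f (at x) v)"
      by auto
  qed
  ultimately show ?case by simp
qed

lemma Ck_on_const: "Ck_on k S (\<lambda>x. c)"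
proof (induction k arbitrary: c)
  case (Suc k)
  show ?case by (simp add: Suc frechet_derivative_const)
qed simp

lemma Ck_on_bounded_linear:
  assumes "bounded_linear h" "open S" "Ck_on k S f"
  shows "Ck_on k S (\<lambda>x. h (f x))"
  using assms(3)
proof (induction k arbitrary: f)
  case 0
  then show ?case using bounded_linear.continuous_on[OF assms(1)] by simp
next
  case (Suc k)
  show ?case
  proof (rule Ck_on_has_derivativeI[OF assms(2)])
    fix x assume "x \<in> S"
    then show "((\<lambda>x. h (f x)) has_derivative (\<lambda>v. h (frechet_derivative f (at x) v))) (at x)"
      using bounded_linear.has_derivative[OF assms(1) Ck_on_has_derivative[OF Suc.prems]] by blast
  qed (use Suc in auto)
qed

lemma Ck_on_add:
  assumes "open S" "Ck_on k S f" "Ck_on k S g"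
  shows "Ck_on k S (\<lambda>x. f x + g x)"
  using assms(2,3)
proof (induction k arbitrary: f g)
  case 0
  then show ?case by (auto intro: continuous_intros)
next
  case (Suc k)
  show ?case
  proof (rule Ck_on_has_derivativeI[OF assms(1)])
    fix x assume "x \<in> S"
    then show "((\<lambda>x. f x + g x) has_derivative
        (\<lambda>v. frechet_derivative f (at x) v + frechet_derivative g (at x) v)) (at x)"
      using Suc.prems by (auto intro!: has_derivative_add Ck_on_has_derivative)
  qed (use Suc in auto)
qed

lemma Ck_on_bilinear:
  assumes "bounded_bilinear pr" "open S" "Ck_on k S f" "Ck_on k S g"
  shows "Ck_on k S (\<lambda>x. pr (f x) (g x))"
  using assms(3,4)
proof (induction k arbitrary: f g)
  case 0
  then show ?case using bounded_bilinear.continuous_on[OF assms(1)] by auto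
next
  case (Suc k)
  show ?case
  proof (rule Ck_on_has_derivativeI[OF assms(2)])
    fix x assume "x \<in> S"
    then show "((\<lambda>x. pr (f x) (g x)) has_derivative
        (\<lambda>v. pr (f x) (frechet_derivative g (at x) v) + pr (frechet_derivative f (at x) v) (g x))) (at x)"
      using Suc.prems by (auto intro!: bounded_bilinear.FDERIV[OF assms(1)] Ck_on_has_derivative)
  next
    fix v
    have "Ck_on k S f" "Ck_on k S g" using Suc.prems Ck_on_SucD by blast+
    then show "Ck_on k S (\<lambda>x. pr (f x) (frechet_derivative g (at x) v) +
        pr (frechet_derivative f (at x) v) (g x))"
      using Suc by (intro Ck_on_add[OF assms(2)]) auto
  qed
qed

lemma Ck_on_sum:
  assumes "open S" "\<And>i. i \<in> I \<Longrightarrow> Ck_on k S (f i)"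
  shows "Ck_on k S (\<lambda>x. \<Sum>i\<in>I. f i x)"
  using assms(2)
  by (induction I rule: infinite_finite_induct) (auto intro!: Ck_on_const Ck_on_add assms(1))

lemma Ck_on_linear:
  assumes "bounded_linear h" "open S"
  shows "Ck_on k S h"
proof (cases k)
  case 0
  then show ?thesis using linear_continuous_on[OF assms(1)] by simp
next
  case (Suc j)
  show ?thesis unfolding Suc
    by (rule Ck_on_has_derivativeI[OF assms(2), where f' = "\<lambda>_. h"])
      (auto intro: bounded_linear_imp_has_derivative assms Ck_on_const)
qed

text \<open>Induction over \<open>k\<close> with \<open>h\<close> arbitrary: by the chain rule the
  derivative is built from directional derivatives of \<open>f\<close> and from \<open>h\<close>'s
  directional derivatives composed with the same \<open>f\<close>.\<close>

lemma Ck_on_compose: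
  fixes f :: "'b::euclidean_space \<Rightarrow> 'c::euclidean_space"
  assumes "open S" "open T" "f ` S \<subseteq> T" "Ck_on k S f" "Ck_on k T h"
  shows "Ck_on k S (\<lambda>x. h (f x))"
  using assms(4,5)
proof (induction k arbitrary: h)
  case 0
  then show ?case using continuous_on_compose2[of T h S f] assms(3) by auto
next
  case (Suc k)
  \<comment> \<open>The chain rule feeds the derivative of \<open>h\<close> a direction that varies
    with \<open>x\<close>, which the induction hypothesis does not cover. Expanding that direction
    in \<open>Basis\<close> leaves only derivatives of \<open>h\<close> in fixed directions.\<close>
  let ?D = "\<lambda>x v. \<Sum>b\<in>Basis. (frechet_derivative f (at x) v \<bullet> b) *\<^sub>R frechet_derivative h (at (f x)) b"
  show ?case
  proof (rule Ck_on_has_derivativeI[OF assms(1)])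
    fix x assume x: "x \<in> S"
    let ?F = "frechet_derivative f (at x)" and ?H = "frechet_derivative h (at (f x))"
    have F: "(f has_derivative ?F) (at x)" using Ck_on_has_derivative[OF Suc.prems(1) x] .
    have H: "(h has_derivative ?H) (at (f x))"
      using Ck_on_has_derivative[OF Suc.prems(2)] x assms(3) by blast
    have "?H (?F v) = ?D x v" for v
    proof -
      interpret linear ?H using H has_derivative_linear by blast
      have "?H (?F v) = ?H (\<Sum>b\<in>Basis. (?F v \<bullet> b) *\<^sub>R b)" by (simp add: euclidean_representation)
      also have "\<dots> = ?D x v" by (simp only: sum scale)
      finally show ?thesis .
    qed
    then have "(\<lambda>v. ?H (?F v)) = ?D x" by auto
    then show "((\<lambda>x. h (f x)) has_derivative ?D x) (at x)"
      using has_derivative_compose[OF F H] by simp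
  next
    fix v
    have f: "Ck_on k S f" using Suc.prems(1) Ck_on_SucD by blast
    show "Ck_on k S (\<lambda>x. ?D x v)"
    proof (intro Ck_on_sum Ck_on_bilinear[OF bounded_bilinear_scaleR] assms(1))
      fix b :: 'c
      show "Ck_on k S (\<lambda>x. frechet_derivative f (at x) v \<bullet> b)"
        using Suc.prems(1) by (intro Ck_on_bounded_linear[OF bounded_linear_inner_left] assms(1)) auto
      show "Ck_on k S (\<lambda>x. frechet_derivative h (at (f x)) b)"
        using Suc.prems(2) by (intro Suc.IH f) auto
    qed
  qed
qed

section \<open>Smooth maps, by quantifying over the order of differentiability\<close>

lemma smooth_on_cong:
  "smooth_on S f \<Longrightarrow> open S \<Longrightarrow> (\<And>x. x \<in> S \<Longrightarrow> f x = g x) \<Longrightarrow> smooth_on S g"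
  unfolding smooth_on_def using Ck_on_cong[of S f g] by blast

lemma smooth_on_subset: "smooth_on S f \<Longrightarrow> T \<subseteq> S \<Longrightarrow> smooth_on T f"
  unfolding smooth_on_def using Ck_on_subset[of _ S f T] by blast

lemma smooth_on_locally:
  "(\<And>x. x \<in> S \<Longrightarrow> \<exists>T. open T \<and> x \<in> T \<and> smooth_on T f) \<Longrightarrow> smooth_on S f"
  unfolding smooth_on_def by (intro allI Ck_on_locally) blast

lemma smooth_on_const: "smooth_on S (\<lambda>x. c)"
  by (simp add: smooth_on_def Ck_on_const)

lemma smooth_on_linear: "bounded_linear h \<Longrightarrow> open S \<Longrightarrow> smooth_on S h"
  by (simp add: smooth_on_def Ck_on_linear)

lemma smooth_on_bounded_linear:
  "bounded_linear h \<Longrightarrow> open S \<Longrightarrow> smooth_on S f \<Longrightarrow> smooth_on S (\<lambda>x. h (f x))"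
  by (simp add: smooth_on_def Ck_on_bounded_linear)

lemma smooth_on_add:
  "open S \<Longrightarrow> smooth_on S f \<Longrightarrow> smooth_on S h \<Longrightarrow> smooth_on S (\<lambda>x. f x + h x)"
  by (simp add: smooth_on_def Ck_on_add)

lemma smooth_on_bilinear:
  "bounded_bilinear pr \<Longrightarrow> open S \<Longrightarrow> smooth_on S f \<Longrightarrow> smooth_on S h \<Longrightarrow>
    smooth_on S (\<lambda>x. pr (f x) (h x))"
  by (simp add: smooth_on_def Ck_on_bilinear)

lemma smooth_on_mult:
  fixes f h :: "'b::euclidean_space \<Rightarrow> real"
  shows "open S \<Longrightarrow> smooth_on S f \<Longrightarrow> smooth_on S h \<Longrightarrow> smooth_on S (\<lambda>x. f x * h x)"
  by (rule smooth_on_bilinear[OF bounded_bilinear_mult])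

lemma smooth_on_diff:
  assumes "open S" "smooth_on S f" "smooth_on S h"
  shows "smooth_on S (\<lambda>x. f x - h x)"
  using smooth_on_add[OF assms(1,2) smooth_on_bounded_linear[OF bounded_linear_minus[OF bounded_linear_ident] assms(1,3)]]
  by simp

lemma smooth_on_sum:
  "open S \<Longrightarrow> (\<And>i. i \<in> I \<Longrightarrow> smooth_on S (f i)) \<Longrightarrow> smooth_on S (\<lambda>x. \<Sum>i\<in>I. f i x)"
  by (simp add: smooth_on_def Ck_on_sum)

lemma smooth_on_compose:
  fixes f :: "'b::euclidean_space \<Rightarrow> 'c::euclidean_space"
  shows "open S \<Longrightarrow> open T \<Longrightarrow> f ` S \<subseteq> T \<Longrightarrow> smooth_on S f \<Longrightarrow> smooth_on T h \<Longrightarrow>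
    smooth_on S (\<lambda>x. h (f x))"
  unfolding smooth_on_def using Ck_on_compose[of S T f _ h] by blast

lemma smooth_on_imp_continuous_on: "smooth_on S f \<Longrightarrow> continuous_on S f"
  using Ck_on_imp_continuous_on[of 0 S f] by (simp add: smooth_on_def)

lemma smooth_on_has_derivative:
  "smooth_on S f \<Longrightarrow> x \<in> S \<Longrightarrow> (f has_derivative frechet_derivative f (at x)) (at x)"
  using Ck_on_has_derivative[of 0 S f x] unfolding smooth_on_def by blast

lemma smooth_on_frechet_derivative:
  "smooth_on S f \<Longrightarrow> smooth_on S (\<lambda>x. frechet_derivative f (at x) v)"
proof -
  assume *: "smooth_on S f"
  have "Ck_on (Suc k) S f" for k using * by (simp add: smooth_on_def del: Ck_on.simps)
  then show ?thesis by (simp add: smooth_on_def)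
qed

text \<open>A family closed under differentiation, up to linear combinations with constant
  coefficients, consists of smooth functions: the induction on the order runs over all members
  simultaneously.\<close>

lemma smooth_on_has_real_derivativeI:
  fixes f :: "nat \<Rightarrow> real \<Rightarrow> real"
  assumes "open S" "\<And>n x. x \<in> S \<Longrightarrow> (f n has_real_derivative (\<Sum>i\<in>I n. c n i * f i x)) (at x)"
  shows "smooth_on S (f n)"
proof -
  have "Ck_on k S (f n)" for k
  proof (induction k arbitrary: n)
    case 0
    show ?case using assms(2)
      by (auto intro: continuous_at_imp_continuous_on DERIV_isCont)
  next
    case (Suc k)
    show ?case
      by (rule Ck_on_has_derivativeI[OF assms(1) assms(2)[unfolded has_field_derivative_def]])
        (auto intro!: Ck_on_bilinear[OF bounded_bilinear_mult] Ck_on_sum Ck_on_const assms(1) Suc)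
  qed
  then show ?thesis by (simp add: smooth_on_def)
qed

section \<open>Bump functions and Hadamard's lemma\<close>

definition flat_exp :: "nat \<Rightarrow> real \<Rightarrow> real" where
  "flat_exp n t = (if t > 0 then exp (- (1 / t)) / t ^ n else 0)"

text \<open>From the right, the substitution s = 1/t turns the claim into s^n / exp s tending to 0
  at infinity; from the left the function is constantly 0.\<close>

lemma flat_exp_tendsto_0: "(flat_exp n \<longlongrightarrow> 0) (at 0)"
proof -
  have "((\<lambda>t::real. inverse t ^ n / exp (inverse t)) \<longlongrightarrow> 0) (at_right 0)"
    by (rule filterlim_compose[OF tendsto_power_div_exp_0 filterlim_inverse_at_top_right])
  moreover have "\<forall>\<^sub>F t in at_right 0. inverse t ^ n / exp (inverse t) = flat_exp n t"
    by (rule eventually_at_right_less[THEN eventually_mono])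
      (auto simp: flat_exp_def exp_minus field_simps)
  ultimately have "(flat_exp n \<longlongrightarrow> 0) (at_right 0)"
    using tendsto_cong by fast
  moreover have "\<forall>\<^sub>F t in at_left 0. 0 = flat_exp n t"
    using eventually_at_left_real[of "-1" 0] by (auto elim!: eventually_mono simp: flat_exp_def)
  then have "(flat_exp n \<longlongrightarrow> 0) (at_left 0)"
    using tendsto_cong tendsto_const by fast
  ultimately show ?thesis by (simp add: filterlim_split_at)
qed

text \<open>Differentiating exp(-1/t)/t^n produces members n + 2 and n + 1 of the same family; the
  exponent is a parameter of \<open>flat_exp\<close> for the sake of this closure.\<close>

lemma flat_exp_has_derivative:
  "(flat_exp n has_real_derivative (flat_exp (n + 2) t - real n * flat_exp (n + 1) t)) (at t)"
proof (cases t "0::real" rule: linorder_cases)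
  case less
  have "((\<lambda>_. 0) has_real_derivative (flat_exp (n + 2) t - real n * flat_exp (n + 1) t)) (at t)"
    using less by (simp add: flat_exp_def)
  then show ?thesis
    by (rule DERIV_cong_ev[THEN iffD1, rotated 3])
      (use less in \<open>auto simp: flat_exp_def eventually_nhds intro!: exI[of _ "{..<0}"]\<close>)
next
  case equal
  \<comment> \<open>Dividing by \<open>h\<close> raises the exponent, so the difference quotient at
    0 is \<open>flat_exp (Suc n)\<close> itself.\<close>
  have "((\<lambda>h. (flat_exp n (0 + h) - flat_exp n 0) / h) \<longlongrightarrow> 0) (at 0)"
    by (rule Lim_transform_eventually[OF flat_exp_tendsto_0[of "Suc n"]])
      (auto simp: flat_exp_def)
  then show ?thesis using equal by (simp add: DERIV_def flat_exp_def)
next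
  case greater
  have "((\<lambda>s. exp (- (1 / s)) / s ^ n) has_real_derivative
      (flat_exp (n + 2) t - real n * flat_exp (n + 1) t)) (at t)"
    using greater
    by (cases n) (auto intro!: derivative_eq_intros simp: flat_exp_def field_simps power2_eq_square,
        metis One_nat_def power_eq_if)
  then show ?thesis
    by (rule DERIV_cong_ev[THEN iffD1, rotated 3])
      (use greater in \<open>auto simp: flat_exp_def eventually_nhds intro!: exI[of _ "{0<..}"]\<close>)
qed

lemma smooth_on_flat_exp: "smooth_on UNIV (flat_exp n)"
proof (rule smooth_on_has_real_derivativeI[where I = "\<lambda>n. {n + 1, n + 2}"
      and c = "\<lambda>n i. if i = n + 2 then 1 else - real n"])
  fix n t
  show "(flat_exp n has_real_derivative
      (\<Sum>i\<in>{n + 1, n + 2}. (if i = n + 2 then 1 else - real n) * flat_exp i t)) (at t)"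
    using flat_exp_has_derivative[of n t] by (simp add: algebra_simps)
qed simp

text \<open>The powers of the inverse form a closed family: the derivative of the n-th is -n times
  the next.\<close>

lemma smooth_on_inverse: "smooth_on {0<..} (inverse :: real \<Rightarrow> real)"
proof -
  have "smooth_on {0<..} (\<lambda>t::real. inverse t ^ n)" for n
  proof (rule smooth_on_has_real_derivativeI[where I = "\<lambda>n. {n + 1}" and c = "\<lambda>n _. - real n"
        and f = "\<lambda>n t. inverse t ^ n"])
    fix n and t :: real assume "t \<in> {0<..}"
    then show "((\<lambda>t. inverse t ^ n) has_real_derivative (\<Sum>i\<in>{n + 1}. - real n * inverse t ^ i)) (at t)"
      by (cases n) (auto intro!: derivative_eq_intros simp: field_simps, metis One_nat_def power_eq_if)
  qed simp
  from this[of 1] show ?thesis by simp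
qed

text \<open>The usual quotient u/(u+v), with u positive exactly inside radius 2s and v positive
  exactly outside radius s; the two regions cover the space, so the denominator never vanishes.
  Working with the squared distance \<open>d\<close> avoids the singularity of the norm at the
  centre.\<close>

lemma plateau_exists:
  fixes a :: "'b::euclidean_space"
  assumes "s > 0"
  obtains \<beta> :: "'b \<Rightarrow> real"
  where "smooth_on UNIV \<beta>" "\<And>x. dist a x \<le> s \<Longrightarrow> \<beta> x = 1" "\<And>x. dist a x \<ge> 2 * s \<Longrightarrow> \<beta> x = 0"
proof -
  define d where "d x = (x - a) \<bullet> (x - a)" for x
  have d: "d x = (dist a x)\<^sup>2" for x by (simp add: d_def dist_norm norm_minus_commute[of a] power2_norm_eq_inner)
  have "smooth_on UNIV (\<lambda>x::'b. x - a)"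
    by (intro smooth_on_diff smooth_on_const smooth_on_linear) auto
  then have d_smooth: "smooth_on UNIV d"
    unfolding d_def by (intro smooth_on_bilinear[OF bounded_bilinear_inner]) auto
  define u where "u x = flat_exp 0 (4 * s\<^sup>2 - d x)" for x
  define v where "v x = flat_exp 0 (d x - s\<^sup>2)" for x
  have u: "smooth_on UNIV u" unfolding u_def
    by (rule smooth_on_compose[OF open_UNIV open_UNIV _ _ smooth_on_flat_exp])
      (auto intro!: smooth_on_diff smooth_on_const d_smooth)
  have v: "smooth_on UNIV v" unfolding v_def
    by (rule smooth_on_compose[OF open_UNIV open_UNIV _ _ smooth_on_flat_exp])
      (auto intro!: smooth_on_diff smooth_on_const d_smooth)
  have nonneg: "u x \<ge> 0" "v x \<ge> 0" for x by (auto simp: u_def v_def flat_exp_def)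
  have pos: "u x + v x > 0" for x
  proof (cases "d x < 4 * s\<^sup>2")
    case True
    then have "u x > 0" by (simp add: u_def flat_exp_def)
    then show ?thesis using nonneg(2)[of x] by simp
  next
    case False
    moreover have "s\<^sup>2 > 0" using assms by simp
    ultimately have "d x - s\<^sup>2 > 0" by linarith
    then have "v x > 0" by (simp add: v_def flat_exp_def)
    then show ?thesis using nonneg(1)[of x] by simp
  qed
  show thesis
  proof
    have "smooth_on UNIV (\<lambda>x. inverse (u x + v x))"
      by (rule smooth_on_compose[OF open_UNIV _ _ _ smooth_on_inverse])
        (auto intro!: smooth_on_add u v pos)
    then show "smooth_on UNIV (\<lambda>x. u x * inverse (u x + v x))"
      by (intro smooth_on_mult u) auto
    show "u x * inverse (u x + v x) = 1" if "dist a x \<le> s" for x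
    proof -
      have "d x \<le> s\<^sup>2" using that assms by (simp add: d power_mono)
      then have "v x = 0" by (simp add: v_def flat_exp_def)
      then show ?thesis using pos[of x] by simp
    qed
    show "u x * inverse (u x + v x) = 0" if "dist a x \<ge> 2 * s" for x
    proof -
      have "(2 * s)\<^sup>2 \<le> d x" unfolding d using that assms by (intro power_mono) auto
      then show ?thesis by (simp add: u_def flat_exp_def power2_eq_square)
    qed
  qed
qed

text \<open>Differentiating under the integral brings out one factor \<open>t\<close> by the chain
  rule. Allowing an arbitrary power of \<open>t\<close> makes the statement stable under
  differentiation, so the induction closes; Hadamard's lemma takes \<open>j = 0\<close>.\<close>

lemma smooth_on_integral_segment:
  fixes G :: "'b::euclidean_space \<Rightarrow> real"
  assumes "smooth_on UNIV G"
  shows "smooth_on UNIV (\<lambda>x. integral {0..1} (\<lambda>t. t ^ j * G (a + t *\<^sub>R (x - a))))"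
proof -
  have cont: "continuous_on U (\<lambda>(x, t). t ^ j * G (a + t *\<^sub>R (x - a)))"
    if "continuous_on UNIV G" for U j and G :: "'b \<Rightarrow> real"
    unfolding split_beta by (intro continuous_intros continuous_on_compose2[OF that]) auto
  have "Ck_on k UNIV (\<lambda>x. integral {0..1} (\<lambda>t. t ^ j * G (a + t *\<^sub>R (x - a))))" for k
    using assms
  proof (induction k arbitrary: j G)
    case 0
    have "continuous_on UNIV (\<lambda>x. integral (cbox 0 1) (\<lambda>t. t ^ j * G (a + t *\<^sub>R (x - a))))"
      by (rule integral_continuous_on_param) (rule cont[OF smooth_on_imp_continuous_on[OF 0]])
    then show ?case by simp
  next
    case (Suc k)
    define DG where "DG x v = frechet_derivative G (at x) v" for x v
    have DG: "(G has_derivative DG x) (at x)" for x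
      unfolding DG_def[abs_def] using smooth_on_has_derivative[OF Suc.prems] by simp
    have DGs: "smooth_on UNIV (\<lambda>x. DG x v)" for v
      unfolding DG_def using smooth_on_frechet_derivative[OF Suc.prems] .
    \<comment> \<open>The Leibniz rule wants the derivative as a bounded linear operator depending
      continuously on (x, t). In finite dimension that continuity can be checked on basis
      directions.\<close>
    define f' where "f' x t = Blinfun (\<lambda>v. t ^ Suc j * DG (a + t *\<^sub>R (x - a)) v)" for x t
    have bl: "bounded_linear (\<lambda>v. t ^ Suc j * DG (a + t *\<^sub>R (x - a)) v)" for x and t :: real
      by (intro bounded_linear_intros has_derivative_bounded_linear[OF DG])
    have f': "blinfun_apply (f' x t) = (\<lambda>v. t ^ Suc j * DG (a + t *\<^sub>R (x - a)) v)" for x t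
      unfolding f'_def using bounded_linear_Blinfun_apply[OF bl] .
    have f'_cont: "continuous_on U (\<lambda>(x, t). f' x t)" for U
      unfolding split_beta
      by (rule continuous_on_blinfun_componentwise)
        (use cont[OF smooth_on_imp_continuous_on[OF DGs], of _ "Suc j"] in
          \<open>simp add: f' split_beta\<close>)
    have f'_int: "f' x integrable_on cbox 0 1" for x
    proof -
      have "continuous_on (cbox 0 1) ((\<lambda>(x, t). f' x t) \<circ> (\<lambda>t. (x, t)))"
        by (intro continuous_on_compose f'_cont continuous_intros)
      then show ?thesis by (intro integrable_continuous) (simp add: o_def)
    qed
    show ?case
    proof (rule Ck_on_has_derivativeI[OF open_UNIV])
      fix x :: 'b
      have "((\<lambda>x. integral (cbox 0 1) (\<lambda>t. t ^ j * G (a + t *\<^sub>R (x - a)))) has_derivative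
          integral (cbox 0 1) (f' x)) (at x within UNIV)"
      proof (rule leibniz_rule[OF _ _ f'_cont])
        fix x and t :: real
        have 1: "((\<lambda>x. a + t *\<^sub>R (x - a)) has_derivative (\<lambda>v. t *\<^sub>R v)) (at x)"
          by (auto intro!: derivative_eq_intros)
        interpret linear "DG (a + t *\<^sub>R (x - a))" using DG has_derivative_linear by blast
        from has_derivative_mult_right[OF has_derivative_compose[OF 1 DG], of "t ^ j"]
        show "((\<lambda>x. t ^ j * G (a + t *\<^sub>R (x - a))) has_derivative blinfun_apply (f' x t)) (at x within UNIV)"
          by (simp add: f' scale mult_ac)
      next
        fix x :: 'b
        have "continuous_on (cbox 0 1) ((\<lambda>(x, t). t ^ j * G (a + t *\<^sub>R (x - a))) \<circ> (\<lambda>t. (x, t)))"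
          by (intro continuous_on_compose cont smooth_on_imp_continuous_on[OF Suc.prems] continuous_intros)
        then show "(\<lambda>t. t ^ j * G (a + t *\<^sub>R (x - a))) integrable_on cbox 0 1"
          by (intro integrable_continuous) (simp add: o_def)
      qed auto
      then show "((\<lambda>x. integral {0..1} (\<lambda>t. t ^ j * G (a + t *\<^sub>R (x - a)))) has_derivative
          integral {0..1} (f' x)) (at x)" by simp
    next
      fix v
      have "blinfun_apply (integral {0..1} (f' x)) v =
          integral {0..1} (\<lambda>t. t ^ Suc j * DG (a + t *\<^sub>R (x - a)) v)" for x
        using blinfun_apply_integral[OF f'_int, of x v] by (simp add: f')
      then show "Ck_on k UNIV (\<lambda>x. blinfun_apply (integral {0..1} (f' x)) v)"
        using Suc.IH[OF DGs, of "Suc j" v] by simp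
    qed
  qed
  then show ?thesis by (simp add: smooth_on_def)
qed

text \<open>The fundamental theorem of calculus along the segment from \<open>a\<close> to
  \<open>x\<close>, with the derivative in direction \<open>x - a\<close> split over
  \<open>Basis\<close>. At \<open>x = a\<close> the integrand is constant in \<open>t\<close>, which
  gives the value of \<open>H b a\<close>. Smoothness on the whole space keeps every segment inside
  the domain.\<close>

lemma hadamard:
  fixes F :: "'b::euclidean_space \<Rightarrow> real"
  assumes "smooth_on UNIV F"
  obtains H where "\<And>b. smooth_on UNIV (H b)" "\<And>b. H b a = frechet_derivative F (at a) b"
    "\<And>x. F x = F a + (\<Sum>b\<in>Basis. ((x - a) \<bullet> b) * H b x)"
proof -
  define DF where "DF x v = frechet_derivative F (at x) v" for x v
  have DF: "(F has_derivative DF x) (at x)" for x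
    unfolding DF_def[abs_def] using smooth_on_has_derivative[OF assms] by simp
  have DFs: "smooth_on UNIV (\<lambda>x. DF x v)" for v
    unfolding DF_def using smooth_on_frechet_derivative[OF assms] .
  define H where "H b x = integral {0..1} (\<lambda>t. DF (a + t *\<^sub>R (x - a)) b)" for b x
  show thesis
  proof
    show "smooth_on UNIV (H b)" for b
      unfolding H_def using smooth_on_integral_segment[OF DFs, of 0] by simp
    show "H b a = frechet_derivative F (at a) b" for b by (simp add: H_def DF_def)
    fix x
    have int: "(\<lambda>t. ((x - a) \<bullet> b) * DF (a + t *\<^sub>R (x - a)) b) integrable_on {0..1}" for b
      by (intro integrable_continuous_real continuous_intros
          continuous_on_compose2[OF smooth_on_imp_continuous_on[OF DFs]]) auto
    have "((\<lambda>t. DF (a + t *\<^sub>R (x - a)) (x - a)) has_integral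
        (F (a + 1 *\<^sub>R (x - a)) - F (a + 0 *\<^sub>R (x - a)))) {0..1}"
    proof (rule fundamental_theorem_of_calculus)
      fix t :: real
      have 1: "((\<lambda>t. a + t *\<^sub>R (x - a)) has_derivative (\<lambda>s. s *\<^sub>R (x - a))) (at t within {0..1})"
        by (auto intro!: derivative_eq_intros)
      interpret linear "DF (a + t *\<^sub>R (x - a))" using DF has_derivative_linear by blast
      from has_derivative_compose[OF 1 DF]
      show "((\<lambda>t. F (a + t *\<^sub>R (x - a))) has_vector_derivative DF (a + t *\<^sub>R (x - a)) (x - a)) (at t within {0..1})"
        by (simp add: has_vector_derivative_def scale)
    qed simp
    moreover have "DF y (x - a) = (\<Sum>b\<in>Basis. ((x - a) \<bullet> b) * DF y b)" for y
    proof -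
      interpret linear "DF y" using DF has_derivative_linear by blast
      have "DF y (x - a) = DF y (\<Sum>b\<in>Basis. ((x - a) \<bullet> b) *\<^sub>R b)" by (simp add: euclidean_representation)
      then show ?thesis by (simp only: sum scale real_scaleR_def)
    qed
    ultimately have "F x - F a = integral {0..1} (\<lambda>t. \<Sum>b\<in>Basis. ((x - a) \<bullet> b) * DF (a + t *\<^sub>R (x - a)) b)"
      by (simp add: integral_unique)
    also have "\<dots> = (\<Sum>b\<in>Basis. ((x - a) \<bullet> b) * H b x)"
      by (simp only: integral_sum[OF finite_Basis int] H_def integral_mult_right)
    finally show "F x = F a + (\<Sum>b\<in>Basis. ((x - a) \<bullet> b) * H b x)" by simp
  qed
qed

section \<open>Smooth functions on manifolds\<close>

lemma is_chartD:
  assumes "is_chart (U, \<phi>)"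
  shows "open U" "open (\<phi> ` U)" "inj_on \<phi> U" "continuous_on U \<phi>"
    "continuous_on (\<phi> ` U) (inv_into U \<phi>)"
proof -
  obtain \<psi> where \<psi>: "homeomorphism U (\<phi> ` U) \<phi> \<psi>" and o: "open U" "open (\<phi> ` U)"
    using assms by (auto simp: is_chart_def)
  show "open U" "open (\<phi> ` U)" by fact+
  show inj: "inj_on \<phi> U" using homeomorphism_apply1[OF \<psi>] by (metis inj_onI)
  show "continuous_on U \<phi>" using homeomorphism_cont1[OF \<psi>] .
  have "inv_into U \<phi> y = \<psi> y" if "y \<in> \<phi> ` U" for y
    using that homeomorphism_apply1[OF \<psi>] inv_into_f_f[OF inj] by auto
  then show "continuous_on (\<phi> ` U) (inv_into U \<phi>)"
    using homeomorphism_cont2[OF \<psi>] continuous_on_cong by metis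
qed

lemma is_chart_restrict:
  assumes "is_chart (U, \<phi>)" "open W" "W \<subseteq> U"
  shows "is_chart (W, \<phi>)"
proof -
  note c = is_chartD[OF assms(1)]
  have W: "\<phi> ` W = \<phi> ` U \<inter> inv_into U \<phi> -` W"
    using assms(3) c(3) by (auto simp: inv_into_f_f image_iff)
  have "homeomorphism W (\<phi> ` W) \<phi> (inv_into U \<phi>)"
  proof
    show "continuous_on W \<phi>" using continuous_on_subset[OF c(4) assms(3)] .
    show "continuous_on (\<phi> ` W) (inv_into U \<phi>)"
      using continuous_on_subset[OF c(5)] assms(3) by blast
  qed (use assms(3) c(3) in \<open>auto simp: inv_into_f_f subset_iff\<close>)
  moreover have "open (\<phi> ` W)"
    unfolding W by (rule continuous_open_preimage[OF c(5) c(2) assms(2)])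
  ultimately show ?thesis using assms(2) by (auto simp: is_chart_def)
qed

lemma smooth_funsI:
  assumes "\<And>p. p \<in> N \<Longrightarrow> \<exists>U \<phi> F. smooth_chart A (U, \<phi>) \<and> p \<in> U \<and> smooth_on (\<phi> ` U) F \<and>
      (\<forall>q\<in>U \<inter> N. f q = F (\<phi> q))"
  shows "f \<in> smooth_funs A N"
  using assms by (simp add: smooth_funs_def)

lemma smooth_funsE:
  assumes "f \<in> smooth_funs A N" "p \<in> N"
  obtains U \<phi> F where "smooth_chart A (U, \<phi>)" "p \<in> U" "smooth_on (\<phi> ` U) F"
    "\<forall>q\<in>U \<inter> N. f q = F (\<phi> q)"
proof -
  have "\<exists>U \<phi> F. smooth_chart A (U, \<phi>) \<and> p \<in> U \<and> smooth_on (\<phi> ` U) F \<and>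
      (\<forall>q\<in>U \<inter> N. f q = F (\<phi> q))"
    using assms by (simp add: smooth_funs_def)
  then show thesis by (elim exE conjE) (rule that)
qed

lemma smooth_funs_subset:
  assumes "f \<in> smooth_funs A N" "N' \<subseteq> N"
  shows "f \<in> smooth_funs A N'"
proof (rule smooth_funsI)
  fix p assume "p \<in> N'"
  with assms(2) have "p \<in> N" by blast
  from smooth_funsE[OF assms(1) this] obtain U \<phi> F where
    "smooth_chart A (U, \<phi>)" "p \<in> U" "smooth_on (\<phi> ` U) F" "\<forall>q\<in>U \<inter> N. f q = F (\<phi> q)"
    by metis
  then show "\<exists>U \<phi> F. smooth_chart A (U, \<phi>) \<and> p \<in> U \<and> smooth_on (\<phi> ` U) F \<and> (\<forall>q\<in>U \<inter> N'. f q = F (\<phi> q))"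
    using assms(2) by (intro exI[of _ U] exI[of _ \<phi>] exI[of _ F]) auto
qed

lemma smooth_funs_chart_comp:
  assumes "smooth_chart A (U, \<phi>)" "smooth_on (\<phi> ` U) F" "N \<subseteq> U"
  shows "(\<lambda>q. F (\<phi> q)) \<in> smooth_funs A N"
  by (rule smooth_funsI, rule exI[of _ U], rule exI[of _ \<phi>], rule exI[of _ F]) (use assms in auto)

lemma sum_fun_apply: "(\<Sum>i\<in>I. X i) x = (\<Sum>i\<in>I. X i x)"
  by (induction I rule: infinite_finite_induct) auto

locale manifold =
  fixes A :: "('a::{t2_space, second_countable_topology}, 'b::euclidean_space) atlas"
  assumes manifold: "smooth_manifold A"
begin

lemma smooth_chart_atlas: "c \<in> A \<Longrightarrow> smooth_chart A c"
  using manifold by (auto simp: smooth_manifold_def smooth_chart_def)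

lemma smooth_chart_exists: obtains U \<phi> where "(U, \<phi>) \<in> A" "smooth_chart A (U, \<phi>)" "p \<in> U"
proof -
  have "p \<in> (\<Union>c\<in>A. fst c)" using manifold by (auto simp: smooth_manifold_def)
  then show thesis using that smooth_chart_atlas by force
qed

lemma smooth_chartD:
  "smooth_chart A (U, \<phi>) \<Longrightarrow> is_chart (U, \<phi>)" by (simp add: smooth_chart_def)

text \<open>Membership in the maximal atlas is tested only against charts of \<open>A\<close>, so
  the transition between two such charts is factored, near each point, through a chart of
  \<open>A\<close> containing that point.\<close>

lemma chart_transition:
  assumes \<phi>: "smooth_chart A (U, \<phi>)" and \<psi>: "smooth_chart A (V, \<psi>)"
  shows "smooth_on (\<phi> ` (U \<inter> V)) (\<psi> \<circ> inv_into U \<phi>)"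
proof (rule smooth_on_locally)
  fix y assume "y \<in> \<phi> ` (U \<inter> V)"
  then obtain q where q: "q \<in> U" "q \<in> V" "y = \<phi> q" by auto
  obtain T \<tau> where T: "(T, \<tau>) \<in> A" "smooth_chart A (T, \<tau>)" "q \<in> T" by (rule smooth_chart_exists)
  note cU = is_chartD[OF smooth_chartD[OF \<phi>]] and cT = is_chartD[OF smooth_chartD[OF T(2)]]
    and cV = is_chartD[OF smooth_chartD[OF \<psi>]]
  define W where "W = U \<inter> V \<inter> T"
  have W: "open W" "W \<subseteq> U" using cU(1) cV(1) cT(1) by (auto simp: W_def)
  have oW: "open (\<phi> ` W)" using is_chartD(2)[OF is_chart_restrict[OF smooth_chartD[OF \<phi>] W]] .
  have oTV: "open (\<tau> ` (T \<inter> V))"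
    using is_chartD(2)[OF is_chart_restrict[OF smooth_chartD[OF T(2)], of "T \<inter> V"]] cT(1) cV(1) by auto
  have s1: "smooth_on (\<phi> ` W) (\<tau> \<circ> inv_into U \<phi>)"
    using \<phi> T(1) by (auto simp: smooth_chart_def smooth_transition_def W_def intro: smooth_on_subset)
  have s2: "smooth_on (\<tau> ` (T \<inter> V)) (\<psi> \<circ> inv_into T \<tau>)"
    using \<psi> T(1) by (auto simp: smooth_chart_def smooth_transition_def)
  have "smooth_on (\<phi> ` W) (\<lambda>x. (\<psi> \<circ> inv_into T \<tau>) ((\<tau> \<circ> inv_into U \<phi>) x))"
    by (rule smooth_on_compose[OF oW oTV _ s1 s2]) (auto simp: W_def cU(3))
  then have "smooth_on (\<phi> ` W) (\<psi> \<circ> inv_into U \<phi>)"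
    by (rule smooth_on_cong[OF _ oW]) (auto simp: W_def cU(3) cT(3))
  then show "\<exists>S. open S \<and> y \<in> S \<and> smooth_on S (\<psi> \<circ> inv_into U \<phi>)"
    using oW q T(3) by (auto simp: W_def)
qed

lemma smooth_chart_restrict:
  assumes \<phi>: "smooth_chart A (U, \<phi>)" and W: "open W" "W \<subseteq> U"
  shows "smooth_chart A (W, \<phi>)"
  unfolding smooth_chart_def
proof (intro conjI ballI)
  note cU = is_chartD[OF smooth_chartD[OF \<phi>]]
  show iW: "is_chart (W, \<phi>)" using is_chart_restrict[OF smooth_chartD[OF \<phi>] W] .
  fix d assume d: "d \<in> A"
  obtain V \<psi> where d_eq: "d = (V, \<psi>)" by fastforce
  note cV = is_chartD[OF smooth_chartD[OF smooth_chart_atlas[OF d[unfolded d_eq]]]]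
  have o: "open (\<phi> ` (W \<inter> V))"
    using is_chartD(2)[OF is_chart_restrict[OF smooth_chartD[OF \<phi>], of "W \<inter> V"]] W cV(1) by auto
  have "smooth_on (\<phi> ` (U \<inter> V)) (\<psi> \<circ> inv_into U \<phi>)"
    using \<phi> d d_eq by (auto simp: smooth_chart_def smooth_transition_def)
  then have "smooth_on (\<phi> ` (W \<inter> V)) (\<psi> \<circ> inv_into U \<phi>)"
    by (rule smooth_on_subset) (use W in auto)
  then have "smooth_on (\<phi> ` (W \<inter> V)) (\<psi> \<circ> inv_into W \<phi>)"
    by (rule smooth_on_cong[OF _ o])
      (use W cU(3) is_chartD(3)[OF iW] in \<open>auto simp: subset_iff inv_into_f_f\<close>)
  then show "smooth_transition (W, \<phi>) d" by (simp add: smooth_transition_def d_eq)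
  have "smooth_on (\<psi> ` (V \<inter> U)) (\<phi> \<circ> inv_into V \<psi>)"
    using \<phi> d d_eq by (auto simp: smooth_chart_def smooth_transition_def)
  then show "smooth_transition d (W, \<phi>)"
    using W by (auto simp: smooth_transition_def d_eq intro: smooth_on_subset)
qed

text \<open>The chart that witnesses smoothness is unspecified. Composing with a transition map
  moves the representative to a prescribed chart, so several functions can be compared in one
  chart.\<close>

lemma smooth_funs_in_chart:
  assumes f: "f \<in> smooth_funs A N" "p \<in> N" and \<psi>: "smooth_chart A (V, \<psi>)" "p \<in> V"
  obtains W F where "open W" "p \<in> W" "W \<subseteq> V" "smooth_on (\<psi> ` W) F" "\<And>q. q \<in> W \<Longrightarrow> q \<in> N \<Longrightarrow> f q = F (\<psi> q)"
proof -
  obtain U \<phi> F where U: "smooth_chart A (U, \<phi>)" "p \<in> U" "smooth_on (\<phi> ` U) F"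
    "\<forall>q\<in>U \<inter> N. f q = F (\<phi> q)"
    by (rule smooth_funsE[OF f])
  note cU = is_chartD[OF smooth_chartD[OF U(1)]] and cV = is_chartD[OF smooth_chartD[OF \<psi>(1)]]
  have o: "open (\<psi> ` (V \<inter> U))"
    using is_chartD(2)[OF is_chart_restrict[OF smooth_chartD[OF \<psi>(1)], of "V \<inter> U"]] cU cV by auto
  have "smooth_on (\<psi> ` (V \<inter> U)) (\<lambda>x. F ((\<phi> \<circ> inv_into V \<psi>) x))"
    by (rule smooth_on_compose[OF o cU(2) _ chart_transition[OF \<psi>(1) U(1)] U(3)])
      (auto simp: cV(3))
  then show thesis
    by (rule that[rotated 3]) (use U \<psi>(2) cU(1) cV(1) cV(3) in auto)
qed

lemma smooth_funs_locally:
  assumes "\<And>p. p \<in> N \<Longrightarrow> \<exists>W h. open W \<and> p \<in> W \<and> h \<in> smooth_funs A (N \<inter> W) \<and> (\<forall>q\<in>N \<inter> W. f q = h q)"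
  shows "f \<in> smooth_funs A N"
proof (rule smooth_funsI)
  fix p assume p: "p \<in> N"
  then obtain W h where W: "open W" "p \<in> W" "h \<in> smooth_funs A (N \<inter> W)" "\<forall>q\<in>N \<inter> W. f q = h q"
    using assms by blast
  obtain U \<phi> F where U: "smooth_chart A (U, \<phi>)" "p \<in> U" "smooth_on (\<phi> ` U) F"
    "\<forall>q\<in>U \<inter> (N \<inter> W). h q = F (\<phi> q)"
    by (rule smooth_funsE[OF W(3)]) (use W(2) p in auto)
  have "smooth_chart A (U \<inter> W, \<phi>)"
    using smooth_chart_restrict[OF U(1)] is_chartD(1)[OF smooth_chartD[OF U(1)]] W(1) by auto
  then show "\<exists>U \<phi> F. smooth_chart A (U, \<phi>) \<and> p \<in> U \<and> smooth_on (\<phi> ` U) F \<and> (\<forall>q\<in>U \<inter> N. f q = F (\<phi> q))"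
    using U W by (intro exI[of _ "U \<inter> W"] exI[of _ \<phi>] exI[of _ F]) (auto intro: smooth_on_subset)
qed

lemma smooth_funs_cong: "f \<in> smooth_funs A N \<Longrightarrow> (\<And>q. q \<in> N \<Longrightarrow> f q = h q) \<Longrightarrow> h \<in> smooth_funs A N"
  by (rule smooth_funs_locally, rule exI[of _ UNIV], rule exI[of _ f]) auto

text \<open>Source of the algebra structure: sums and products are compositions with smooth maps on
  pairs of reals. It also gives smoothness of the Hadamard coefficients evaluated at coordinate
  functions.\<close>

lemma smooth_funs_compose:
  fixes y :: "'a \<Rightarrow> 'c::euclidean_space"
  assumes y: "\<And>b. b \<in> Basis \<Longrightarrow> (\<lambda>q. y q \<bullet> b) \<in> smooth_funs A N" and F: "smooth_on UNIV F"
  shows "(\<lambda>q. F (y q)) \<in> smooth_funs A N"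
proof (rule smooth_funsI)
  fix p assume p: "p \<in> N"
  obtain V \<psi> where V: "smooth_chart A (V, \<psi>)" "p \<in> V" by (rule smooth_chart_exists)
  have "\<exists>W G. open W \<and> p \<in> W \<and> W \<subseteq> V \<and> smooth_on (\<psi> ` W) G \<and> (\<forall>q\<in>W \<inter> N. y q \<bullet> b = G (\<psi> q))"
    if "b \<in> Basis" for b
    by (rule smooth_funs_in_chart[OF y[OF that] p V]) blast
  then obtain W G where W: "\<And>b. b \<in> Basis \<Longrightarrow> open (W b) \<and> p \<in> W b \<and> W b \<subseteq> V \<and>
      smooth_on (\<psi> ` W b) (G b) \<and> (\<forall>q\<in>W b \<inter> N. y q \<bullet> b = G b (\<psi> q))"
    by metis
  define U where "U = V \<inter> (\<Inter>b\<in>Basis. W b)"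
  have "open U" unfolding U_def
    by (intro open_Int open_INT is_chartD(1)[OF smooth_chartD[OF V(1)]] ballI) (use W in auto)
  then have U: "smooth_chart A (U, \<psi>)" using smooth_chart_restrict[OF V(1)] U_def by blast
  then have oU: "open (\<psi> ` U)" using is_chartD(2) smooth_chartD by blast
  \<comment> \<open>The vector-valued local representative of \<open>y\<close>, assembled from those
    of its components on a common neighbourhood; \<open>Basis\<close> is finite, so that
    neighbourhood is open.\<close>
  let ?G = "\<lambda>x. \<Sum>b\<in>Basis. G b x *\<^sub>R b"
  have "smooth_on (\<psi> ` U) ?G"
  proof (rule smooth_on_sum[OF oU])
    fix b :: 'c assume b: "b \<in> Basis"
    have "smooth_on (\<psi> ` U) (G b)"
      using W[OF b] b by (auto simp: U_def intro!: smooth_on_subset[of "\<psi> ` W b"])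
    then show "smooth_on (\<psi> ` U) (\<lambda>x. G b x *\<^sub>R b)"
      by (rule smooth_on_bounded_linear[OF bounded_linear_scaleR_left oU])
  qed
  then have s: "smooth_on (\<psi> ` U) (\<lambda>x. F (?G x))"
    by (intro smooth_on_compose[OF oU open_UNIV _ _ F]) auto
  have "y q = ?G (\<psi> q)" if "q \<in> U \<inter> N" for q
  proof -
    have "y q = (\<Sum>b\<in>Basis. (y q \<bullet> b) *\<^sub>R b)" by (simp add: euclidean_representation)
    also have "\<dots> = ?G (\<psi> q)" using W that by (intro sum.cong) (auto simp: U_def)
    finally show ?thesis .
  qed
  then show "\<exists>U \<phi> F'. smooth_chart A (U, \<phi>) \<and> p \<in> U \<and> smooth_on (\<phi> ` U) F' \<and> (\<forall>q\<in>U \<inter> N. F (y q) = F' (\<phi> q))"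
    using U s W V by (intro exI[of _ U] exI[of _ \<psi>] exI[of _ "\<lambda>x. F (?G x)"]) (auto simp: U_def)
qed

lemma smooth_funs_compose2:
  assumes "f \<in> smooth_funs A N" "h \<in> smooth_funs A N" "smooth_on UNIV (F :: real \<times> real \<Rightarrow> real)"
  shows "(\<lambda>q. F (f q, h q)) \<in> smooth_funs A N"
  by (rule smooth_funs_compose[OF _ assms(3)]) (use assms in \<open>auto simp: Basis_prod_def\<close>)

lemma smooth_funs_mult:
  assumes "f \<in> smooth_funs A N" "h \<in> smooth_funs A N"
  shows "(\<lambda>q. f q * h q) \<in> smooth_funs A N"
proof -
  have "smooth_on UNIV (\<lambda>x::real \<times> real. fst x * snd x)"
    by (intro smooth_on_mult smooth_on_linear bounded_linear_fst bounded_linear_snd) auto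
  from smooth_funs_compose2[OF assms this] show ?thesis by simp
qed

lemma smooth_funs_lincomb:
  assumes "f \<in> smooth_funs A N" "h \<in> smooth_funs A N"
  shows "(\<lambda>q. c * f q + d * h q) \<in> smooth_funs A N"
proof -
  have "smooth_on UNIV (\<lambda>x::real \<times> real. c * fst x + d * snd x)"
    by (intro smooth_on_add smooth_on_mult smooth_on_const smooth_on_linear
        bounded_linear_fst bounded_linear_snd) auto
  from smooth_funs_compose2[OF assms this] show ?thesis by simp
qed

lemma smooth_funs_const: "(\<lambda>q. c) \<in> smooth_funs A N"
proof (rule smooth_funsI)
  fix p
  obtain U \<phi> where "smooth_chart A (U, \<phi>)" "p \<in> U" by (rule smooth_chart_exists)
  then show "\<exists>U \<phi> F. smooth_chart A (U, \<phi>) \<and> p \<in> U \<and> smooth_on (\<phi> ` U) F \<and> (\<forall>q\<in>U \<inter> N. c = F (\<phi> q))"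
    by (intro exI[of _ U] exI[of _ \<phi>] exI[of _ "\<lambda>_. c"]) (simp add: smooth_on_const)
qed

lemma smooth_funs_add: "f \<in> smooth_funs A N \<Longrightarrow> h \<in> smooth_funs A N \<Longrightarrow> (\<lambda>q. f q + h q) \<in> smooth_funs A N"
  using smooth_funs_lincomb[of f N h 1 1] by simp

lemma smooth_funs_diff: "f \<in> smooth_funs A N \<Longrightarrow> h \<in> smooth_funs A N \<Longrightarrow> (\<lambda>q. f q - h q) \<in> smooth_funs A N"
  using smooth_funs_lincomb[of f N h 1 "-1"] by simp

lemma smooth_funs_sum:
  "(\<And>i. i \<in> I \<Longrightarrow> f i \<in> smooth_funs A N) \<Longrightarrow> (\<lambda>q. \<Sum>i\<in>I. f i q) \<in> smooth_funs A N"
  by (induction I rule: infinite_finite_induct) (auto intro: smooth_funs_const smooth_funs_add)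

section \<open>Cut-off functions on the manifold and extension of functions from
  \<open>N\<close>\<close>

lemma plateau_fun_exists:
  assumes "open V" "p \<in> V"
  obtains \<rho> W K where "\<rho> \<in> smooth_funs A UNIV" "open W" "p \<in> W" "\<And>q. q \<in> W \<Longrightarrow> \<rho> q = 1"
    "closed K" "W \<subseteq> K" "K \<subseteq> V" "\<And>q. q \<notin> K \<Longrightarrow> \<rho> q = 0"
proof -
  obtain U0 \<phi> where U0: "smooth_chart A (U0, \<phi>)" "p \<in> U0" by (rule smooth_chart_exists)
  define U where "U = U0 \<inter> V"
  have U: "smooth_chart A (U, \<phi>)" "p \<in> U"
    using smooth_chart_restrict[OF U0(1), of U] U0 assms is_chartD(1)[OF smooth_chartD[OF U0(1)]]
    by (auto simp: U_def)
  note c = is_chartD[OF smooth_chartD[OF U(1)]]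
  obtain e where e: "e > 0" "ball (\<phi> p) e \<subseteq> \<phi> ` U"
    using c(2) U(2) by (meson imageI open_contains_ball)
  \<comment> \<open>A third of the radius, so that the closed ball of radius \<open>2 * s\<close>,
    outside which the plateau vanishes, stays inside the chart image.\<close>
  define s where "s = e / 3"
  have s: "s > 0" "cball (\<phi> p) (2 * s) \<subseteq> \<phi> ` U"
    using e by (auto simp: s_def subset_iff)
  obtain \<beta> :: "'b \<Rightarrow> real" where \<beta>: "smooth_on UNIV \<beta>" "\<And>x. dist (\<phi> p) x \<le> s \<Longrightarrow> \<beta> x = 1"
    "\<And>x. dist (\<phi> p) x \<ge> 2 * s \<Longrightarrow> \<beta> x = 0"
    using plateau_exists[OF s(1)] by blast
  define K where "K = inv_into U \<phi> ` cball (\<phi> p) (2 * s)"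
  define W where "W = U \<inter> \<phi> -` ball (\<phi> p) s"
  define \<rho> where "\<rho> q = (if q \<in> U then \<beta> (\<phi> q) else 0)" for q
  \<comment> \<open>The Hausdorff axiom enters here: \<open>K\<close> is compact as a continuous
    image of a closed ball, hence closed in the whole manifold, so extension by 0 is smooth across
    the boundary of the chart domain.\<close>
  have "compact K" unfolding K_def
    by (intro compact_continuous_image continuous_on_subset[OF c(5) s(2)] compact_cball)
  then have K: "closed K" by (rule compact_imp_closed)
  have KU: "K \<subseteq> U" unfolding K_def using s(2) by (intro image_subsetI inv_into_into) auto
  have K_iff: "q \<in> K \<longleftrightarrow> dist (\<phi> p) (\<phi> q) \<le> 2 * s" if "q \<in> U" for q
  proof
    assume "q \<in> K"
    then show "dist (\<phi> p) (\<phi> q) \<le> 2 * s"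
      unfolding K_def using s(2) by (auto simp: subset_iff f_inv_into_f)
  next
    assume "dist (\<phi> p) (\<phi> q) \<le> 2 * s"
    then show "q \<in> K" unfolding K_def
      by (intro image_eqI[of _ _ "\<phi> q"]) (auto simp: that c(3))
  qed
  have zero: "\<rho> q = 0" if "q \<notin> K" for q
    using that K_iff[of q] by (auto simp: \<rho>_def intro: \<beta>(3))
  show thesis
  proof
    show "\<rho> \<in> smooth_funs A UNIV"
    proof (rule smooth_funs_locally)
      fix q
      show "\<exists>W h. open W \<and> q \<in> W \<and> h \<in> smooth_funs A (UNIV \<inter> W) \<and> (\<forall>q\<in>UNIV \<inter> W. \<rho> q = h q)"
      proof (cases "q \<in> U")
        case True
        have "(\<lambda>q. \<beta> (\<phi> q)) \<in> smooth_funs A U"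
          by (rule smooth_funs_chart_comp[OF U(1)]) (auto intro: smooth_on_subset \<beta>(1))
        then show ?thesis using True c(1)
          by (intro exI[of _ U] exI[of _ "\<lambda>q. \<beta> (\<phi> q)"]) (auto simp: \<rho>_def)
      next
        case False
        then show ?thesis using K KU zero
          by (intro exI[of _ "- K"] exI[of _ "\<lambda>q. 0"]) (auto intro: smooth_funs_const)
      qed
    qed
    show "open W" unfolding W_def by (rule continuous_open_preimage[OF c(4) c(1)]) auto
    show "p \<in> W" using s(1) U(2) by (simp add: W_def)
    show "\<rho> q = 1" if "q \<in> W" for q using that by (auto simp: W_def \<rho>_def intro: \<beta>(2))
    show "W \<subseteq> K" using K_iff s(1) by (auto simp: W_def)
    show "K \<subseteq> V" using KU by (auto simp: U_def)
  qed (use K zero in auto)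
qed

text \<open>The open sets \<open>V\<close> and \<open>- K\<close> cover everything; on the first the
  function is a product of smooth functions, on the second it is 0.\<close>

lemma smooth_funs_cutoff:
  assumes "\<rho> \<in> smooth_funs A UNIV" "closed K" "K \<subseteq> V" "open V" "\<And>q. q \<notin> K \<Longrightarrow> \<rho> q = 0"
    and "f \<in> smooth_funs A (N \<inter> V)"
  shows "(\<lambda>q. if q \<in> V then \<rho> q * f q else 0) \<in> smooth_funs A N"
proof (rule smooth_funs_locally)
  fix p assume p: "p \<in> N"
  show "\<exists>W h. open W \<and> p \<in> W \<and> h \<in> smooth_funs A (N \<inter> W) \<and>
      (\<forall>q\<in>N \<inter> W. (if q \<in> V then \<rho> q * f q else 0) = h q)"
  proof (cases "p \<in> V")
    case True
    have "(\<lambda>q. \<rho> q * f q) \<in> smooth_funs A (N \<inter> V)"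
      by (intro smooth_funs_mult smooth_funs_subset[OF assms(1)] assms(6)) auto
    then show ?thesis using True assms(4) by (intro exI[of _ V] exI[of _ "\<lambda>q. \<rho> q * f q"]) auto
  next
    case False
    then show ?thesis using assms
      by (intro exI[of _ "- K"] exI[of _ "\<lambda>q. 0"]) (auto intro: smooth_funs_const)
  qed
qed

text \<open>By definition a function in \<open>smooth_funs A N\<close> is near each point the
  restriction of a function of ambient coordinates; a cut-off makes that one global. The price is
  that agreement holds only near \<open>p\<close>.\<close>

lemma smooth_fun_extension:
  assumes f: "f \<in> smooth_funs A N" and p: "p \<in> N"
  obtains h V where "h \<in> smooth_funs A UNIV" "open V" "p \<in> V" "\<And>q. q \<in> N \<Longrightarrow> q \<in> V \<Longrightarrow> f q = h q"
proof -
  obtain U \<phi> F where U: "smooth_chart A (U, \<phi>)" "p \<in> U" "smooth_on (\<phi> ` U) F"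
    "\<forall>q\<in>U \<inter> N. f q = F (\<phi> q)"
    by (rule smooth_funsE[OF f p])
  note oU = is_chartD(1)[OF smooth_chartD[OF U(1)]]
  obtain \<rho> W K where \<rho>: "\<rho> \<in> smooth_funs A UNIV" "open W" "p \<in> W" "\<And>q. q \<in> W \<Longrightarrow> \<rho> q = 1"
    "closed K" "W \<subseteq> K" "K \<subseteq> U" "\<And>q. q \<notin> K \<Longrightarrow> \<rho> q = 0"
    using plateau_fun_exists[OF oU U(2)] by metis
  show thesis
  proof
    show "(\<lambda>q. if q \<in> U then \<rho> q * F (\<phi> q) else 0) \<in> smooth_funs A UNIV"
      by (rule smooth_funs_cutoff[OF \<rho>(1,5,7) oU \<rho>(8)]) (auto intro: smooth_funs_chart_comp[OF U(1,3)])
    show "open W" "p \<in> W" by fact+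
    show "f q = (if q \<in> U then \<rho> q * F (\<phi> q) else 0)" if "q \<in> N" "q \<in> W" for q
      using that U(4) \<rho>(4,6,7) by auto
  qed
qed

end

section \<open>Tangent vectors and vector fields\<close>

lemma scaleR_fun_apply: "(c *\<^sub>R f) x = c *\<^sub>R f x"
  by (simp add: scaleR_fun_def)

context manifold
begin

lemma tangent_lincomb:
  assumes "v \<in> tangent_space A N p" "f \<in> smooth_funs A N" "h \<in> smooth_funs A N"
  shows "v (\<lambda>q. c * f q + d * h q) = c * v f + d * v h"
  using assms unfolding tangent_space_def mem_Collect_eq by (elim conjE) blast

lemma tangent_mult:
  assumes "v \<in> tangent_space A N p" "f \<in> smooth_funs A N" "h \<in> smooth_funs A N"
  shows "v (\<lambda>q. f q * h q) = v f * h p + f p * v h"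
  using assms unfolding tangent_space_def mem_Collect_eq by (elim conjE) blast

lemma tangent_cong:
  assumes "v \<in> tangent_space A N p" "f \<in> smooth_funs A N" "\<And>q. q \<in> N \<Longrightarrow> f q = h q"
  shows "v f = v h"
proof -
  have "h \<in> smooth_funs A N" "\<forall>q\<in>N. f q = h q" using smooth_funs_cong[OF assms(2,3)] assms(3) by auto
  then show ?thesis
    using assms(1,2) unfolding tangent_space_def mem_Collect_eq by (elim conjE) blast
qed

lemma tangent_not_smooth: "v \<in> tangent_space A N p \<Longrightarrow> f \<notin> smooth_funs A N \<Longrightarrow> v f = 0"
  unfolding tangent_space_def mem_Collect_eq by (elim conjE) blast

lemma tangent_const:
  assumes v: "v \<in> tangent_space A N p"
  shows "v (\<lambda>q. c) = 0"
proof -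
  have "v (\<lambda>q. 1 * 1) = v (\<lambda>q. 1) * 1 + 1 * v (\<lambda>q. 1)"
    by (rule tangent_mult[OF v smooth_funs_const smooth_funs_const])
  then have "v (\<lambda>q. 1) = 0" by simp
  then show ?thesis
    using tangent_lincomb[OF v smooth_funs_const smooth_funs_const, of c 1 0 0] by simp
qed

lemma tangent_diff:
  assumes "v \<in> tangent_space A N p" "f \<in> smooth_funs A N" "h \<in> smooth_funs A N"
  shows "v (\<lambda>q. f q - h q) = v f - v h"
  using tangent_lincomb[OF assms, of 1 "-1"] by simp

lemma tangent_sum:
  assumes v: "v \<in> tangent_space A N p" and f: "\<And>i. i \<in> I \<Longrightarrow> f i \<in> smooth_funs A N"
  shows "v (\<lambda>q. \<Sum>i\<in>I. f i q) = (\<Sum>i\<in>I. v (f i))"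
  using f
proof (induction I rule: infinite_finite_induct)
  case (insert i I)
  have "(\<lambda>q. \<Sum>i\<in>I. f i q) \<in> smooth_funs A N" using insert.prems by (intro smooth_funs_sum) auto
  then show ?case using insert tangent_lincomb[OF v, of "f i" "\<lambda>q. \<Sum>i\<in>I. f i q" 1 1] by simp
qed (auto simp: tangent_const[OF v])

text \<open>Since \<open>f - h\<close> vanishes on \<open>N\<close> inside \<open>V\<close> and
  \<open>\<rho>\<close> vanishes outside \<open>V\<close>, the difference equals (1 - \<rho>)(f - h)
  on \<open>N\<close>. Both factors are 0 at \<open>p\<close>, and the Leibniz rule gives 0.\<close>

lemma tangent_local:
  assumes v: "v \<in> tangent_space A N p" and p: "p \<in> N" and V: "open V" "p \<in> V"
    and f: "f \<in> smooth_funs A N" and h: "h \<in> smooth_funs A N"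
    and eq: "\<And>q. q \<in> N \<Longrightarrow> q \<in> V \<Longrightarrow> f q = h q"
  shows "v f = v h"
proof -
  obtain \<rho> W K where \<rho>: "\<rho> \<in> smooth_funs A UNIV" "open W" "p \<in> W" "\<And>q. q \<in> W \<Longrightarrow> \<rho> q = 1"
    "closed K" "W \<subseteq> K" "K \<subseteq> V" "\<And>q. q \<notin> K \<Longrightarrow> \<rho> q = 0"
    using plateau_fun_exists[OF V] by metis
  have 1: "(\<lambda>q. 1 - \<rho> q) \<in> smooth_funs A N"
    by (intro smooth_funs_diff smooth_funs_const smooth_funs_subset[OF \<rho>(1)]) auto
  have 2: "(\<lambda>q. f q - h q) \<in> smooth_funs A N" by (intro smooth_funs_diff f h)
  have "v (\<lambda>q. f q - h q) = v (\<lambda>q. (1 - \<rho> q) * (f q - h q))"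
    by (rule tangent_cong[OF v 2]) (use eq \<rho>(7,8) in fastforce)
  also have "\<dots> = 0"
    using tangent_mult[OF v 1 2] eq[OF p V(2)] \<rho>(4)[OF \<rho>(3)] by simp
  finally show ?thesis using tangent_diff[OF v f h] by simp
qed

lemma subspace_tangent_space: "subspace (tangent_space A N p)"
  unfolding subspace_def
proof (intro conjI ballI allI)
  fix v w assume v: "v \<in> tangent_space A N p" and w: "w \<in> tangent_space A N p"
  show "v + w \<in> tangent_space A N p"
    unfolding tangent_space_def mem_Collect_eq
  proof (intro conjI allI impI ballI)
    fix f assume "f \<notin> smooth_funs A N"
    then show "(v + w) f = 0" using tangent_not_smooth[OF v] tangent_not_smooth[OF w] by simp
  next
    fix f h assume f: "f \<in> smooth_funs A N" and h: "h \<in> smooth_funs A N"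
    show "(v + w) f = (v + w) h" if "\<forall>q\<in>N. f q = h q"
      using tangent_cong[OF v f, of h] tangent_cong[OF w f, of h] that by simp
    show "(v + w) (\<lambda>q. c * f q + d * h q) = c * (v + w) f + d * (v + w) h" for c d
      unfolding plus_fun_apply tangent_lincomb[OF v f h] tangent_lincomb[OF w f h]
      by (simp add: algebra_simps)
    show "(v + w) (\<lambda>q. f q * h q) = (v + w) f * h p + f p * (v + w) h"
      unfolding plus_fun_apply tangent_mult[OF v f h] tangent_mult[OF w f h]
      by (simp add: algebra_simps)
  qed
next
  fix v and s :: real assume v: "v \<in> tangent_space A N p"
  show "s *\<^sub>R v \<in> tangent_space A N p"
    unfolding tangent_space_def mem_Collect_eq
  proof (intro conjI allI impI ballI)
    fix f assume "f \<notin> smooth_funs A N"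
    then show "(s *\<^sub>R v) f = 0" using tangent_not_smooth[OF v] by (simp add: scaleR_fun_apply)
  next
    fix f h assume f: "f \<in> smooth_funs A N" and h: "h \<in> smooth_funs A N"
    show "(s *\<^sub>R v) f = (s *\<^sub>R v) h" if "\<forall>q\<in>N. f q = h q"
      using tangent_cong[OF v f, of h] that by (simp add: scaleR_fun_apply)
    show "(s *\<^sub>R v) (\<lambda>q. c * f q + d * h q) = c * (s *\<^sub>R v) f + d * (s *\<^sub>R v) h" for c d
      unfolding scaleR_fun_apply tangent_lincomb[OF v f h] by (simp add: algebra_simps)
    show "(s *\<^sub>R v) (\<lambda>q. f q * h q) = (s *\<^sub>R v) f * h p + f p * (s *\<^sub>R v) h"
      unfolding scaleR_fun_apply tangent_mult[OF v f h] by (simp add: algebra_simps)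
  qed
qed (auto simp: tangent_space_def)

lemma smooth_sections_add:
  assumes "X \<in> smooth_sections A N" "Y \<in> smooth_sections A N"
  shows "(\<lambda>q. X q + Y q) \<in> smooth_sections A N"
  using assms
  by (auto simp: smooth_sections_def intro!: subspace_add[OF subspace_tangent_space] smooth_funs_add)

lemma smooth_sections_scale:
  assumes "X \<in> smooth_sections A N" "c \<in> smooth_funs A N"
  shows "(\<lambda>q. c q *\<^sub>R X q) \<in> smooth_sections A N"
  using assms
  by (auto simp: smooth_sections_def scaleR_fun_apply
      intro!: subspace_scale[OF subspace_tangent_space] smooth_funs_mult)

lemma smooth_sections_zero: "(\<lambda>q. 0) \<in> smooth_sections A N"
  by (auto simp: smooth_sections_def intro!: subspace_0[OF subspace_tangent_space] smooth_funs_const)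

lemma smooth_sections_sum:
  assumes "\<And>i. i \<in> I \<Longrightarrow> X i \<in> smooth_sections A N"
  shows "(\<lambda>q. \<Sum>i\<in>I. X i q) \<in> smooth_sections A N"
  using assms
  by (induction I rule: infinite_finite_induct) (auto intro: smooth_sections_zero smooth_sections_add)

lemma smooth_sections_cutoff:
  assumes "\<rho> \<in> smooth_funs A UNIV" "closed K" "K \<subseteq> V" "open V" "\<And>q. q \<notin> K \<Longrightarrow> \<rho> q = 0"
    and X: "X \<in> smooth_sections A (N \<inter> V)"
  shows "(\<lambda>q. if q \<in> V then \<rho> q *\<^sub>R X q else 0) \<in> smooth_sections A N"
  unfolding smooth_sections_def
proof (intro CollectI conjI ballI)
  fix f assume f: "f \<in> smooth_funs A UNIV"
  have "(\<lambda>q. if q \<in> V then \<rho> q * X q f else 0) \<in> smooth_funs A N"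
    by (rule smooth_funs_cutoff[OF assms(1-5)]) (use X f in \<open>auto simp: smooth_sections_def\<close>)
  moreover have "(if q \<in> V then \<rho> q *\<^sub>R X q else 0) f = (if q \<in> V then \<rho> q * X q f else 0)" for q
    by (simp add: scaleR_fun_apply)
  ultimately show "(\<lambda>p. (if p \<in> V then \<rho> p *\<^sub>R X p else 0) f) \<in> smooth_funs A N" by simp
qed (use X in \<open>auto simp: smooth_sections_def intro!: subspace_scale[OF subspace_tangent_space]
    subspace_0[OF subspace_tangent_space]\<close>)

section \<open>Tangent vectors of a submanifold as ambient tangent vectors\<close>

lemma incl_diff_tangent:
  assumes "v \<in> tangent_space A N p" "p \<in> N"
  shows "incl_diff A v \<in> tangent_space A UNIV p"
proof -
  have sub: "f \<in> smooth_funs A N" if "f \<in> smooth_funs A UNIV" for f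
    using smooth_funs_subset[OF that] by auto
  show ?thesis
    unfolding tangent_space_def mem_Collect_eq
  proof (intro conjI allI impI ballI)
    fix f assume "f \<notin> smooth_funs A UNIV"
    then show "incl_diff A v f = 0" by (simp add: incl_diff_def)
  next
    fix f h assume f: "f \<in> smooth_funs A UNIV" and h: "h \<in> smooth_funs A UNIV"
    show "incl_diff A v f = incl_diff A v h" if "\<forall>q\<in>UNIV. f q = h q"
    proof -
      have "f = h" using that by auto
      then show ?thesis by simp
    qed
    show "incl_diff A v (\<lambda>q. c * f q + d * h q) = c * incl_diff A v f + d * incl_diff A v h" for c d
      using f h smooth_funs_lincomb[OF f h] tangent_lincomb[OF assms(1) sub[OF f] sub[OF h]]
      by (simp add: incl_diff_def)
    show "incl_diff A v (\<lambda>q. f q * h q) = incl_diff A v f * h p + f p * incl_diff A v h"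
      using f h smooth_funs_mult[OF f h] tangent_mult[OF assms(1) sub[OF f] sub[OF h]]
      by (simp add: incl_diff_def)
  qed
qed

text \<open>Each function smooth on \<open>N\<close> agrees near \<open>p\<close> with an ambient
  one, and derivations are local, so the values on ambient functions determine the derivation. This
  is what makes the \<open>THE\<close> in \<open>intrinsic\<close> meaningful.\<close>

lemma incl_diff_inj:
  assumes v: "v \<in> tangent_space A N p" and w: "w \<in> tangent_space A N p" and p: "p \<in> N"
    and eq: "incl_diff A v = incl_diff A w"
  shows "v = w"
proof
  fix f
  show "v f = w f"
  proof (cases "f \<in> smooth_funs A N")
    case True
    then obtain h V where h: "h \<in> smooth_funs A UNIV" "open V" "p \<in> V"
      "\<And>q. q \<in> N \<Longrightarrow> q \<in> V \<Longrightarrow> f q = h q"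
      using smooth_fun_extension p by metis
    have hN: "h \<in> smooth_funs A N" using smooth_funs_subset[OF h(1)] by auto
    have "v f = v h" by (rule tangent_local[OF v p h(2,3) True hN h(4)])
    also have "\<dots> = w h" using fun_cong[OF eq, of h] h(1) by (simp add: incl_diff_def)
    also have "\<dots> = w f" by (rule tangent_local[OF w p h(2,3) hN True h(4)[symmetric]])
    finally show ?thesis .
  qed (simp add: tangent_not_smooth[OF v] tangent_not_smooth[OF w])
qed

lemma intrinsic:
  assumes "X p \<in> tangent_bundle A M p" "p \<in> M"
  shows "intrinsic A M X p \<in> tangent_space A M p" "incl_diff A (intrinsic A M X p) = X p"
proof -
  have "\<exists>!v. v \<in> tangent_space A M p \<and> incl_diff A v = X p"
    using assms incl_diff_inj by (auto simp: tangent_bundle_def)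
  from theI'[OF this] show "intrinsic A M X p \<in> tangent_space A M p"
    "incl_diff A (intrinsic A M X p) = X p" by (auto simp: intrinsic_def)
qed

lemma intrinsic_apply:
  assumes "X p \<in> tangent_bundle A M p" "p \<in> M" "f \<in> smooth_funs A UNIV"
  shows "intrinsic A M X p f = X p f"
  using fun_cong[OF intrinsic(2)[of X, OF assms(1,2)], of f] assms(3) by (simp add: incl_diff_def)

lemma tangent_bundle_subset: "p \<in> M \<Longrightarrow> tangent_bundle A M p \<subseteq> tangent_space A UNIV p"
  using incl_diff_tangent by (auto simp: tangent_bundle_def)

text \<open>A vector tangent to \<open>M\<close> sees an ambient function only through its values on
  \<open>M\<close>. Comparing covariant derivatives of different extensions of a field rests on
  this.\<close>

lemma tangent_bundle_local:
  assumes "v \<in> tangent_bundle A M p" and p: "p \<in> M" and V: "open V" "p \<in> V"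
    and f: "f \<in> smooth_funs A UNIV" and h: "h \<in> smooth_funs A UNIV"
    and eq: "\<And>q. q \<in> M \<Longrightarrow> q \<in> V \<Longrightarrow> f q = h q"
  shows "v f = v h"
proof -
  obtain w where w: "w \<in> tangent_space A M p" "v = incl_diff A w"
    using assms(1) by (auto simp: tangent_bundle_def)
  have "w f = w h"
    by (rule tangent_local[OF w(1) p V _ _ eq]) (use f h in \<open>auto intro: smooth_funs_subset\<close>)
  then show ?thesis using f h by (simp add: w(2) incl_diff_def)
qed

section \<open>Coordinate fields, local expansion of tangent vectors, extension of sections\<close>

lemma smooth_in_chart:
  assumes f: "f \<in> smooth_funs A UNIV" and U: "smooth_chart A (U, \<phi>)"
  shows "smooth_on (\<phi> ` U) (f \<circ> inv_into U \<phi>)"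
proof (rule smooth_on_locally)
  fix x assume "x \<in> \<phi> ` U"
  then obtain p where p: "p \<in> U" "x = \<phi> p" by auto
  note c = is_chartD[OF smooth_chartD[OF U]]
  obtain W F where W: "open W" "p \<in> W" "W \<subseteq> U" "smooth_on (\<phi> ` W) F" "\<And>q. q \<in> W \<Longrightarrow> q \<in> UNIV \<Longrightarrow> f q = F (\<phi> q)"
    using smooth_funs_in_chart[OF f UNIV_I U p(1)] by metis
  have o: "open (\<phi> ` W)" using is_chartD(2)[OF is_chart_restrict[OF smooth_chartD[OF U] W(1,3)]] .
  have "smooth_on (\<phi> ` W) (f \<circ> inv_into U \<phi>)"
    by (rule smooth_on_cong[OF W(4) o]) (use W(3,5) c(3) in auto)
  then show "\<exists>T. open T \<and> x \<in> T \<and> smooth_on T (f \<circ> inv_into U \<phi>)"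
    using o W(2) p(2) by auto
qed

text \<open>The coordinate derivation in direction \<open>b\<close>, damped by a cut-off so that it
  becomes a field on the whole manifold; where \<open>\<rho>\<close> is 1 it is the genuine partial
  derivative. The value 0 off the smooth functions follows the convention of
  \<open>tangent_space\<close>.\<close>

definition coord_field :: "'a set \<Rightarrow> ('a \<Rightarrow> 'b) \<Rightarrow> ('a \<Rightarrow> real) \<Rightarrow> 'b \<Rightarrow> 'a vfield" where
  "coord_field U \<phi> \<rho> b q f = (if f \<in> smooth_funs A UNIV \<and> q \<in> U
     then \<rho> q * frechet_derivative (f \<circ> inv_into U \<phi>) (at (\<phi> q)) b else 0)"

lemma coord_field_vector_field:
  assumes U: "smooth_chart A (U, \<phi>)" and \<rho>: "\<rho> \<in> smooth_funs A UNIV" "closed K" "K \<subseteq> U"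
    "\<And>q. q \<notin> K \<Longrightarrow> \<rho> q = 0"
  shows "coord_field U \<phi> \<rho> b \<in> vector_fields A"
  unfolding smooth_sections_def
proof (intro CollectI conjI ballI)
  fix q
  note c = is_chartD[OF smooth_chartD[OF U]]
  have deriv: "((f \<circ> inv_into U \<phi>) has_derivative frechet_derivative (f \<circ> inv_into U \<phi>) (at (\<phi> q))) (at (\<phi> q))"
    if "f \<in> smooth_funs A UNIV" "q \<in> U" for f
    using smooth_on_has_derivative[OF smooth_in_chart[OF that(1) U]] that(2) by blast
  show "coord_field U \<phi> \<rho> b q \<in> tangent_space A UNIV q"
    unfolding tangent_space_def mem_Collect_eq
  proof (intro conjI allI impI ballI)
    fix f h assume f: "f \<in> smooth_funs A UNIV" and h: "h \<in> smooth_funs A UNIV"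
    show "coord_field U \<phi> \<rho> b q f = coord_field U \<phi> \<rho> b q h" if "\<forall>q\<in>UNIV. f q = h q"
    proof -
      have "f = h" using that by auto
      then show ?thesis by simp
    qed
    let ?f = "f \<circ> inv_into U \<phi>" and ?h = "h \<circ> inv_into U \<phi>"
    show "coord_field U \<phi> \<rho> b q (\<lambda>q. s * f q + t * h q) =
        s * coord_field U \<phi> \<rho> b q f + t * coord_field U \<phi> \<rho> b q h" for s t
    proof (cases "q \<in> U")
      case True
      have "((\<lambda>x. s * ?f x + t * ?h x) has_derivative (\<lambda>v. s * frechet_derivative ?f (at (\<phi> q)) v +
          t * frechet_derivative ?h (at (\<phi> q)) v)) (at (\<phi> q))"
        by (intro has_derivative_add has_derivative_mult_right deriv f h True)
      from frechet_derivative_at[OF this]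
      have "frechet_derivative ((\<lambda>q. s * f q + t * h q) \<circ> inv_into U \<phi>) (at (\<phi> q)) b =
          s * frechet_derivative ?f (at (\<phi> q)) b + t * frechet_derivative ?h (at (\<phi> q)) b"
        by (simp add: o_def fun_eq_iff)
      then show ?thesis using f h smooth_funs_lincomb[OF f h, of s t] True
        by (simp add: coord_field_def algebra_simps)
    qed (simp add: coord_field_def)
    show "coord_field U \<phi> \<rho> b q (\<lambda>q. f q * h q) =
        coord_field U \<phi> \<rho> b q f * h q + f q * coord_field U \<phi> \<rho> b q h"
    proof (cases "q \<in> U")
      case True
      have "((\<lambda>x. ?f x * ?h x) has_derivative (\<lambda>v. ?f (\<phi> q) * frechet_derivative ?h (at (\<phi> q)) v +
          frechet_derivative ?f (at (\<phi> q)) v * ?h (\<phi> q))) (at (\<phi> q))"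
        by (intro has_derivative_mult deriv f h True)
      from frechet_derivative_at[OF this]
      have "frechet_derivative ((\<lambda>q. f q * h q) \<circ> inv_into U \<phi>) (at (\<phi> q)) b =
          f q * frechet_derivative ?h (at (\<phi> q)) b + frechet_derivative ?f (at (\<phi> q)) b * h q"
        using True c(3) by (simp add: o_def fun_eq_iff)
      then show ?thesis using f h smooth_funs_mult[OF f h] True
        by (simp add: coord_field_def algebra_simps)
    qed (simp add: coord_field_def)
  qed (simp add: coord_field_def)
next
  fix f assume f: "f \<in> smooth_funs A UNIV"
  have "(\<lambda>q. if q \<in> U then \<rho> q * frechet_derivative (f \<circ> inv_into U \<phi>) (at (\<phi> q)) b else 0) \<in> smooth_funs A UNIV"
    by (rule smooth_funs_cutoff[OF \<rho>(1-3) is_chartD(1)[OF smooth_chartD[OF U]] \<rho>(4)])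
      (auto intro!: smooth_funs_chart_comp[OF U] smooth_on_frechet_derivative smooth_in_chart[OF f U])
  then show "(\<lambda>q. coord_field U \<phi> \<rho> b q f) \<in> smooth_funs A UNIV"
    using f by (simp add: coord_field_def)
qed

text \<open>Derivations are combinations of partial derivatives. With the coordinates cut off to
  global functions \<open>y\<close>, Hadamard's lemma writes \<open>f\<close> near \<open>q\<close>
  as a constant plus products of y_b - y_b(q) with smooth factors, and the Leibniz rule evaluates
  \<open>v\<close> on them.\<close>

lemma coordinates_exist:
  obtains W and y :: "'a \<Rightarrow> 'b" and E where "open W" "p \<in> W"
    "\<forall>b. (\<lambda>q. y q \<bullet> b) \<in> smooth_funs A UNIV" "\<forall>b. E b \<in> vector_fields A"
    "\<forall>q\<in>W. \<forall>v\<in>tangent_space A UNIV q. \<forall>f\<in>smooth_funs A UNIV.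
      v f = (\<Sum>b\<in>Basis. v (\<lambda>q. y q \<bullet> b) * E b q f)"
proof -
  obtain U \<phi> where U: "smooth_chart A (U, \<phi>)" "p \<in> U" by (rule smooth_chart_exists)
  note c = is_chartD[OF smooth_chartD[OF U(1)]]
  obtain \<rho> W K where \<rho>: "\<rho> \<in> smooth_funs A UNIV" "open W" "p \<in> W" "\<And>q. q \<in> W \<Longrightarrow> \<rho> q = 1"
    "closed K" "W \<subseteq> K" "K \<subseteq> U" "\<And>q. q \<notin> K \<Longrightarrow> \<rho> q = 0"
    using plateau_fun_exists[OF c(1) U(2)] by metis
  define y where "y q = (if q \<in> U then \<rho> q *\<^sub>R \<phi> q else 0)" for q
  have WU: "W \<subseteq> U" using \<rho>(6,7) by blast
  have y_smooth: "(\<lambda>q. y q \<bullet> b) \<in> smooth_funs A UNIV" for b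
  proof -
    have "(\<lambda>q. if q \<in> U then \<rho> q * (\<phi> q \<bullet> b) else 0) \<in> smooth_funs A UNIV"
      by (rule smooth_funs_cutoff[OF \<rho>(1,5,7) c(1) \<rho>(8)])
        (auto intro!: smooth_funs_chart_comp[OF U(1)] smooth_on_linear bounded_linear_inner_left c(2))
    moreover have "y q \<bullet> b = (if q \<in> U then \<rho> q * (\<phi> q \<bullet> b) else 0)" for q
      by (simp add: y_def)
    ultimately show ?thesis by simp
  qed
  have main: "v f = (\<Sum>b\<in>Basis. v (\<lambda>x. y x \<bullet> b) * coord_field U \<phi> \<rho> b q f)"
    if q: "q \<in> W" and v: "v \<in> tangent_space A UNIV q" and f: "f \<in> smooth_funs A UNIV" for q v f
  proof -
    have qU: "q \<in> U" using q WU by blast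
    have yW: "y x = \<phi> x" if "x \<in> W" for x using that WU \<rho>(4) by (auto simp: y_def)
    obtain e where e: "e > 0" "ball (\<phi> q) e \<subseteq> \<phi> ` U"
      using c(2) qU by (meson imageI open_contains_ball)
    define s where "s = e / 3"
    have s: "s > 0" "cball (\<phi> q) (2 * s) \<subseteq> \<phi> ` U"
      using e by (auto simp: s_def subset_iff)
    obtain \<beta> :: "'b \<Rightarrow> real" where \<beta>: "smooth_on UNIV \<beta>" "\<And>x. dist (\<phi> q) x \<le> s \<Longrightarrow> \<beta> x = 1"
      "\<And>x. dist (\<phi> q) x \<ge> 2 * s \<Longrightarrow> \<beta> x = 0"
      using plateau_exists[OF s(1)] by blast
    let ?f = "f \<circ> inv_into U \<phi>"
    \<comment> \<open>Hadamard's lemma requires a function smooth on the whole Euclidean space, so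
      the local representative of \<open>f\<close> is cut off around the image of \<open>q\<close>;
      value and derivative there are unchanged.\<close>
    define F where "F x = (if x \<in> \<phi> ` U then \<beta> x * ?f x else 0)" for x
    have F: "smooth_on UNIV F"
    proof (rule smooth_on_locally)
      fix x
      show "\<exists>T. open T \<and> x \<in> T \<and> smooth_on T F"
      proof (cases "x \<in> \<phi> ` U")
        case True
        have "smooth_on (\<phi> ` U) (\<lambda>x. \<beta> x * ?f x)"
          by (intro smooth_on_mult c(2) smooth_in_chart[OF f U(1)] smooth_on_subset[OF \<beta>(1)]) auto
        then have "smooth_on (\<phi> ` U) F"
          by (rule smooth_on_cong[OF _ c(2)]) (simp add: F_def)
        then show ?thesis using True c(2) by blast
      next
        case False
        have "smooth_on (- cball (\<phi> q) (2 * s)) F"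
          by (rule smooth_on_cong[OF smooth_on_const[of _ 0]]) (auto simp: F_def \<beta>(3))
        then show ?thesis using False s(2) by (intro exI[of _ "- cball (\<phi> q) (2 * s)"]) auto
      qed
    qed
    have F_near: "F x = ?f x" if "x \<in> ball (\<phi> q) s" for x
      using that s by (auto simp: F_def \<beta>(2) subset_iff)
    have dF: "frechet_derivative F (at (\<phi> q)) = frechet_derivative ?f (at (\<phi> q))"
    proof -
      have "(F has_derivative frechet_derivative F (at (\<phi> q))) (at (\<phi> q))"
        using smooth_on_has_derivative[OF F] by simp
      then have "(?f has_derivative frechet_derivative F (at (\<phi> q))) (at (\<phi> q))"
        by (rule has_derivative_transform_within_open[OF _ open_ball _ F_near]) (use s in auto)
      then show ?thesis by (rule frechet_derivative_at)
    qed
    obtain H where H: "\<And>b. smooth_on UNIV (H b)" "\<And>b. H b (\<phi> q) = frechet_derivative F (at (\<phi> q)) b"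
      "\<And>x. F x = F (\<phi> q) + (\<Sum>b\<in>Basis. ((x - \<phi> q) \<bullet> b) * H b x)"
      by (rule hadamard[OF F, of "\<phi> q"]) blast
    have Hs: "(\<lambda>x. H b (y x)) \<in> smooth_funs A UNIV" for b
      by (rule smooth_funs_compose[OF y_smooth H(1)])
    have ys: "(\<lambda>x. y x \<bullet> b - \<phi> q \<bullet> b) \<in> smooth_funs A UNIV" for b
      by (intro smooth_funs_diff y_smooth smooth_funs_const)
    have Ps: "(\<lambda>x. (y x \<bullet> b - \<phi> q \<bullet> b) * H b (y x)) \<in> smooth_funs A UNIV" for b
      by (intro smooth_funs_mult ys Hs)
    \<comment> \<open>On this neighbourhood the cut-off coordinates are the true ones and
      \<open>F\<close> is still the representative of \<open>f\<close>.\<close>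
    let ?V = "W \<inter> \<phi> -` ball (\<phi> q) s"
    have oV: "open ?V"
      using continuous_open_preimage[OF continuous_on_subset[OF c(4) WU] \<rho>(2)] by auto
    have "v f = v (\<lambda>x. F (y x))"
    proof (rule tangent_local[OF v UNIV_I oV _ f smooth_funs_compose[OF y_smooth F]])
      fix x assume x: "x \<in> ?V"
      then have "x \<in> U" using WU by blast
      then show "f x = F (y x)" using x F_near[of "\<phi> x"] c(3) by (simp add: yW)
    qed (use q s in auto)
    also have "\<dots> = v (\<lambda>x. F (\<phi> q) + (\<Sum>b\<in>Basis. (y x \<bullet> b - \<phi> q \<bullet> b) * H b (y x)))"
      by (rule arg_cong[of _ _ v], rule ext) (rule H(3)[unfolded inner_diff_left])
    also have "\<dots> = v (\<lambda>x. \<Sum>b\<in>Basis. (y x \<bullet> b - \<phi> q \<bullet> b) * H b (y x))"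
      using tangent_lincomb[OF v smooth_funs_const smooth_funs_sum, of Basis "\<lambda>b x. (y x \<bullet> b - \<phi> q \<bullet> b) * H b (y x)" "F (\<phi> q)" 1 1]
        Ps tangent_const[OF v] by simp
    also have "\<dots> = (\<Sum>b\<in>Basis. v (\<lambda>x. (y x \<bullet> b - \<phi> q \<bullet> b) * H b (y x)))"
      by (rule tangent_sum[OF v Ps])
    also have "\<dots> = (\<Sum>b\<in>Basis. v (\<lambda>x. y x \<bullet> b) * coord_field U \<phi> \<rho> b q f)"
    proof (rule sum.cong[OF refl])
      fix b :: 'b
      \<comment> \<open>The first factor vanishes at \<open>q\<close>, so only the term that
        differentiates it survives.\<close>
      have "v (\<lambda>x. (y x \<bullet> b - \<phi> q \<bullet> b) * H b (y x)) = v (\<lambda>x. y x \<bullet> b - \<phi> q \<bullet> b) * H b (y q)"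
        using tangent_mult[OF v ys Hs] yW[OF q] by simp
      also have "v (\<lambda>x. y x \<bullet> b - \<phi> q \<bullet> b) = v (\<lambda>x. y x \<bullet> b)"
        using tangent_diff[OF v y_smooth smooth_funs_const] tangent_const[OF v] by simp
      finally show "v (\<lambda>x. (y x \<bullet> b - \<phi> q \<bullet> b) * H b (y x)) = v (\<lambda>x. y x \<bullet> b) * coord_field U \<phi> \<rho> b q f"
        using f qU H(2) dF \<rho>(4)[OF q] yW[OF q] by (simp add: coord_field_def)
    qed
    finally show ?thesis .
  qed
  show thesis
    by (rule that[of W y "coord_field U \<phi> \<rho>"])
      (use \<rho>(2,3) y_smooth coord_field_vector_field[OF U(1) \<rho>(1,5,7,8)] main in \<open>blast+\<close>)
qed

text \<open>The coefficients of \<open>X\<close> in the coordinate fields are smooth functions on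
  \<open>M\<close>, each of which extends near \<open>p\<close>; recombining the extensions with the
  ambient fields \<open>E b\<close> extends \<open>X\<close>. This shows that the choices made in
  \<open>connection_along\<close> have witnesses.\<close>

lemma extends_at_exists:
  assumes X: "X \<in> smooth_sections A M" and p: "p \<in> M"
  shows "\<exists>X'. extends_at A M p X X'"
proof -
  obtain W and y :: "'a \<Rightarrow> 'b" and E where E: "open W" "p \<in> W"
    "\<forall>b. (\<lambda>q. y q \<bullet> b) \<in> smooth_funs A UNIV" "\<forall>b. E b \<in> vector_fields A"
    "\<forall>q\<in>W. \<forall>v\<in>tangent_space A UNIV q. \<forall>f\<in>smooth_funs A UNIV.
      v f = (\<Sum>b\<in>Basis. v (\<lambda>q. y q \<bullet> b) * E b q f)"
    by (rule coordinates_exist[of p])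
  let ?P = "\<lambda>b c. fst c \<in> smooth_funs A UNIV \<and> open (snd c) \<and> p \<in> snd c \<and>
      (\<forall>q\<in>M \<inter> snd c. X q (\<lambda>q. y q \<bullet> b) = fst c q)"
  have "\<exists>c. ?P b c" for b
  proof -
    have "(\<lambda>q. X q (\<lambda>q. y q \<bullet> b)) \<in> smooth_funs A M"
      using X E(3) by (simp add: smooth_sections_def)
    then obtain h V where "h \<in> smooth_funs A UNIV" "open V" "p \<in> V"
      "\<And>q. q \<in> M \<Longrightarrow> q \<in> V \<Longrightarrow> X q (\<lambda>q. y q \<bullet> b) = h q"
      by (rule smooth_fun_extension[OF _ p]) blast
    then show ?thesis by (intro exI[of _ "(h, V)"]) simp
  qed
  then have "\<exists>c. \<forall>b. ?P b (c b)" by (intro choice allI)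
  then obtain c where c: "\<forall>b. ?P b (c b)" ..
  define h V where "h b = fst (c b)" and "V b = snd (c b)" for b
  have h: "h b \<in> smooth_funs A UNIV" "open (V b)" "p \<in> V b"
    "\<And>q. q \<in> M \<Longrightarrow> q \<in> V b \<Longrightarrow> X q (\<lambda>q. y q \<bullet> b) = h b q" for b
    using c by (auto simp: h_def V_def)
  define X' where "X' q = (\<Sum>b\<in>Basis. h b q *\<^sub>R E b q)" for q
  have "extends_at A M p X X'"
    unfolding extends_at_def
  proof (intro conjI exI ballI)
    show X': "X' \<in> vector_fields A" unfolding X'_def[abs_def]
      by (intro smooth_sections_sum smooth_sections_scale E(4)[rule_format] h(1))
    show "open (W \<inter> (\<Inter>b\<in>Basis. V b))"
      by (intro open_Int open_INT E(1) ballI) (use h in auto)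
    show "p \<in> W \<inter> (\<Inter>b\<in>Basis. V b)" using h E(2) by auto
    fix q assume q: "q \<in> M \<inter> (W \<inter> (\<Inter>b\<in>Basis. V b))"
    have Xq: "X q \<in> tangent_space A UNIV q" using X q by (auto simp: smooth_sections_def)
    show "X' q = X q"
    proof
      fix f
      show "X' q f = X q f"
      proof (cases "f \<in> smooth_funs A UNIV")
        case True
        have "X q f = (\<Sum>b\<in>Basis. X q (\<lambda>q. y q \<bullet> b) * E b q f)"
          by (rule E(5)[rule_format, OF _ Xq True]) (use q in auto)
        also have "\<dots> = X' q f"
          unfolding X'_def sum_fun_apply
          by (intro sum.cong) (use h q in \<open>auto simp: scaleR_fun_apply\<close>)
        finally show ?thesis by simp
      next
        case False
        moreover have "X' q \<in> tangent_space A UNIV q" using X' by (auto simp: smooth_sections_def)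
        ultimately show ?thesis using tangent_not_smooth Xq by metis
      qed
    qed
  qed
  then show ?thesis by blast
qed

section \<open>Lie brackets on the ambient manifold and on \<open>M\<close>\<close>

lemma lie_bracket_tangent:
  assumes X: "\<And>q. q \<in> N \<Longrightarrow> X q \<in> tangent_space A N q" "\<And>f. f \<in> smooth_funs A N \<Longrightarrow> (\<lambda>q. X q f) \<in> smooth_funs A N"
    and Y: "\<And>q. q \<in> N \<Longrightarrow> Y q \<in> tangent_space A N q" "\<And>f. f \<in> smooth_funs A N \<Longrightarrow> (\<lambda>q. Y q f) \<in> smooth_funs A N"
    and p: "p \<in> N"
  shows "lie_bracket A N X Y p \<in> tangent_space A N p"
  unfolding tangent_space_def mem_Collect_eq
proof (intro conjI allI impI ballI)
  fix f h assume f: "f \<in> smooth_funs A N" and h: "h \<in> smooth_funs A N"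
  note Xf = X(2)[OF f] and Xh = X(2)[OF h] and Yf = Y(2)[OF f] and Yh = Y(2)[OF h]
  note Xp = X(1)[OF p] and Yp = Y(1)[OF p]
  show "lie_bracket A N X Y p f = lie_bracket A N X Y p h" if eq: "\<forall>q\<in>N. f q = h q"
  proof -
    have "X q f = X q h" "Y q f = Y q h" if "q \<in> N" for q
      using tangent_cong[OF X(1)[OF that] f] tangent_cong[OF Y(1)[OF that] f] eq by auto
    then have "X p (\<lambda>q. Y q f) = X p (\<lambda>q. Y q h)" "Y p (\<lambda>q. X q f) = Y p (\<lambda>q. X q h)"
      by (auto intro: tangent_cong[OF Xp Yf] tangent_cong[OF Yp Xf])
    then show ?thesis using f h by (simp add: lie_bracket_def)
  qed
  show "lie_bracket A N X Y p (\<lambda>q. s * f q + t * h q) =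
      s * lie_bracket A N X Y p f + t * lie_bracket A N X Y p h" for s t
  proof -
    note l = smooth_funs_lincomb[OF f h, of s t]
    have "X p (\<lambda>q. Y q (\<lambda>q. s * f q + t * h q)) = X p (\<lambda>q. s * Y q f + t * Y q h)"
      by (rule tangent_cong[OF Xp Y(2)[OF l]]) (rule tangent_lincomb[OF Y(1) f h])
    moreover have "Y p (\<lambda>q. X q (\<lambda>q. s * f q + t * h q)) = Y p (\<lambda>q. s * X q f + t * X q h)"
      by (rule tangent_cong[OF Yp X(2)[OF l]]) (rule tangent_lincomb[OF X(1) f h])
    ultimately show ?thesis
      using l f h by (simp add: lie_bracket_def tangent_lincomb[OF Xp Yf Yh] tangent_lincomb[OF Yp Xf Xh]
          algebra_simps)
  qed
  show "lie_bracket A N X Y p (\<lambda>q. f q * h q) =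
      lie_bracket A N X Y p f * h p + f p * lie_bracket A N X Y p h"
  proof -
    note l = smooth_funs_mult[OF f h]
    have "X p (\<lambda>q. Y q (\<lambda>q. f q * h q)) = X p (\<lambda>q. 1 * (Y q f * h q) + 1 * (f q * Y q h))"
      by (rule tangent_cong[OF Xp Y(2)[OF l]]) (simp add: tangent_mult[OF Y(1) f h])
    also have "\<dots> = 1 * X p (\<lambda>q. Y q f * h q) + 1 * X p (\<lambda>q. f q * Y q h)"
      by (rule tangent_lincomb[OF Xp smooth_funs_mult[OF Yf h] smooth_funs_mult[OF f Yh]])
    also have "\<dots> = (X p (\<lambda>q. Y q f) * h p + Y p f * X p h) + (X p f * Y p h + f p * X p (\<lambda>q. Y q h))"
      by (simp only: tangent_mult[OF Xp Yf h] tangent_mult[OF Xp f Yh] mult_1)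
    finally have XY: "X p (\<lambda>q. Y q (\<lambda>q. f q * h q)) = \<dots>" .
    have "Y p (\<lambda>q. X q (\<lambda>q. f q * h q)) = Y p (\<lambda>q. 1 * (X q f * h q) + 1 * (f q * X q h))"
      by (rule tangent_cong[OF Yp X(2)[OF l]]) (simp add: tangent_mult[OF X(1) f h])
    also have "\<dots> = 1 * Y p (\<lambda>q. X q f * h q) + 1 * Y p (\<lambda>q. f q * X q h)"
      by (rule tangent_lincomb[OF Yp smooth_funs_mult[OF Xf h] smooth_funs_mult[OF f Xh]])
    also have "\<dots> = (Y p (\<lambda>q. X q f) * h p + X p f * Y p h) + (Y p f * X p h + f p * Y p (\<lambda>q. X q h))"
      by (simp only: tangent_mult[OF Yp Xf h] tangent_mult[OF Yp f Xh] mult_1)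
    finally have YX: "Y p (\<lambda>q. X q (\<lambda>q. f q * h q)) = \<dots>" .
    \<comment> \<open>The mixed products \<open>Y p f * X p h\<close> and
      \<open>X p f * Y p h\<close> occur in both expansions and cancel; the second-order terms alone
      satisfy the Leibniz rule.\<close>
    show ?thesis using l f h by (simp add: lie_bracket_def XY YX algebra_simps)
  qed
qed (simp add: lie_bracket_def)

text \<open>Near each point \<open>f\<close> may be replaced by an ambient function
  \<open>h\<close>, on which the intrinsic vector acts as \<open>X\<close> itself does.\<close>

lemma smooth_funs_intrinsic:
  assumes X: "X \<in> sections_of A M (tangent_bundle A M)" and f: "f \<in> smooth_funs A M"
  shows "(\<lambda>q. intrinsic A M X q f) \<in> smooth_funs A M"
proof (rule smooth_funs_locally)
  fix p assume p: "p \<in> M"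
  obtain h V where h: "h \<in> smooth_funs A UNIV" "open V" "p \<in> V" "\<And>q. q \<in> M \<Longrightarrow> q \<in> V \<Longrightarrow> f q = h q"
    by (rule smooth_fun_extension[OF f p]) blast
  have hM: "h \<in> smooth_funs A M" using smooth_funs_subset[OF h(1)] by auto
  have "intrinsic A M X q f = X q h" if q: "q \<in> M \<inter> V" for q
  proof -
    have Xq: "X q \<in> tangent_bundle A M q" and qM: "q \<in> M" "q \<in> V"
      using X q by (auto simp: sections_of_def)
    have "intrinsic A M X q f = intrinsic A M X q h"
      by (rule tangent_local[OF intrinsic(1)[of X, OF Xq qM(1)] qM(1) h(2) qM(2) f hM h(4)])
    then show ?thesis using intrinsic_apply[of X, OF Xq qM(1) h(1)] by simp
  qed
  moreover have "(\<lambda>q. X q h) \<in> smooth_funs A (M \<inter> V)"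
    using X h(1) by (auto simp: sections_of_def smooth_sections_def intro: smooth_funs_subset[of _ A M])
  ultimately show "\<exists>W k. open W \<and> p \<in> W \<and> k \<in> smooth_funs A (M \<inter> W) \<and>
      (\<forall>q\<in>M \<inter> W. intrinsic A M X q f = k q)"
    using h by blast
qed

lemma sub_bracket_tangent:
  assumes X: "X \<in> sections_of A M (tangent_bundle A M)" and Y: "Y \<in> sections_of A M (tangent_bundle A M)"
    and p: "p \<in> M"
  shows "sub_bracket A M X Y p \<in> tangent_bundle A M p"
  unfolding sub_bracket_def tangent_bundle_def
  by (intro imageI lie_bracket_tangent intrinsic(1) smooth_funs_intrinsic X Y p)
    (use X Y in \<open>auto simp: sections_of_def\<close>)

lemma smooth_sectionsD:
  assumes "X \<in> smooth_sections A N"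
  shows "p \<in> N \<Longrightarrow> X p \<in> tangent_space A UNIV p" "f \<in> smooth_funs A UNIV \<Longrightarrow> (\<lambda>p. X p f) \<in> smooth_funs A N"
  using assms by (auto simp: smooth_sections_def)

lemma lie_bracket_vector_field:
  assumes X: "X \<in> vector_fields A" and Y: "Y \<in> vector_fields A"
  shows "lie_bracket A UNIV X Y \<in> vector_fields A"
  unfolding smooth_sections_def
proof (intro CollectI conjI ballI)
  show "lie_bracket A UNIV X Y p \<in> tangent_space A UNIV p" for p
    by (rule lie_bracket_tangent) (use smooth_sectionsD[OF X] smooth_sectionsD[OF Y] in auto)
  fix f assume f: "f \<in> smooth_funs A UNIV"
  have "(\<lambda>p. X p (\<lambda>q. Y q f) - Y p (\<lambda>q. X q f)) \<in> smooth_funs A UNIV"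
    by (intro smooth_funs_diff smooth_sectionsD[OF X] smooth_sectionsD[OF Y] f)
  then show "(\<lambda>p. lie_bracket A UNIV X Y p f) \<in> smooth_funs A UNIV"
    using f by (simp add: lie_bracket_def)
qed

text \<open>Fields tangent to \<open>M\<close> have a bracket on \<open>M\<close> that any ambient
  extensions compute. This connects integrability, which is stated with the bracket on
  \<open>M\<close>, to the torsion-free ambient connection.\<close>

lemma sub_bracket_eq:
  assumes X: "X \<in> sections_of A M (tangent_bundle A M)" and Y: "Y \<in> sections_of A M (tangent_bundle A M)"
    and X': "X' \<in> vector_fields A" and Y': "Y' \<in> vector_fields A"
    and V: "open V" "\<And>q. q \<in> M \<Longrightarrow> q \<in> V \<Longrightarrow> X' q = X q \<and> Y' q = Y q"
    and p: "p \<in> M" "p \<in> V"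
  shows "sub_bracket A M X Y p = lie_bracket A UNIV X' Y' p"
proof
  fix f
  \<comment> \<open>Kept general in the four fields, so that exchanging the roles of
    \<open>X\<close> and \<open>Y\<close> gives the other half of the bracket.\<close>
  have *: "intrinsic A M X p (\<lambda>q. intrinsic A M Y q f) = X' p (\<lambda>q. Y' q f)"
    if f: "f \<in> smooth_funs A UNIV" and X: "X \<in> sections_of A M (tangent_bundle A M)"
      and Y: "Y \<in> sections_of A M (tangent_bundle A M)" and Y': "Y' \<in> vector_fields A"
      and eq: "\<And>q. q \<in> M \<Longrightarrow> q \<in> V \<Longrightarrow> X' q = X q \<and> Y' q = Y q" for X Y X' Y'
  proof -
    have t: "X q \<in> tangent_bundle A M q" "Y q \<in> tangent_bundle A M q" if "q \<in> M" for q
      using X Y that by (auto simp: sections_of_def)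
    have Yf: "(\<lambda>q. Y' q f) \<in> smooth_funs A UNIV" using Y' f by (simp add: smooth_sections_def)
    have fM: "f \<in> smooth_funs A M" using smooth_funs_subset[OF f] by auto
    have "intrinsic A M X p (\<lambda>q. intrinsic A M Y q f) = intrinsic A M X p (\<lambda>q. Y' q f)"
    proof (rule tangent_local[OF intrinsic(1)[of X, OF t(1)[OF p(1)] p(1)] p(1) V(1) p(2)
          smooth_funs_intrinsic[OF Y fM] smooth_funs_subset[OF Yf subset_UNIV]])
      fix q assume "q \<in> M" "q \<in> V"
      then show "intrinsic A M Y q f = Y' q f" using intrinsic_apply[of Y, OF t(2) _ f] eq by simp
    qed
    also have "\<dots> = X' p (\<lambda>q. Y' q f)" using intrinsic_apply[of X, OF t(1)[OF p(1)] p(1) Yf] eq[OF p] by simp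
    finally show ?thesis .
  qed
  show "sub_bracket A M X Y p f = lie_bracket A UNIV X' Y' p f"
  proof (cases "f \<in> smooth_funs A UNIV")
    case True
    then show ?thesis
      using *[OF True X Y Y' V(2)] *[OF True Y X X', of Y'] V(2) smooth_funs_subset[OF True, of M]
      by (simp add: sub_bracket_def incl_diff_def lie_bracket_def)
  qed (simp add: sub_bracket_def incl_diff_def lie_bracket_def)
qed

lemma extends_at2:
  assumes X: "X \<in> smooth_sections A M" and Y: "Y \<in> smooth_sections A M" and p: "p \<in> M"
  obtains X' Y' V where "X' \<in> vector_fields A" "Y' \<in> vector_fields A" "open V" "p \<in> V"
    "\<And>q. q \<in> M \<Longrightarrow> q \<in> V \<Longrightarrow> X' q = X q \<and> Y' q = Y q"
proof -
  obtain X' V where X': "X' \<in> vector_fields A" "open V" "p \<in> V" "\<forall>q\<in>M \<inter> V. X' q = X q"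
    using extends_at_exists[OF X p] by (auto simp: extends_at_def)
  obtain Y' V' where Y': "Y' \<in> vector_fields A" "open V'" "p \<in> V'" "\<forall>q\<in>M \<inter> V'. Y' q = Y q"
    using extends_at_exists[OF Y p] by (auto simp: extends_at_def)
  show thesis
    by (rule that[OF X'(1) Y'(1) open_Int[OF X'(2) Y'(2)]]) (use X' Y' in auto)
qed

text \<open>Integrability asks for smooth sections, not only for values in the right fibres; locally
  the bracket is that of two ambient extensions, which is smooth.\<close>

lemma sub_bracket_smooth:
  assumes X: "X \<in> sections_of A M (tangent_bundle A M)" and Y: "Y \<in> sections_of A M (tangent_bundle A M)"
  shows "sub_bracket A M X Y \<in> smooth_sections A M"
  unfolding smooth_sections_def
proof (intro CollectI conjI ballI)
  show "sub_bracket A M X Y p \<in> tangent_space A UNIV p" if "p \<in> M" for p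
    using sub_bracket_tangent[OF X Y that] tangent_bundle_subset[OF that] by blast
  fix f assume f: "f \<in> smooth_funs A UNIV"
  show "(\<lambda>p. sub_bracket A M X Y p f) \<in> smooth_funs A M"
  proof (rule smooth_funs_locally)
    fix p assume p: "p \<in> M"
    obtain X' Y' V where e: "X' \<in> vector_fields A" "Y' \<in> vector_fields A" "open V" "p \<in> V"
      "\<And>q. q \<in> M \<Longrightarrow> q \<in> V \<Longrightarrow> X' q = X q \<and> Y' q = Y q"
      using extends_at2[of X M Y p] X Y p by (auto simp: sections_of_def)
    have "(\<lambda>q. lie_bracket A UNIV X' Y' q f) \<in> smooth_funs A (M \<inter> V)"
      by (rule smooth_funs_subset[OF smooth_sectionsD(2)[OF lie_bracket_vector_field[OF e(1,2)] f]]) simp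
    then show "\<exists>W h. open W \<and> p \<in> W \<and> h \<in> smooth_funs A (M \<inter> W) \<and>
        (\<forall>q\<in>M \<inter> W. sub_bracket A M X Y q f = h q)"
      using e(3,4) sub_bracket_eq[OF X Y e(1,2,3,5)]
      by (intro exI[of _ V] exI[of _ "\<lambda>q. lie_bracket A UNIV X' Y' q f"]) simp
  qed
qed

section \<open>Sections of subbundles\<close>

lemma subbundle_subspace: "subbundle A M k E \<Longrightarrow> p \<in> M \<Longrightarrow> subspace (E p)"
  unfolding subbundle_def using subspace_span by (metis IntI)

lemma subbundle_finite_span:
  assumes "subbundle A M k E" "p \<in> M"
  obtains B where "finite B" "E p = span B"
  using assms unfolding subbundle_def by (metis IntI finite_imageI finite_lessThan)

text \<open>Multiplying a local frame by a cut-off gives sections defined along all of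
  \<open>M\<close>. This allows a condition on sections of B' to be tested on arbitrary vectors of a
  fibre.\<close>

lemma section_through:
  assumes E: "subbundle A M k E" and p: "p \<in> M" and z: "z \<in> E p"
  obtains Z where "Z \<in> sections_of A M E" "Z p = z"
proof -
  have "\<exists>V X. open V \<and> p \<in> V \<and> (\<forall>i<k. X i \<in> smooth_sections A (M \<inter> V)) \<and>
      (\<forall>q\<in>M \<inter> V. E q = span ((\<lambda>i. X i q) ` {..<k}))"
    using E p by (simp add: subbundle_def)
  then obtain V X where V: "open V" "p \<in> V" "\<forall>i<k. X i \<in> smooth_sections A (M \<inter> V)"
    "\<forall>q\<in>M \<inter> V. E q = span ((\<lambda>i. X i q) ` {..<k})"
    by (elim exE conjE)
  obtain \<rho> W K where \<rho>: "\<rho> \<in> smooth_funs A UNIV" "open W" "p \<in> W" "\<And>q. q \<in> W \<Longrightarrow> \<rho> q = 1"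
    "closed K" "W \<subseteq> K" "K \<subseteq> V" "\<And>q. q \<notin> K \<Longrightarrow> \<rho> q = 0"
    using plateau_fun_exists[OF V(1,2)] by metis
  \<comment> \<open>The values at \<open>p\<close> of sections form a subspace, so it is enough that
    it contains the frame vectors.\<close>
  let ?Q = "{z. \<exists>Z\<in>sections_of A M E. Z p = z}"
  note sub = subbundle_subspace[OF E]
  have "X i p \<in> ?Q" if "i < k" for i
  proof -
    let ?Z = "\<lambda>q. if q \<in> V then \<rho> q *\<^sub>R X i q else 0"
    have "?Z \<in> smooth_sections A M"
      by (rule smooth_sections_cutoff[OF \<rho>(1,5,7) V(1) \<rho>(8) V(3)[rule_format, OF that]])
    moreover have "?Z q \<in> E q" if "q \<in> M" for q
    proof (cases "q \<in> V")
      case True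
      then have "E q = span ((\<lambda>i. X i q) ` {..<k})" using V(4) that by blast
      then show ?thesis using True \<open>i < k\<close> by (simp add: span_scale span_base)
    qed (use subspace_0[OF sub[OF that]] in simp)
    ultimately have "?Z \<in> sections_of A M E" by (simp add: sections_of_def)
    moreover have "?Z p = X i p" using V(2) \<rho>(3,4) by simp
    ultimately show ?thesis by (intro CollectI bexI[of _ ?Z])
  qed
  moreover have "subspace ?Q"
    unfolding subspace_def
  proof (intro conjI ballI allI)
    have "(\<lambda>q. 0) \<in> sections_of A M E"
      using subspace_0[OF sub] smooth_sections_zero by (simp add: sections_of_def)
    then show "0 \<in> ?Q" by (intro CollectI bexI[of _ "\<lambda>q. 0"]) simp_all
  next
    fix x y assume "x \<in> ?Q" "y \<in> ?Q"
    then obtain Z Z' where Z: "Z \<in> sections_of A M E" "Z p = x" "Z' \<in> sections_of A M E" "Z' p = y"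
      by (elim CollectE bexE)
    have "(\<lambda>q. Z q + Z' q) \<in> sections_of A M E"
      using Z(1,3) subspace_add[OF sub] smooth_sections_add by (simp add: sections_of_def)
    then show "x + y \<in> ?Q" using Z(2,4) by (intro CollectI bexI[of _ "\<lambda>q. Z q + Z' q"]) simp_all
  next
    fix c x assume "x \<in> ?Q"
    then obtain Z where Z: "Z \<in> sections_of A M E" "Z p = x" by (elim CollectE bexE)
    have "(\<lambda>q. c *\<^sub>R Z q) \<in> sections_of A M E"
      using Z(1) subspace_scale[OF sub] smooth_sections_scale[OF _ smooth_funs_const]
      by (simp add: sections_of_def)
    then show "c *\<^sub>R x \<in> ?Q" using Z(2) by (intro CollectI bexI[of _ "\<lambda>q. c *\<^sub>R Z q"]) simp_all
  qed
  ultimately have "span ((\<lambda>i. X i p) ` {..<k}) \<subseteq> ?Q" by (intro span_minimal image_subsetI) simp_all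
  moreover have "E p = span ((\<lambda>i. X i p) ` {..<k})" using V(2,4) p by blast
  ultimately have "z \<in> ?Q" using z by blast
  then show thesis using that by (elim CollectE bexE)
qed

end

section \<open>Symmetric bilinear forms\<close>

locale symmetric_form =
  fixes T :: "'v::real_vector set" and g :: "'v \<Rightarrow> 'v \<Rightarrow> real"
  assumes subspace_T: "subspace T"
    and sym: "u \<in> T \<Longrightarrow> v \<in> T \<Longrightarrow> g u v = g v u"
    and lincomb: "u \<in> T \<Longrightarrow> v \<in> T \<Longrightarrow> w \<in> T \<Longrightarrow> g (c *\<^sub>R u + d *\<^sub>R v) w = c * g u w + d * g v w"
begin

lemma add_left: "u \<in> T \<Longrightarrow> v \<in> T \<Longrightarrow> w \<in> T \<Longrightarrow> g (u + v) w = g u w + g v w"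
  using lincomb[of u v w 1 1] by simp

lemma diff_left: "u \<in> T \<Longrightarrow> v \<in> T \<Longrightarrow> w \<in> T \<Longrightarrow> g (u - v) w = g u w - g v w"
  using lincomb[of u v w 1 "-1"] by simp

lemma scale_left: "u \<in> T \<Longrightarrow> w \<in> T \<Longrightarrow> g (c *\<^sub>R u) w = c * g u w"
  using lincomb[of u u w c 0] by simp

lemma zero_left: "w \<in> T \<Longrightarrow> g 0 w = 0"
  using scale_left[of w w 0] by simp

lemma mem_T:
  "u \<in> T \<Longrightarrow> v \<in> T \<Longrightarrow> u + v \<in> T" "u \<in> T \<Longrightarrow> v \<in> T \<Longrightarrow> u - v \<in> T" "u \<in> T \<Longrightarrow> c *\<^sub>R u \<in> T" "0 \<in> T"
  using subspace_T by (auto simp: subspace_add subspace_diff subspace_scale subspace_0)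

lemma sum_T: "(\<And>i. i \<in> I \<Longrightarrow> u i \<in> T) \<Longrightarrow> (\<Sum>i\<in>I. u i) \<in> T"
  using subspace_sum[OF subspace_T] .

lemma sum_left:
  "(\<And>i. i \<in> I \<Longrightarrow> u i \<in> T) \<Longrightarrow> w \<in> T \<Longrightarrow> g (\<Sum>i\<in>I. u i) w = (\<Sum>i\<in>I. g (u i) w)"
  by (induction I rule: infinite_finite_induct) (auto simp: zero_left add_left sum_T)

lemma add_right: "u \<in> T \<Longrightarrow> v \<in> T \<Longrightarrow> w \<in> T \<Longrightarrow> g w (u + v) = g w u + g w v"
  using add_left[of u v w] sym[of w "u + v"] sym[of w u] sym[of w v] by (simp add: mem_T)

lemma scale_right: "u \<in> T \<Longrightarrow> w \<in> T \<Longrightarrow> g w (c *\<^sub>R u) = c * g w u"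
  using scale_left[of u w c] sym[of w "c *\<^sub>R u"] sym[of w u] by (simp add: mem_T)

lemma lincomb_right:
  "u \<in> T \<Longrightarrow> v \<in> T \<Longrightarrow> w \<in> T \<Longrightarrow> g w (c *\<^sub>R u + d *\<^sub>R v) = c * g w u + d * g w v"
  by (simp add: add_right scale_right mem_T)

lemma zero_right: "w \<in> T \<Longrightarrow> g w 0 = 0"
  using zero_left[of w] sym[of w 0] mem_T(4) by simp

lemma subform: "subspace W \<Longrightarrow> W \<subseteq> T \<Longrightarrow> symmetric_form W g"
  using sym lincomb by unfold_locales (simp_all add: subset_iff)

text \<open>A functional that vanishes on the common annihilator of finitely many vectors is a
  pairing with a combination of them. Induction on \<open>B\<close> replaces a dimension count, and
  the form is not assumed non-degenerate.\<close>

lemma functional_representation: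
  assumes "finite B" "B \<subseteq> T"
    and "\<And>u v c d. u \<in> T \<Longrightarrow> v \<in> T \<Longrightarrow> \<phi> (c *\<^sub>R u + d *\<^sub>R v) = c * \<phi> u + d * \<phi> v"
    and "\<And>y. y \<in> T \<Longrightarrow> (\<forall>w\<in>B. g w y = 0) \<Longrightarrow> \<phi> y = 0"
  shows "\<exists>w\<in>span B. \<forall>y\<in>T. \<phi> y = g w y"
  using assms
proof (induction B arbitrary: \<phi> rule: finite_induct)
  case empty
  have "\<phi> y = g 0 y" if "y \<in> T" for y
    using empty.prems(3)[OF that] zero_left[OF that] by simp
  then show ?case by (intro bexI[of _ 0] ballI) simp_all
next
  case (insert b B)
  have b: "b \<in> T" and BT: "B \<subseteq> T" using insert.prems(1) by auto
  have span_mono': "span B \<subseteq> span (insert b B)" by (intro span_mono) auto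
  show ?case
  proof (cases "\<exists>y\<in>T. (\<forall>w\<in>B. g w y = 0) \<and> g b y \<noteq> 0")
    case False
    have 0: "\<phi> y = 0" if y: "y \<in> T" "\<forall>w\<in>B. g w y = 0" for y
    proof (rule insert.prems(3)[OF y(1)], rule ballI)
      have "g b y = 0" using False y by blast
      then show "g w y = 0" if "w \<in> insert b B" for w using that y(2) by blast
    qed
    have "\<exists>w\<in>span B. \<forall>y\<in>T. \<phi> y = g w y"
      by (rule insert.IH[OF BT insert.prems(2) 0])
    then show ?thesis using span_mono' by blast
  next
    case True
    then obtain y1 where y1: "y1 \<in> T" "\<forall>w\<in>B. g w y1 = 0" "g b y1 \<noteq> 0" by blast
    \<comment> \<open>Chosen so that \<open>\<phi> - k * g b\<close> vanishes at \<open>y1\<close>,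
      the vector which \<open>b\<close> detects and \<open>B\<close> does not.\<close>
    define k where "k = \<phi> y1 / g b y1"
    have "\<exists>w\<in>span B. \<forall>y\<in>T. \<phi> y - k * g b y = g w y"
    proof (rule insert.IH[OF BT])
      show "\<phi> (c *\<^sub>R u + d *\<^sub>R v) - k * g b (c *\<^sub>R u + d *\<^sub>R v) =
          c * (\<phi> u - k * g b u) + d * (\<phi> v - k * g b v)" if "u \<in> T" "v \<in> T" for u v c d
        unfolding lincomb_right[OF that b] insert.prems(2)[OF that] by (simp add: algebra_simps)
      fix y assume y: "y \<in> T" "\<forall>w\<in>B. g w y = 0"
      \<comment> \<open>Moving \<open>y\<close> along \<open>y1\<close> makes it orthogonal to
        \<open>b\<close> as well, while keeping it orthogonal to \<open>B\<close>.\<close>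
      let ?y = "1 *\<^sub>R y + (- (g b y / g b y1)) *\<^sub>R y1"
      have yT: "?y \<in> T" by (intro mem_T y(1) y1(1))
      have "g w ?y = 0" if "w \<in> insert b B" for w
      proof -
        have wT: "w \<in> T" using that b BT by auto
        have "g w ?y = g w y - g b y / g b y1 * g w y1"
          using lincomb_right[OF y(1) y1(1) wT, of 1 "- (g b y / g b y1)"] by simp
        then show ?thesis using that y(2) y1(2,3) by (cases "w = b") simp_all
      qed
      then have "\<phi> ?y = 0" using insert.prems(3)[OF yT] by blast
      then show "\<phi> y - k * g b y = 0"
        using insert.prems(2)[OF y(1) y1(1), of 1 "- (g b y / g b y1)"] by (simp add: k_def)
    qed
    then obtain w where w: "w \<in> span B" "\<forall>y\<in>T. \<phi> y - k * g b y = g w y" by blast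
    have wT: "w \<in> T" using w(1) span_minimal[OF BT subspace_T] by blast
    have "w + k *\<^sub>R b \<in> span (insert b B)"
      by (intro span_add span_scale subsetD[OF span_mono' w(1)] span_base insertI1)
    moreover have "\<phi> y = g (w + k *\<^sub>R b) y" if "y \<in> T" for y
      using w(2)[rule_format, OF that] add_left[OF wT mem_T(3)[OF b] that] scale_left[OF b that] by simp
    ultimately show ?thesis by (intro bexI[of _ "w + k *\<^sub>R b"]) simp_all
  qed
qed

text \<open>Representation of the functional \<open>g v\<close> on the subspace
  \<open>span B\<close>: non-degeneracy there makes the annihilator of \<open>B\<close> trivial, so
  the vanishing condition is automatic.\<close>

lemma orthogonal_projection:
  assumes B: "finite B" "B \<subseteq> T" and nd: "nondegenerate_on g (span B)" and v: "v \<in> T"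
  obtains w where "w \<in> span B" "\<forall>y\<in>span B. g (v - w) y = 0"
proof -
  have ST: "span B \<subseteq> T" by (rule span_minimal[OF B(2) subspace_T])
  interpret S: symmetric_form "span B" g by (rule subform[OF subspace_span ST])
  have "\<exists>w\<in>span B. \<forall>y\<in>span B. g v y = g w y"
  proof (rule S.functional_representation[OF B(1) span_superset])
    show "g v (c *\<^sub>R u + d *\<^sub>R w) = c * g v u + d * g v w" if "u \<in> span B" "w \<in> span B" for u w c d
    proof -
      have "u \<in> T" "w \<in> T" using that ST by auto
      then show ?thesis using lincomb_right[of u w v c d] v by blast
    qed
    fix y assume y: "y \<in> span B" "\<forall>w\<in>B. g w y = 0"
    have "subspace {w \<in> span B. g y w = 0}"
      using y(1) by (simp add: subspace_def S.zero_right S.add_right S.scale_right span_add span_scale span_0)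
    moreover have "B \<subseteq> {w \<in> span B. g y w = 0}"
      using y(2) S.sym[OF y(1)] by (auto simp: span_base)
    ultimately have "span B \<subseteq> {w \<in> span B. g y w = 0}" by (rule span_minimal[rotated])
    then have "y = 0" using nd y(1) unfolding nondegenerate_on_def by blast
    then show "g v y = 0" using zero_right[OF v] by simp
  qed
  then obtain w where w: "w \<in> span B" "\<forall>y\<in>span B. g v y = g w y" by blast
  show thesis
  proof (rule that[OF w(1)], intro ballI)
    fix y assume y: "y \<in> span B"
    then have "y \<in> T" "w \<in> T" using w(1) ST by auto
    then show "g (v - w) y = 0" using w(2) y v by (simp add: diff_left)
  qed
qed

text \<open>The hypothesis on \<open>x\<close> says exactly that the functional \<open>g x\<close>
  vanishes on the annihilator of \<open>B\<close>; non-degeneracy on \<open>T\<close> identifies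
  \<open>x\<close> with the vector of \<open>span B\<close> that represents it.\<close>

lemma double_orthogonal_complement:
  assumes B: "finite B" "B \<subseteq> T" and nd: "nondegenerate_on g T" and x: "x \<in> T"
    and *: "\<And>y. y \<in> T \<Longrightarrow> (\<forall>w\<in>B. g w y = 0) \<Longrightarrow> g x y = 0"
  shows "x \<in> span B"
proof -
  have "\<exists>w\<in>span B. \<forall>y\<in>T. g x y = g w y"
  proof (rule functional_representation[OF B _ *])
    show "g x (c *\<^sub>R u + d *\<^sub>R v) = c * g x u + d * g x v" if "u \<in> T" "v \<in> T" for u v c d
      using lincomb_right[of u v x c d] that x by blast
  qed
  then obtain w where w: "w \<in> span B" "\<forall>y\<in>T. g x y = g w y" by blast
  have wT: "w \<in> T" using w(1) span_minimal[OF B(2) subspace_T] by blast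
  have "g (x - w) y = 0" if "y \<in> T" for y
    using w(2) that x wT by (simp add: diff_left)
  then have "x - w = 0" using nd mem_T(2)[OF x wT] unfolding nondegenerate_on_def by blast
  then show ?thesis using w(1) by simp
qed

end

text \<open>Coefficients are indexed by \<open>I\<close> rather than by vectors, so that pairing
  with a dual family reads them off one index at a time.\<close>

lemma span_image_representation:
  assumes "x \<in> span (e ` I)" "finite I"
  obtains d where "x = (\<Sum>i\<in>I. d i *\<^sub>R e i)"
proof -
  let ?Q = "{x. \<exists>d. x = (\<Sum>i\<in>I. d i *\<^sub>R e i)}"
  have "subspace ?Q"
    unfolding subspace_def
  proof (intro conjI ballI allI)
    show "0 \<in> ?Q" by (intro CollectI exI[of _ "\<lambda>_. 0"]) simp
    fix x y assume "x \<in> ?Q" "y \<in> ?Q"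
    then obtain d d' where "x = (\<Sum>i\<in>I. d i *\<^sub>R e i)" "y = (\<Sum>i\<in>I. d' i *\<^sub>R e i)" by auto
    then show "x + y \<in> ?Q"
      by (intro CollectI exI[of _ "\<lambda>i. d i + d' i"]) (simp add: scaleR_add_left sum.distrib)
  next
    fix c x assume "x \<in> ?Q"
    then obtain d where "x = (\<Sum>i\<in>I. d i *\<^sub>R e i)" by auto
    then show "c *\<^sub>R x \<in> ?Q"
      by (intro CollectI exI[of _ "\<lambda>i. c * d i"]) (simp add: scaleR_sum_right)
  qed
  moreover have "e i \<in> ?Q" if "i \<in> I" for i
  proof -
    have "(\<Sum>j\<in>I. (if j = i then 1 else 0) *\<^sub>R e j) = (\<Sum>j\<in>I. if j = i then e j else 0)"
      by (rule sum.cong) auto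
    also have "\<dots> = e i" using that assms(2) by simp
    finally have "(\<Sum>j\<in>I. (if j = i then 1 else 0) *\<^sub>R e j) = e i" .
    from this[symmetric] show ?thesis
      by (intro CollectI exI[of _ "\<lambda>j. if j = i then 1 else 0"])
  qed
  ultimately have "span (e ` I) \<subseteq> ?Q" by (intro span_minimal image_subsetI)
  then show thesis using assms(1) that by blast
qed

section \<open>Linear algebra of one fibre: the decomposition into tangential, lightlike transversal
  and screen transversal parts\<close>

locale lightlike_splitting = symmetric_form T g
  for T :: "'v::real_vector set" and g +
  fixes TM R S N' S' L :: "'v set" and r :: nat and \<xi> \<nu> :: "nat \<Rightarrow> 'v"
  assumes nondeg: "nondegenerate_on g T"
    and TM_T: "TM \<subseteq> T"
    and normal: "N' = {v \<in> T. \<forall>u\<in>TM. g u v = 0}"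
    and radical: "R = TM \<inter> N'"
    and TM_sum: "TM = {v + w | v w. v \<in> R \<and> w \<in> S}" and RS: "R \<inter> S = {0}"
    and N_sum: "N' = {v + w | v w. v \<in> R \<and> w \<in> S'}" and RS': "R \<inter> S' = {0}"
    and S_fin: "\<exists>B. finite B \<and> S = span B" and S'_fin: "\<exists>B. finite B \<and> S' = span B"
    and R_span: "R = span (\<xi> ` {..<r})" and L_span: "L = span (\<nu> ` {..<r})"
    and \<nu>_T: "i < r \<Longrightarrow> \<nu> i \<in> T"
    and \<nu>_S: "i < r \<Longrightarrow> u \<in> S \<Longrightarrow> g (\<nu> i) u = 0" and \<nu>_S': "i < r \<Longrightarrow> u \<in> S' \<Longrightarrow> g (\<nu> i) u = 0"
    and \<nu>_\<xi>: "i < r \<Longrightarrow> j < r \<Longrightarrow> g (\<nu> i) (\<xi> j) = (if i = j then 1 else 0)"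
    and \<nu>_\<nu>: "i < r \<Longrightarrow> j < r \<Longrightarrow> g (\<nu> i) (\<nu> j) = 0"
begin

lemma subspaces: "subspace R" "subspace S" "subspace S'" "subspace L"
  using R_span L_span S_fin S'_fin by auto

lemma S_TM: "S \<subseteq> TM"
proof
  fix s assume "s \<in> S"
  then show "s \<in> TM" unfolding TM_sum using subspace_0[OF subspaces(1)]
    by (intro CollectI exI[of _ 0] exI[of _ s]) simp
qed

lemma S'_N: "S' \<subseteq> N'"
proof
  fix s assume "s \<in> S'"
  then show "s \<in> N'" unfolding N_sum using subspace_0[OF subspaces(1)]
    by (intro CollectI exI[of _ 0] exI[of _ s]) simp
qed

lemma in_T: "x \<in> R \<Longrightarrow> x \<in> T" "x \<in> S \<Longrightarrow> x \<in> T" "x \<in> S' \<Longrightarrow> x \<in> T" "x \<in> L \<Longrightarrow> x \<in> T" "x \<in> N' \<Longrightarrow> x \<in> T"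
  "x \<in> TM \<Longrightarrow> x \<in> T"
proof -
  have "L \<subseteq> T" unfolding L_span by (rule span_minimal[OF _ subspace_T]) (auto intro: \<nu>_T)
  then show "x \<in> L \<Longrightarrow> x \<in> T" by blast
qed (use radical TM_T S_TM S'_N normal in auto)

lemma TM_N: "u \<in> TM \<Longrightarrow> v \<in> N' \<Longrightarrow> g u v = 0" "u \<in> TM \<Longrightarrow> v \<in> N' \<Longrightarrow> g v u = 0"
  using normal sym in_T(6) by auto

lemma L_perp:
  assumes a: "a \<in> L"
  shows "u \<in> S \<Longrightarrow> g a u = 0" "u \<in> S' \<Longrightarrow> g a u = 0"
proof -
  obtain d where d: "a = (\<Sum>i<r. d i *\<^sub>R \<nu> i)"
    using a unfolding L_span by (rule span_image_representation) auto
  have "g a u = (\<Sum>i<r. d i * g (\<nu> i) u)" if "u \<in> T"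
    unfolding d using that by (subst sum_left) (auto simp: \<nu>_T mem_T scale_left)
  then show "u \<in> S \<Longrightarrow> g a u = 0" "u \<in> S' \<Longrightarrow> g a u = 0"
    using in_T \<nu>_S \<nu>_S' by auto
qed

lemma \<xi>_R: "i < r \<Longrightarrow> \<xi> i \<in> R"
  unfolding R_span by (auto intro: span_base)

text \<open>Pairing with the dual vectors \<open>\<nu> j\<close> reads off the coefficients with
  respect to the \<open>\<xi> i\<close>; \<open>L_eq_0\<close> is the same with the two families
  exchanged.\<close>

lemma R_eq_0:
  assumes x: "x \<in> R" and 0: "\<And>i. i < r \<Longrightarrow> g (\<nu> i) x = 0"
  shows "x = 0"
proof -
  obtain d where d: "x = (\<Sum>i<r. d i *\<^sub>R \<xi> i)"
    using x unfolding R_span by (rule span_image_representation) auto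
  have "d j = 0" if j: "j < r" for j
  proof -
    have "g x (\<nu> j) = (\<Sum>i<r. d i * g (\<xi> i) (\<nu> j))"
      unfolding d using j by (subst sum_left) (auto simp: \<nu>_T mem_T scale_left in_T(1) \<xi>_R)
    also have "\<dots> = (\<Sum>i<r. if i = j then d j else 0)"
      using j by (intro sum.cong) (auto simp: sym[OF in_T(1)[OF \<xi>_R] \<nu>_T] \<nu>_\<xi>)
    also have "\<dots> = d j" using j by simp
    finally show ?thesis using 0[OF j] sym[OF in_T(1)[OF x] \<nu>_T[OF j]] by simp
  qed
  then show ?thesis by (simp add: d)
qed

lemma L_eq_0:
  assumes x: "x \<in> L" and 0: "\<And>i. i < r \<Longrightarrow> g x (\<xi> i) = 0"
  shows "x = 0"
proof -
  obtain d where d: "x = (\<Sum>i<r. d i *\<^sub>R \<nu> i)"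
    using x unfolding L_span by (rule span_image_representation) auto
  have "d j = 0" if j: "j < r" for j
  proof -
    have "g x (\<xi> j) = (\<Sum>i<r. d i * g (\<nu> i) (\<xi> j))"
      unfolding d using j by (subst sum_left) (auto simp: \<nu>_T mem_T scale_left in_T(1) \<xi>_R)
    also have "\<dots> = (\<Sum>i<r. if i = j then d j else 0)"
      using j by (intro sum.cong) (auto simp: \<nu>_\<xi>)
    also have "\<dots> = d j" using j by simp
    finally show ?thesis using 0[OF j] by simp
  qed
  then show ?thesis by (simp add: d)
qed

text \<open>A vector of \<open>S\<close> orthogonal to \<open>S\<close> is also orthogonal to the
  radical, hence to all of \<open>TM\<close>, so it lies in \<open>R\<close>, which meets
  \<open>S\<close> only in 0.\<close>

lemma nondegenerate_S: "nondegenerate_on g S"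
  unfolding nondegenerate_on_def
proof (intro ballI impI)
  fix s assume s: "s \<in> S" "\<forall>w\<in>S. g s w = 0"
  have "g u s = 0" if "u \<in> TM" for u
  proof -
    obtain v w where vw: "u = v + w" "v \<in> R" "w \<in> S" using \<open>u \<in> TM\<close> unfolding TM_sum by blast
    have "g v s = 0" using TM_N(2)[of s v] vw(2) s(1) S_TM radical by blast
    moreover have "g w s = 0" using s(2) vw(3) sym[OF in_T(2)[OF s(1)] in_T(2)[OF vw(3)]] by simp
    ultimately show ?thesis using vw s(1) by (simp add: add_left in_T)
  qed
  then have "s \<in> R" using s(1) S_TM in_T(2) normal radical by blast
  then show "s = 0" using s(1) RS by blast
qed

text \<open>A vector of \<open>S'\<close> orthogonal to \<open>S'\<close> is orthogonal to the whole
  normal space. The double complement of \<open>TM\<close> being \<open>TM\<close>, it is tangent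
  and normal, hence in \<open>R\<close>, which meets \<open>S'\<close> only in 0.\<close>

lemma nondegenerate_S': "nondegenerate_on g S'"
  unfolding nondegenerate_on_def
proof (intro ballI impI)
  fix s assume s: "s \<in> S'" "\<forall>w\<in>S'. g s w = 0"
  obtain B where B: "finite B" "S = span B" using S_fin by blast
  have "TM = span (\<xi> ` {..<r} \<union> B)"
    unfolding TM_sum span_Un R_span B(2) by blast
  moreover have "s \<in> span (\<xi> ` {..<r} \<union> B)"
  proof (rule double_orthogonal_complement[OF _ _ nondeg in_T(3)[OF s(1)]])
    show "finite (\<xi> ` {..<r} \<union> B)" using B(1) by simp
    show sub: "\<xi> ` {..<r} \<union> B \<subseteq> T" using \<xi>_R in_T(1,2) B(2) span_base by blast
    fix y assume y: "y \<in> T" "\<forall>w\<in>\<xi> ` {..<r} \<union> B. g w y = 0"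
    have "subspace {w \<in> T. g w y = 0}"
      using y(1) by (auto simp: subspace_def zero_left add_left scale_left mem_T)
    then have "span (\<xi> ` {..<r} \<union> B) \<subseteq> {w \<in> T. g w y = 0}"
      using sub y(2) by (intro span_minimal) auto
    then have "y \<in> N'" using y(1) \<open>TM = _\<close> normal by blast
    then obtain v w where vw: "y = v + w" "v \<in> R" "w \<in> S'" unfolding N_sum by blast
    have "g s v = 0" using TM_N(2)[of v s] vw(2) s(1) S'_N radical by blast
    then show "g s y = 0" using vw s by (simp add: add_right in_T)
  qed
  ultimately have "s \<in> R" using s(1) S'_N radical by blast
  then show "s = 0" using s(1) RS' by blast
qed

text \<open>Project away \<open>S\<close> and \<open>S'\<close>, then remove the parts along
  \<open>\<xi>\<close> and \<open>\<nu>\<close> using their duality. The remainder \<open>z\<close>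
  is orthogonal to \<open>TM\<close>, to all \<open>\<nu> i\<close> and to \<open>S'\<close>, and
  this forces it to be 0.\<close>

lemma splitting_exists:
  assumes v: "v \<in> T"
  shows "\<exists>t a b. t \<in> TM \<and> a \<in> L \<and> b \<in> S' \<and> v = t + a + b"
proof -
  obtain BS where BS: "finite BS" "S = span BS" using S_fin by blast
  obtain BS' where BS': "finite BS'" "S' = span BS'" using S'_fin by blast
  have sub: "BS \<subseteq> T" "BS' \<subseteq> T" using BS BS' in_T(2,3) span_base by blast+
  obtain s where s: "s \<in> S" "\<forall>y\<in>S. g (v - s) y = 0"
    using orthogonal_projection[OF BS(1) sub(1) nondegenerate_S[unfolded BS(2)] v] BS(2) by metis
  have vs: "v - s \<in> T" using v s(1) by (simp add: mem_T in_T)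
  obtain s' where s': "s' \<in> S'" "\<forall>y\<in>S'. g (v - s - s') y = 0"
    using orthogonal_projection[OF BS'(1) sub(2) nondegenerate_S'[unfolded BS'(2)] vs] BS'(2) by metis
  define w where "w = v - s - s'"
  have w: "w \<in> T" using vs s'(1) by (simp add: w_def mem_T in_T)
  \<comment> \<open>\<open>S\<close> is orthogonal to \<open>S'\<close>, so the second projection
    does not spoil the first.\<close>
  have wS: "g w y = 0" if "y \<in> S" for y
  proof -
    have "g s' y = 0" using TM_N(2) S_TM S'_N that s'(1) by blast
    then show ?thesis using s(2) that vs s'(1) by (simp add: w_def diff_left in_T)
  qed
  \<comment> \<open>The coefficients are crossed: the two families are null and dual to each other,
    so the part along \<open>\<xi> i\<close> is detected by \<open>\<nu> i\<close> and the part
    along \<open>\<nu> i\<close> by \<open>\<xi> i\<close>.\<close>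
  define e where "e = (\<Sum>i<r. g w (\<nu> i) *\<^sub>R \<xi> i)"
  define a where "a = (\<Sum>i<r. g w (\<xi> i) *\<^sub>R \<nu> i)"
  have e: "e \<in> R" unfolding e_def by (intro subspace_sum[OF subspaces(1)] subspace_scale[OF subspaces(1)] \<xi>_R) auto
  have a: "a \<in> L" unfolding a_def L_span by (intro span_sum span_scale span_base) auto
  have R_TM: "x \<in> TM" "x \<in> N'" if "x \<in> R" for x using that radical by auto
  define z where "z = w - e - a"
  have z: "z \<in> T" using w e a by (simp add: z_def mem_T in_T)
  have zg: "g z y = g w y - g e y - g a y" if "y \<in> T" for y
    using that w e a by (simp add: z_def diff_left mem_T in_T)
  have "g z (\<xi> j) = 0" if j: "j < r" for j
  proof -
    have "g a (\<xi> j) = (\<Sum>i<r. g w (\<xi> i) * g (\<nu> i) (\<xi> j))"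
      unfolding a_def using j by (subst sum_left) (auto simp: \<nu>_T mem_T scale_left in_T(1) \<xi>_R)
    also have "\<dots> = (\<Sum>i<r. if i = j then g w (\<xi> j) else 0)"
      using j by (intro sum.cong) (auto simp: \<nu>_\<xi>)
    also have "\<dots> = g w (\<xi> j)" using j by simp
    moreover have "g e (\<xi> j) = 0" using TM_N(1) R_TM e \<xi>_R[OF j] by blast
    ultimately show ?thesis using zg[OF in_T(1)[OF \<xi>_R[OF j]]] by simp
  qed
  moreover have z\<nu>: "g z (\<nu> j) = 0" if j: "j < r" for j
  proof -
    have "g e (\<nu> j) = (\<Sum>i<r. g w (\<nu> i) * g (\<xi> i) (\<nu> j))"
      unfolding e_def using j by (subst sum_left) (auto simp: \<nu>_T mem_T scale_left in_T(1) \<xi>_R)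
    also have "\<dots> = (\<Sum>i<r. if i = j then g w (\<nu> j) else 0)"
      using j by (intro sum.cong) (auto simp: sym[OF in_T(1)[OF \<xi>_R] \<nu>_T] \<nu>_\<xi>)
    also have "\<dots> = g w (\<nu> j)" using j by simp
    moreover have "g a (\<nu> j) = (\<Sum>i<r. g w (\<xi> i) * g (\<nu> i) (\<nu> j))"
      unfolding a_def using j by (subst sum_left) (auto simp: \<nu>_T mem_T scale_left)
    then have "g a (\<nu> j) = 0" using j by (simp add: \<nu>_\<nu>)
    ultimately show ?thesis using zg[OF \<nu>_T[OF j]] by simp
  qed
  moreover have "g z y = 0" if y: "y \<in> S" for y
    using zg[OF in_T(2)[OF y]] wS[OF y] L_perp(1)[OF a y] TM_N(2)[of y e] S_TM R_TM(2)[OF e] y by auto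
  moreover have zS': "g z y = 0" if y: "y \<in> S'" for y
  proof -
    have "g w y = 0" using s'(2) y by (simp add: w_def)
    moreover have "g e y = 0" using TM_N(1) R_TM(1)[OF e] S'_N y by blast
    ultimately show ?thesis using zg[OF in_T(3)[OF y]] L_perp(2)[OF a y] by simp
  qed
  ultimately have z\<xi>: "\<And>j. j < r \<Longrightarrow> g z (\<xi> j) = 0" and zS: "\<And>y. y \<in> S \<Longrightarrow> g z y = 0" by auto
  have "g u z = 0" if "u \<in> TM" for u
  proof -
    obtain x y where xy: "u = x + y" "x \<in> R" "y \<in> S" using \<open>u \<in> TM\<close> unfolding TM_sum by blast
    obtain d where d: "x = (\<Sum>i<r. d i *\<^sub>R \<xi> i)"
      using xy(2) unfolding R_span by (rule span_image_representation) auto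
    have "g x z = (\<Sum>i<r. d i * g (\<xi> i) z)"
      unfolding d using z by (subst sum_left) (auto simp: mem_T scale_left in_T(1) \<xi>_R)
    also have "\<dots> = 0" using z\<xi> by (auto intro!: sum.neutral simp: sym[OF in_T(1)[OF \<xi>_R] z])
    finally show ?thesis
      using xy z zS sym[OF in_T(2)[OF xy(3)] z] by (simp add: add_left in_T)
  qed
  then have "z \<in> N'" using z normal by blast
  then obtain x b where xb: "z = x + b" "x \<in> R" "b \<in> S'" unfolding N_sum by blast
  \<comment> \<open>Pairing with \<open>\<nu> i\<close> kills both \<open>z\<close> and its part in
    \<open>S'\<close>, so it kills the radical part as well.\<close>
  have "x = 0"
  proof (rule R_eq_0[OF xb(2)])
    fix i assume i: "i < r"
    have "g z (\<nu> i) = g (\<nu> i) x + g (\<nu> i) b"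
      using xb i sym[OF z \<nu>_T[OF i]] by (simp add: add_right in_T \<nu>_T)
    then show "g (\<nu> i) x = 0" using z\<nu>[OF i] \<nu>_S'[OF i xb(3)] by simp
  qed
  then have "z \<in> S'" using xb by simp
  then have "z = 0" using nondegenerate_S' zS' unfolding nondegenerate_on_def by blast
  then have "v = (e + s) + a + s'" by (simp add: z_def w_def algebra_simps)
  moreover have "e + s \<in> TM" unfolding TM_sum using e s(1) by blast
  ultimately show ?thesis using a s'(1) by blast
qed

text \<open>Pairing with \<open>\<xi> i\<close> sees only the component in \<open>L\<close>, which
  is therefore determined. What remains is a vector in both \<open>TM\<close> and \<open>S'\<close>,
  hence in \<open>R\<close> and \<open>S'\<close>, hence 0.\<close>

lemma splitting_unique:
  assumes 1: "t \<in> TM" "a \<in> L" "b \<in> S'" and 2: "t' \<in> TM" "a' \<in> L" "b' \<in> S'"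
    and eq: "t + a + b = t' + a' + b'"
  shows "t = t' \<and> a = a' \<and> b = b'"
proof -
  have aL: "a - a' \<in> L" using subspace_diff[OF subspaces(4)] 1(2) 2(2) .
  have "a - a' = 0"
  proof (rule L_eq_0[OF aL])
    fix i assume i: "i < r"
    have \<xi>: "\<xi> i \<in> T" "\<xi> i \<in> TM" "\<xi> i \<in> N'" using \<xi>_R[OF i] in_T(1) radical by auto
    have 0: "g x (\<xi> i) = 0" if "x \<in> TM \<or> x \<in> S'" for x
      using that TM_N(1)[of x, OF _ \<xi>(3)] TM_N(2)[OF \<xi>(2), of x] S'_N by blast
    have "g (t + a + b) (\<xi> i) = g a (\<xi> i)" "g (t' + a' + b') (\<xi> i) = g a' (\<xi> i)"
      using 1 2 \<xi>(1) by (simp_all add: add_left in_T mem_T 0)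
    then show "g (a - a') (\<xi> i) = 0" using eq 1(2) 2(2) \<xi>(1) by (simp add: diff_left in_T)
  qed
  then have a: "a = a'" by simp
  then have tb: "t - t' = b' - b" using eq by (simp add: algebra_simps)
  have bS': "b' - b \<in> S'" using subspace_diff[OF subspaces(3)] 2(3) 1(3) .
  obtain x y x' y' where xy: "t = x + y" "x \<in> R" "y \<in> S" "t' = x' + y'" "x' \<in> R" "y' \<in> S"
    using 1(1) 2(1) unfolding TM_sum by blast
  have "t - t' = (x - x') + (y - y')" using xy by simp
  moreover have "x - x' \<in> R" "y - y' \<in> S" using xy subspace_diff subspaces by auto
  ultimately have "t - t' \<in> TM" unfolding TM_sum by blast
  then have "b' - b \<in> R" using bS' S'_N tb radical by auto
  then have "b' - b = 0" using bS' RS' by blast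
  then show ?thesis using a tb by simp
qed

end

section \<open>Screen generic submanifolds\<close>

locale screen_generic_submanifold =
  fixes A :: "('a::{t2_space, second_countable_topology}, 'b::euclidean_space) atlas"
    and g :: "'a form" and J :: "'a endo" and D :: "'a connection"
    and l m :: "'a \<Rightarrow> real" and \<eta> :: "'a vfield"
    and M :: "'a set" and S S' L B' :: "'a \<Rightarrow> 'a tvec set" and n r q :: nat
  assumes locally_bronze: "locally_bronze A q g J D"
    and lightlike: "lightlike_submanifold A g n r M"
    and frame_choice: "lightlike_frame_choice A g r M S S' L"
    and screen_generic: "screen_generic A g J M S S' L B'"
begin

sublocale manifold A
  using locally_bronze by unfold_locales (simp add: locally_bronze_def bronze_manifold_def)

abbreviation "T p \<equiv> tangent_space A UNIV p"
abbreviation "R \<equiv> radical_bundle A g M"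
abbreviation "B \<equiv> bundle_sum (Bo J S) R"
abbreviation "\<Omega>bar \<equiv> lm_connection g J D l m \<eta>"
abbreviation "\<Gamma> E \<equiv> sections_of A M E"
text \<open>Exactly the witness that \<open>connection_along\<close> picks at \<open>p\<close>, so
  unfolding the latter produces these terms literally.\<close>

abbreviation "ext X p \<equiv> SOME X'. extends_at A M p X X'"

section \<open>The hypotheses in pointwise form, and the fibres involved\<close>

lemma metric: "semi_riemannian_metric A q g"
  using locally_bronze by (simp add: locally_bronze_def bronze_manifold_def)

lemma metric_form: "symmetric_form (T p) (g p)"
proof
  show "subspace (T p)" by (rule subspace_tangent_space)
  have *: "\<forall>u\<in>T p. \<forall>v\<in>T p. g p u v = g p v u \<and>
      (\<forall>w\<in>T p. \<forall>c d. g p (c *\<^sub>R u + d *\<^sub>R v) w = c * g p u w + d * g p v w)"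
    using metric unfolding semi_riemannian_metric_def by (elim conjE allE[of _ p])
  show "g p u v = g p v u" if "u \<in> T p" "v \<in> T p" for u v
    using * that by blast
  show "g p (c *\<^sub>R u + d *\<^sub>R v) w = c * g p u w + d * g p v w"
    if "u \<in> T p" "v \<in> T p" "w \<in> T p" for u v w c d
    using * that by blast
qed

lemma metric_nondegenerate: "nondegenerate_on (g p) (T p)"
  using metric by (simp add: semi_riemannian_metric_def)

lemma metric_smooth:
  "X \<in> vector_fields A \<Longrightarrow> Y \<in> vector_fields A \<Longrightarrow> (\<lambda>p. g p (X p) (Y p)) \<in> smooth_funs A UNIV"
  using metric unfolding semi_riemannian_metric_def by blast

lemma J_tangent: "u \<in> T p \<Longrightarrow> J p u \<in> T p"
  using locally_bronze
  unfolding locally_bronze_def bronze_manifold_def smooth_endomorphism_def by blast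

lemma J_linear: "u \<in> T p \<Longrightarrow> v \<in> T p \<Longrightarrow> J p (c *\<^sub>R u + d *\<^sub>R v) = c *\<^sub>R J p u + d *\<^sub>R J p v"
  using locally_bronze
  unfolding locally_bronze_def bronze_manifold_def smooth_endomorphism_def by blast

lemma J_vector_field: "X \<in> vector_fields A \<Longrightarrow> app J X \<in> vector_fields A"
  using locally_bronze
  unfolding locally_bronze_def bronze_manifold_def smooth_endomorphism_def app_def by blast

lemma J_square: "u \<in> T p \<Longrightarrow> J p (J p u) = 3 *\<^sub>R J p u + u"
  using locally_bronze unfolding locally_bronze_def bronze_manifold_def by blast

lemma J_symmetric: "u \<in> T p \<Longrightarrow> v \<in> T p \<Longrightarrow> g p (J p u) v = g p u (J p v)"
  using locally_bronze unfolding locally_bronze_def bronze_manifold_def by blast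

lemma D_vector_field: "X \<in> vector_fields A \<Longrightarrow> Y \<in> vector_fields A \<Longrightarrow> D X Y \<in> vector_fields A"
  using locally_bronze unfolding locally_bronze_def levi_civita_def affine_connection_def by blast

lemma D_torsion_free:
  "X \<in> vector_fields A \<Longrightarrow> Y \<in> vector_fields A \<Longrightarrow> D X Y - D Y X = lie_bracket A UNIV X Y"
  using locally_bronze unfolding locally_bronze_def levi_civita_def by blast

lemma D_metric:
  "X \<in> vector_fields A \<Longrightarrow> Y \<in> vector_fields A \<Longrightarrow> Z \<in> vector_fields A \<Longrightarrow>
    X p (\<lambda>x. g x (Y x) (Z x)) = g p (D X Y p) (Z p) + g p (Y p) (D X Z p)"
  using locally_bronze unfolding locally_bronze_def levi_civita_def by blast

lemma D_J: "X \<in> vector_fields A \<Longrightarrow> Y \<in> vector_fields A \<Longrightarrow> D X (app J Y) p = J p (D X Y p)"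
  using locally_bronze unfolding locally_bronze_def app_def by blast

lemma splitting:
  assumes p: "p \<in> M"
  obtains \<xi> \<nu> where "lightlike_splitting (T p) (g p) (tangent_bundle A M p) (R p) (S p)
    (normal_bundle A g M p) (S' p) (L p) r \<xi> \<nu>"
proof -
  from frame_choice have "\<exists>k. subbundle A M k S" "\<exists>k. subbundle A M k S'"
      and sums: "orthogonal_sum g M (tangent_bundle A M) R S" "orthogonal_sum g M (normal_bundle A g M) R S'"
    and frame: "\<forall>p\<in>M. \<exists>V \<xi> N. open V \<and> p \<in> V \<and>
        (\<forall>i<r. \<xi> i \<in> smooth_sections A (M \<inter> V) \<and> N i \<in> smooth_sections A (M \<inter> V)) \<and>
        (\<forall>q\<in>M \<inter> V. R q = span ((\<lambda>i. \<xi> i q) ` {..<r}) \<and> L q = span ((\<lambda>i. N i q) ` {..<r}) \<and>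
           (\<forall>i<r. (\<forall>u\<in>S q. g q (N i q) u = 0) \<and> (\<forall>u\<in>S' q. g q (N i q) u = 0) \<and>
              (\<forall>j<r. g q (N i q) (\<xi> j q) = (if i = j then 1 else 0) \<and> g q (N i q) (N j q) = 0)))"
    unfolding lightlike_frame_choice_def by - (elim conjE, assumption)+
  then obtain k k' where sub: "subbundle A M k S" "subbundle A M k' S'" by (elim exE)
  from bspec[OF frame p] obtain V \<xi> N where V: "open V" "p \<in> V"
    "\<forall>i<r. \<xi> i \<in> smooth_sections A (M \<inter> V) \<and> N i \<in> smooth_sections A (M \<inter> V)"
    "\<forall>q\<in>M \<inter> V. R q = span ((\<lambda>i. \<xi> i q) ` {..<r}) \<and> L q = span ((\<lambda>i. N i q) ` {..<r}) \<and>
           (\<forall>i<r. (\<forall>u\<in>S q. g q (N i q) u = 0) \<and> (\<forall>u\<in>S' q. g q (N i q) u = 0) \<and>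
              (\<forall>j<r. g q (N i q) (\<xi> j q) = (if i = j then 1 else 0) \<and> g q (N i q) (N j q) = 0))"
    by (elim exE conjE)
  have pV: "p \<in> M \<inter> V" using p V(2) by blast
  note V' = bspec[OF V(4) pV]
  note V_i = V'[THEN conjunct2, THEN conjunct2, rule_format]
  interpret symmetric_form "T p" "g p" by (rule metric_form)
  have "lightlike_splitting (T p) (g p) (tangent_bundle A M p) (R p) (S p)
    (normal_bundle A g M p) (S' p) (L p) r (\<lambda>i. \<xi> i p) (\<lambda>i. N i p)"
  proof
    show "nondegenerate_on (g p) (T p)" by (rule metric_nondegenerate)
    show "tangent_bundle A M p \<subseteq> T p" by (rule tangent_bundle_subset[OF p])
    show "normal_bundle A g M p = {v \<in> T p. \<forall>u\<in>tangent_bundle A M p. g p u v = 0}"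
      by (simp add: normal_bundle_def)
    show "R p = tangent_bundle A M p \<inter> normal_bundle A g M p" by (simp add: radical_bundle_def)
    show "tangent_bundle A M p = {v + w | v w. v \<in> R p \<and> w \<in> S p}" "R p \<inter> S p = {0}"
      using bspec[OF sums(1)[unfolded orthogonal_sum_def bundle_sum_def] p] by - (elim conjE, assumption)+
    show "normal_bundle A g M p = {v + w | v w. v \<in> R p \<and> w \<in> S' p}" "R p \<inter> S' p = {0}"
      using bspec[OF sums(2)[unfolded orthogonal_sum_def bundle_sum_def] p] by - (elim conjE, assumption)+
    show "\<exists>B. finite B \<and> S p = span B" by (rule subbundle_finite_span[OF sub(1) p]) blast
    show "\<exists>B. finite B \<and> S' p = span B" by (rule subbundle_finite_span[OF sub(2) p]) blast
    show "R p = span ((\<lambda>i. \<xi> i p) ` {..<r})" "L p = span ((\<lambda>i. N i p) ` {..<r})"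
      using V' by - (elim conjE, assumption)+
    fix i assume i: "i < r"
    show "N i p \<in> T p" by (rule smooth_sectionsD(1)[OF conjunct2[OF V(3)[rule_format, OF i]] pV])
    show "g p (N i p) u = 0" if "u \<in> S p" for u by (rule bspec[OF conjunct1[OF V_i[OF i]] that])
    show "g p (N i p) u = 0" if "u \<in> S' p" for u
      by (rule bspec[OF conjunct1[OF conjunct2[OF V_i[OF i]]] that])
    fix j assume j: "j < r"
    show "g p (N i p) (\<xi> j p) = (if i = j then 1 else 0)" "g p (N i p) (N j p) = 0"
      using conjunct2[OF conjunct2[OF V_i[OF i]]] j by simp_all
  qed
  then show thesis by (rule that)
qed

lemma components:
  assumes p: "p \<in> M" and W: "W p \<in> T p"
  shows "tan_part A M L S' W p \<in> tangent_bundle A M p" "ltr_part A M L S' W p \<in> L p"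
    "str_part A M L S' W p \<in> S' p"
    "W p = tan_part A M L S' W p + ltr_part A M L S' W p + str_part A M L S' W p"
proof -
  obtain \<xi> \<nu> where "lightlike_splitting (T p) (g p) (tangent_bundle A M p) (R p) (S p)
    (normal_bundle A g M p) (S' p) (L p) r \<xi> \<nu>" by (rule splitting[OF p])
  then interpret lightlike_splitting "T p" "g p" "tangent_bundle A M p" "R p" "S p"
    "normal_bundle A g M p" "S' p" "L p" r \<xi> \<nu> .
  let ?P = "\<lambda>(t, a, b). t \<in> tangent_bundle A M p \<and> a \<in> L p \<and> b \<in> S' p \<and> W p = t + a + b"
  obtain t a b where tab: "t \<in> tangent_bundle A M p" "a \<in> L p" "b \<in> S' p" "W p = t + a + b"
    using splitting_exists[OF W] by (elim exE conjE)
  have "\<exists>!x. ?P x"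
  proof (rule ex1I[of _ "(t, a, b)"])
    show "?P (t, a, b)" unfolding prod.case by (intro conjI tab)
    fix x assume x: "?P x"
    obtain t' a' b' where x_eq: "x = (t', a', b')" by (rule prod_cases3)
    have P: "t' \<in> tangent_bundle A M p" "a' \<in> L p" "b' \<in> S' p" "W p = t' + a' + b'"
      using x unfolding x_eq prod.case by - (elim conjE, assumption)+
    have "t' = t \<and> a' = a \<and> b' = b"
      by (rule splitting_unique[OF P(1-3) tab(1-3)]) (simp only: P(4)[symmetric] tab(4)[symmetric])
    then show "x = (t, a, b)" unfolding x_eq by simp
  qed
  then have *: "?P (lightlike_components A M L S' p (W p))"
    unfolding lightlike_components_def by (rule theI')
  obtain t' a' b' where eq: "lightlike_components A M L S' p (W p) = (t', a', b')" by (rule prod_cases3)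
  show "tan_part A M L S' W p \<in> tangent_bundle A M p" "ltr_part A M L S' W p \<in> L p"
    "str_part A M L S' W p \<in> S' p"
    "W p = tan_part A M L S' W p + ltr_part A M L S' W p + str_part A M L S' W p"
    using * unfolding tan_part_def ltr_part_def str_part_def eq prod.case fst_conv snd_conv
    by - (elim conjE, assumption)+
qed

lemma orthogonality:
  assumes p: "p \<in> M"
  shows "u \<in> tangent_bundle A M p \<Longrightarrow> v \<in> S' p \<Longrightarrow> g p u v = 0"
    "u \<in> tangent_bundle A M p \<Longrightarrow> v \<in> S' p \<Longrightarrow> g p v u = 0"
    "a \<in> L p \<Longrightarrow> u \<in> S p \<Longrightarrow> g p a u = 0" "a \<in> L p \<Longrightarrow> v \<in> S' p \<Longrightarrow> g p a v = 0"
    "x \<in> R p \<Longrightarrow> u \<in> tangent_bundle A M p \<Longrightarrow> g p x u = 0"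
    "S p \<subseteq> tangent_bundle A M p" "L p \<subseteq> T p" "S' p \<subseteq> T p"
    "tangent_bundle A M p = bundle_sum R S p"
proof -
  obtain \<xi> \<nu> where "lightlike_splitting (T p) (g p) (tangent_bundle A M p) (R p) (S p)
    (normal_bundle A g M p) (S' p) (L p) r \<xi> \<nu>" by (rule splitting[OF p])
  then interpret lightlike_splitting "T p" "g p" "tangent_bundle A M p" "R p" "S p"
    "normal_bundle A g M p" "S' p" "L p" r \<xi> \<nu> .
  show "u \<in> tangent_bundle A M p \<Longrightarrow> v \<in> S' p \<Longrightarrow> g p u v = 0"
    "u \<in> tangent_bundle A M p \<Longrightarrow> v \<in> S' p \<Longrightarrow> g p v u = 0"
    using TM_N S'_N by blast+
  show "a \<in> L p \<Longrightarrow> u \<in> S p \<Longrightarrow> g p a u = 0" "a \<in> L p \<Longrightarrow> v \<in> S' p \<Longrightarrow> g p a v = 0"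
    using L_perp by blast+
  show "x \<in> R p \<Longrightarrow> u \<in> tangent_bundle A M p \<Longrightarrow> g p x u = 0"
    using TM_N(2) radical by blast
  show "S p \<subseteq> tangent_bundle A M p" by (rule S_TM)
  show "L p \<subseteq> T p" "S' p \<subseteq> T p" using in_T by blast+
  show "tangent_bundle A M p = bundle_sum R S p" using TM_sum by (simp add: bundle_sum_def)
qed

lemma screen_genericD:
  "\<forall>p\<in>M. J p ` R p = R p" "\<exists>k. subbundle A M k (Bo J S)" "\<exists>k. subbundle A M k B'"
  "\<forall>p\<in>M. nondegenerate_on (g p) (B' p)" "orthogonal_sum g M S (Bo J S) B'"
  "\<forall>Y\<in>\<Gamma> B'. f_part A J M L S' Y \<in> \<Gamma> B' \<and> w_part A J M L S' Y \<in> \<Gamma> S'"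
  using screen_generic unfolding screen_generic_def by - (elim conjE, assumption)+

lemma screen_sum:
  assumes p: "p \<in> M"
  shows "S p = bundle_sum (Bo J S) B' p" "u \<in> Bo J S p \<Longrightarrow> v \<in> B' p \<Longrightarrow> g p u v = 0"
    "nondegenerate_on (g p) (B' p)"
  using bspec[OF screen_genericD(5)[unfolded orthogonal_sum_def] p] bspec[OF screen_genericD(4) p]
  by simp_all

lemma fibre_subspaces:
  assumes p: "p \<in> M"
  shows "subspace (Bo J S p)" "subspace (R p)" "subspace (B' p)" "subspace (S p)"
proof -
  show "subspace (Bo J S p)" by (rule exE[OF screen_genericD(2)]) (rule subbundle_subspace[OF _ p])
  show "subspace (B' p)" by (rule exE[OF screen_genericD(3)]) (rule subbundle_subspace[OF _ p])
  have "subbundle A M r R" using lightlike by (simp add: lightlike_submanifold_def)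
  then show "subspace (R p)" by (rule subbundle_subspace[OF _ p])
  have "\<exists>k. subbundle A M k S" using frame_choice by (simp only: lightlike_frame_choice_def)
  then show "subspace (S p)" by (rule exE) (rule subbundle_subspace[OF _ p])
qed

lemma fibre_subsets:
  assumes p: "p \<in> M"
  shows "B' p \<subseteq> S p" "Bo J S p \<subseteq> S p" "R p \<subseteq> tangent_bundle A M p" "B p \<subseteq> tangent_bundle A M p"
proof -
  show B': "B' p \<subseteq> S p"
  proof
    fix v assume "v \<in> B' p"
    then show "v \<in> S p" unfolding screen_sum(1)[OF p] bundle_sum_def
      using subspace_0[OF fibre_subspaces(1)[OF p]] by (intro CollectI exI[of _ 0] exI[of _ v]) simp
  qed
  show Bo: "Bo J S p \<subseteq> S p" by (auto simp: Bo_def)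
  show R: "R p \<subseteq> tangent_bundle A M p" by (auto simp: radical_bundle_def)
  show "B p \<subseteq> tangent_bundle A M p"
  proof
    fix v assume "v \<in> B p"
    then obtain x y where "v = x + y" "x \<in> Bo J S p" "y \<in> R p" unfolding bundle_sum_def by blast
    then show "v \<in> tangent_bundle A M p"
      unfolding orthogonality(9)[OF p] bundle_sum_def
      using Bo by (intro CollectI exI[of _ y] exI[of _ x]) (auto simp: add.commute)
  qed
qed

lemma tangent_TM: "p \<in> M \<Longrightarrow> v \<in> tangent_bundle A M p \<Longrightarrow> v \<in> T p"
  using tangent_bundle_subset by blast

lemma B_perp_B':
  assumes p: "p \<in> M" and v: "v \<in> B p" and z: "z \<in> B' p"
  shows "g p v z = 0"
proof -
  interpret symmetric_form "T p" "g p" by (rule metric_form)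
  obtain x y where xy: "v = x + y" "x \<in> Bo J S p" "y \<in> R p" using v unfolding bundle_sum_def by blast
  have TM: "x \<in> tangent_bundle A M p" "y \<in> tangent_bundle A M p" "z \<in> tangent_bundle A M p"
    using xy z fibre_subsets[OF p] orthogonality(6)[OF p] by blast+
  have "g p x z = 0" using screen_sum(2)[OF p xy(2) z] .
  moreover have "g p y z = 0" by (rule orthogonality(5)[OF p xy(3) TM(3)])
  ultimately show ?thesis using xy(1) TM tangent_TM[OF p] by (simp add: add_left)
qed

text \<open>For the part in \<open>Bo\<close>: if x = Js with x and s in the screen, then Jx = 3x +
  s by the bronze equation, so Jx is again in the screen and is the image of a screen
  vector.\<close>

lemma J_B:
  assumes p: "p \<in> M" and v: "v \<in> B p"
  shows "J p v \<in> B p"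
proof -
  obtain x y where xy: "v = x + y" "x \<in> Bo J S p" "y \<in> R p" using v unfolding bundle_sum_def by blast
  have T: "x \<in> T p" "y \<in> T p"
    using xy fibre_subsets[OF p] orthogonality(6)[OF p] tangent_TM[OF p] by blast+
  obtain s where s: "s \<in> S p" "x = J p s" using xy(2) by (auto simp: Bo_def)
  have xS: "x \<in> S p" using xy(2) by (auto simp: Bo_def)
  have sT: "s \<in> T p" using s(1) orthogonality(6)[OF p] tangent_TM[OF p] by blast
  have "3 *\<^sub>R x + s \<in> S p"
    using xS s(1) fibre_subspaces(4)[OF p] by (simp add: subspace_add subspace_scale)
  then have "J p x \<in> S p" using J_square[OF sT] s(2) by simp
  then have "J p x \<in> Bo J S p" using xS by (auto simp: Bo_def)
  moreover have "J p y \<in> R p" using screen_genericD(1) p xy(3) by blast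
  moreover have "J p v = J p x + J p y" using J_linear[OF T, of 1 1] xy(1) by simp
  ultimately show ?thesis unfolding bundle_sum_def by blast
qed

section \<open>Covariant derivatives along \<open>M\<close> and their pairings with
  \<open>B'\<close>\<close>

lemma extends_ext:
  assumes "X \<in> smooth_sections A M" "p \<in> M"
  shows "extends_at A M p X (ext X p)"
  using extends_at_exists[OF assms] by (rule someI_ex)

lemma extends_atD:
  assumes "extends_at A M p X X'"
  shows "X' \<in> vector_fields A" "p \<in> M \<Longrightarrow> X' p = X p"
    "\<exists>V. open V \<and> p \<in> V \<and> (\<forall>q\<in>M \<inter> V. X' q = X q)"
  using assms by (auto simp: extends_at_def)

lemma extends_app_J:
  assumes "extends_at A M p X X'"
  shows "extends_at A M p (app J X) (app J X')"
  using assms J_vector_field unfolding extends_at_def app_def by force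

text \<open>J applied to an extension of \<open>X\<close> shows that \<open>app J X\<close> has
  extensions; the one chosen by \<open>SOME\<close> may be a different one.\<close>

lemma extends_ext_app_J:
  assumes "X \<in> smooth_sections A M" "p \<in> M"
  shows "extends_at A M p (app J X) (ext (app J X) p)"
  by (rule someI[of "extends_at A M p (app J X)"]) (rule extends_app_J[OF extends_ext[OF assms]])

text \<open>Two extensions of a field along \<open>M\<close> need not have the same covariant derivative as vector fields, but
  metric compatibility shows that it pairs equally with every field, because a vector tangent to \<open>M\<close>
  differentiates functions on \<open>M\<close>.\<close>

lemma metric_D_extension:
  assumes X: "X \<in> vector_fields A" "X p \<in> tangent_bundle A M p" and p: "p \<in> M"
    and Y: "extends_at A M p W Y" and Y': "extends_at A M p W Y'" and Z: "Z \<in> vector_fields A"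
  shows "g p (D X Y p) (Z p) = g p (D X Y' p) (Z p)"
proof -
  note Yv = extends_atD(1)[OF Y] and Yv' = extends_atD(1)[OF Y']
  obtain V where V: "open V" "p \<in> V" "\<forall>q\<in>M \<inter> V. Y q = W q"
    using extends_atD(3)[OF Y] by (elim exE conjE)
  obtain V' where V': "open V'" "p \<in> V'" "\<forall>q\<in>M \<inter> V'. Y' q = W q"
    using extends_atD(3)[OF Y'] by (elim exE conjE)
  have "X p (\<lambda>x. g x (Y x) (Z x)) = X p (\<lambda>x. g x (Y' x) (Z x))"
    by (rule tangent_bundle_local[OF X(2) p open_Int[OF V(1) V'(1)]])
      (use V V' metric_smooth[OF Yv Z] metric_smooth[OF Yv' Z] in auto)
  then show ?thesis
    using D_metric[OF X(1) Yv Z, of p] D_metric[OF X(1) Yv' Z, of p] extends_atD(2)[OF Y p]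
      extends_atD(2)[OF Y' p] by simp
qed

lemma sections_B:
  assumes "X \<in> \<Gamma> B"
  shows "X \<in> \<Gamma> (tangent_bundle A M)" "X \<in> smooth_sections A M" "p \<in> M \<Longrightarrow> X p \<in> B p"
  using assms fibre_subsets(4) unfolding sections_of_def by blast+

lemma sections_B':
  assumes "Z \<in> \<Gamma> B'"
  shows "Z \<in> smooth_sections A M" "p \<in> M \<Longrightarrow> Z p \<in> B' p"
  using assms unfolding sections_of_def by blast+

lemma connection_along_J:
  assumes X: "X \<in> \<Gamma> B" and Y: "Y \<in> \<Gamma> B" and p: "p \<in> M" and Z: "Z \<in> \<Gamma> B'"
  defines "U \<equiv> connection_along A M \<Omega>bar X (app J Y)" and "E \<equiv> D (ext X p) (ext Y p) p"
  shows "U p \<in> T p" "g p (U p) (Z p) = g p (J p E) (Z p)"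
    "g p (U p) (J p (Z p)) = 3 * g p (J p E) (Z p) + g p E (Z p)"
proof -
  interpret symmetric_form "T p" "g p" by (rule metric_form)
  let ?X = "ext X p" and ?Y = "ext Y p" and ?W = "ext (app J Y) p" and ?Z = "ext Z p"
  note eX = extends_ext[OF sections_B(2)[OF X] p] and eY = extends_ext[OF sections_B(2)[OF Y] p]
    and eW = extends_ext_app_J[OF sections_B(2)[OF Y] p] and eZ = extends_ext[OF sections_B'(1)[OF Z] p]
  note vX = extends_atD(1)[OF eX] and vY = extends_atD(1)[OF eY] and vW = extends_atD(1)[OF eW]
    and vZ = extends_atD(1)[OF eZ]
  note XB = sections_B(3)[OF X p] and YB = sections_B(3)[OF Y p] and ZB' = sections_B'(2)[OF Z p]
  have BT: "v \<in> T p" if "v \<in> B p" for v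
    using that fibre_subsets(4)[OF p] tangent_TM[OF p] by blast
  have ZT: "Z p \<in> T p" using smooth_sectionsD(1)[OF sections_B'(1)[OF Z] p] .
  have ET: "E \<in> T p" unfolding E_def using smooth_sectionsD(1)[OF D_vector_field[OF vX vY] UNIV_I] .
  have FT: "D ?X ?W p \<in> T p" using smooth_sectionsD(1)[OF D_vector_field[OF vX vW] UNIV_I] .
  define \<theta> where "\<theta> = g p (J p (Y p)) (\<eta> p)"
  \<comment> \<open>The correction term of the connection at \<open>p\<close>. It is a combination
    of \<open>X p\<close> and \<open>J p (X p)\<close>, both in the fibre of
    \<open>B\<close>.\<close>
  define b where "b = \<theta> *\<^sub>R (l p *\<^sub>R X p + m p *\<^sub>R J p (X p))"
  have Wp: "?W p = J p (Y p)" using extends_atD(2)[OF eW p] by (simp only: app_def)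
  have U: "U p = D ?X ?W p + b"
    unfolding U_def connection_along_def lm_connection_def b_def \<theta>_def extends_atD(2)[OF eX p] Wp ..
  have bT: "b \<in> T p" unfolding b_def by (intro mem_T BT XB J_B[OF p])
  have b_perp: "g p b z = 0" if "z \<in> T p" "\<And>v. v \<in> B p \<Longrightarrow> g p v z = 0" for z
    using that(2)[OF XB] that(2)[OF J_B[OF p XB]] that(1) BT[OF XB] BT[OF J_B[OF p XB]]
    by (simp add: b_def scale_left lincomb mem_T)
  show "U p \<in> T p" unfolding U by (intro mem_T FT bT)
  \<comment> \<open>Replaces the chosen extension of \<open>app J Y\<close> by J of the chosen
    extension of \<open>Y\<close>, where parallelism of J applies. It is used with an extension of
    \<open>Z\<close> and with J of that extension.\<close>
  have D_eq: "g p (D ?X ?W p) (Z' p) = g p (J p E) (Z' p)" if "Z' \<in> vector_fields A" for Z'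
  proof -
    have "g p (D ?X ?W p) (Z' p) = g p (D ?X (app J ?Y) p) (Z' p)"
    proof (rule metric_D_extension[OF vX _ p eW extends_app_J[OF eY] that])
      show "?X p \<in> tangent_bundle A M p"
        using XB fibre_subsets(4)[OF p] extends_atD(2)[OF eX p] by auto
    qed
    then show ?thesis by (simp add: D_J[OF vX vY] E_def)
  qed
  have "g p (D ?X ?W p) (Z p) = g p (J p E) (Z p)"
    using D_eq[OF vZ] by (simp add: extends_atD(2)[OF eZ p])
  moreover have "g p b (Z p) = 0" by (rule b_perp[OF ZT B_perp_B'[OF p _ ZB']])
  ultimately show "g p (U p) (Z p) = g p (J p E) (Z p)"
    unfolding U using FT bT ZT by (simp add: add_left)
  have "g p (D ?X ?W p) (J p (Z p)) = g p (J p E) (J p (Z p))"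
    using D_eq[OF J_vector_field[OF vZ]] by (simp add: app_def extends_atD(2)[OF eZ p])
  also have "\<dots> = g p (J p (J p E)) (Z p)" using J_symmetric[OF J_tangent[OF ET] ZT] by simp
  also have "\<dots> = 3 * g p (J p E) (Z p) + g p E (Z p)"
    using J_square[OF ET] J_tangent[OF ET] ET ZT by (simp add: add_left scale_left mem_T)
  finally have 1: "g p (D ?X ?W p) (J p (Z p)) = 3 * g p (J p E) (Z p) + g p E (Z p)" .
  \<comment> \<open>Symmetry moves J from \<open>Z\<close> to the vector of \<open>B\<close>, which
    J keeps in \<open>B\<close>.\<close>
  have "g p b (J p (Z p)) = 0"
  proof (rule b_perp[OF J_tangent[OF ZT]])
    fix v assume v: "v \<in> B p"
    show "g p v (J p (Z p)) = 0"
      using J_symmetric[OF BT[OF v] ZT] B_perp_B'[OF p J_B[OF p v] ZB'] by simp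
  qed
  then show "g p (U p) (J p (Z p)) = 3 * g p (J p E) (Z p) + g p E (Z p)"
    unfolding U using FT bT J_tangent[OF ZT] 1 by (simp add: add_left)
qed

text \<open>Here JZ = fZ + wZ with fZ in the screen and wZ in \<open>S'\<close>. The lightlike
  transversal part of \<open>U\<close> is orthogonal to both, so no such term appears in the
  condition; the tangential part meets only fZ, and the part in \<open>S'\<close> may be paired with
  all of JZ.\<close>

lemma induced_pairing:
  assumes p: "p \<in> M" and Z: "Z \<in> \<Gamma> B'" and U: "U p \<in> T p"
  shows "g p (tan_part A M L S' U p) (f_part A J M L S' Z p) +
      g p (str_part A M L S' U p) (app J Z p) = g p (U p) (J p (Z p))"
    "g p (tan_part A M L S' U p) (Z p) = g p (U p) (Z p)"
proof -
  interpret symmetric_form "T p" "g p" by (rule metric_form)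
  note c = components[of p U, OF p U]
  let ?t = "tan_part A M L S' U p" and ?a = "ltr_part A M L S' U p" and ?b = "str_part A M L S' U p"
  have T: "?t \<in> T p" "?a \<in> T p" "?b \<in> T p"
    using c(1-3) orthogonality(7,8)[OF p] tangent_TM[OF p] by blast+
  have ZB': "Z p \<in> B' p" by (rule sections_B'(2)[OF Z p])
  have S_TM: "v \<in> tangent_bundle A M p" "v \<in> T p" if "v \<in> S p" for v
    using that orthogonality(6)[OF p] tangent_TM[OF p] by blast+
  have ZS: "Z p \<in> S p" using ZB' fibre_subsets(1)[OF p] by blast
  show "g p ?t (Z p) = g p (U p) (Z p)"
  proof -
    have "g p (?t + ?a + ?b) (Z p) = g p ?t (Z p) + g p ?a (Z p) + g p ?b (Z p)"
      using T S_TM(2)[OF ZS] by (simp add: add_left mem_T)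
    then show ?thesis using c(4) orthogonality(3)[OF p c(2) ZS]
        orthogonality(2)[OF p S_TM(1)[OF ZS] c(3)] by simp
  qed
  let ?F = "f_part A J M L S' Z p" and ?w = "w_part A J M L S' Z p"
  have JZT: "app J Z p \<in> T p" using J_tangent[OF S_TM(2)[OF ZS]] by (simp add: app_def)
  have sec: "f_part A J M L S' Z \<in> \<Gamma> B'" "w_part A J M L S' Z \<in> \<Gamma> S'"
    using bspec[OF screen_genericD(6) Z] by simp_all
  have F: "?F \<in> S p" using sections_B'(2)[OF sec(1) p] fibre_subsets(1)[OF p] by blast
  have w: "?w \<in> S' p" using sec(2) p unfolding sections_of_def by blast
  have wT: "?w \<in> T p" using w orthogonality(8)[OF p] by blast
  have JZ: "J p (Z p) = ?F + ?w"
    using components(4)[of p "app J Z", OF p JZT] unfolding f_part_def w_part_def app_def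
    by (simp add: add.assoc)
  have "g p (U p) (J p (Z p)) = g p (?t + ?a + ?b) ?F + g p (?t + ?a + ?b) ?w"
    unfolding JZ using c(4) T S_TM(2)[OF F] wT by (simp add: add_right mem_T)
  also have "g p (?t + ?a + ?b) ?F = g p ?t ?F + g p ?a ?F + g p ?b ?F"
    using T S_TM(2)[OF F] by (simp add: add_left mem_T)
  also have "g p (?t + ?a + ?b) ?w = g p ?t ?w + g p ?a ?w + g p ?b ?w"
    using T wT by (simp add: add_left mem_T)
  finally have "g p (U p) (J p (Z p)) = g p ?t ?F + (g p ?b ?F + g p ?b ?w)"
    using orthogonality(3)[OF p c(2) F] orthogonality(1)[OF p c(1) w] orthogonality(4)[OF p c(2) w]
    by simp
  also have "g p ?b ?F + g p ?b ?w = g p ?b (app J Z p)"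
    unfolding app_def JZ using add_right[OF S_TM(2)[OF F] wT T(3)] by simp
  finally show "g p ?t ?F + g p ?b (app J Z p) = g p (U p) (J p (Z p))" by simp
qed

text \<open>Once every pairing is expressed through the two ambient covariant derivatives, the terms
  with J occur on both sides with coefficient 3, and what remains is the pairing of the torsion-free
  bracket with \<open>Z\<close>.\<close>

lemma condition_iff:
  assumes X: "X \<in> \<Gamma> B" and Y: "Y \<in> \<Gamma> B" and Z: "Z \<in> \<Gamma> B'" and p: "p \<in> M"
  defines "\<Omega> \<equiv> induced_connection A M L S' \<Omega>bar" and "hs \<equiv> induced_hs A M L S' \<Omega>bar"
    and "f \<equiv> f_part A J M L S'"
  shows "g p (\<Omega> X (app J Y) p) (f Z p) + g p (hs X (app J Y) p) (app J Z p)
         + 3 * g p (\<Omega> Y (app J X) p) (Z p)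
     = g p (\<Omega> Y (app J X) p) (f Z p) + g p (hs Y (app J X) p) (app J Z p)
         + 3 * g p (\<Omega> X (app J Y) p) (Z p) \<longleftrightarrow> g p (sub_bracket A M X Y p) (Z p) = 0"
proof -
  interpret symmetric_form "T p" "g p" by (rule metric_form)
  let ?X = "ext X p" and ?Y = "ext Y p"
  note eX = extends_ext[OF sections_B(2)[OF X] p] and eY = extends_ext[OF sections_B(2)[OF Y] p]
  note vX = extends_atD(1)[OF eX] and vY = extends_atD(1)[OF eY]
  obtain V where V: "open V" "p \<in> V" "\<forall>q\<in>M \<inter> V. ?X q = X q"
    using extends_atD(3)[OF eX] by (elim exE conjE)
  obtain V' where V': "open V'" "p \<in> V'" "\<forall>q\<in>M \<inter> V'. ?Y q = Y q"
    using extends_atD(3)[OF eY] by (elim exE conjE)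
  \<comment> \<open>The extensions occurring in \<open>connection_along_J\<close> for both orders of
    \<open>X\<close> and \<open>Y\<close> also compute the bracket.\<close>
  have "sub_bracket A M X Y p = lie_bracket A UNIV ?X ?Y p"
    by (rule sub_bracket_eq[OF sections_B(1)[OF X] sections_B(1)[OF Y] vX vY open_Int[OF V(1) V'(1)] _ p])
      (use V V' in auto)
  also have "\<dots> = D ?X ?Y p - D ?Y ?X p" by (simp add: D_torsion_free[OF vX vY, symmetric])
  finally have br: "sub_bracket A M X Y p = D ?X ?Y p - D ?Y ?X p" .
  have T: "D ?X ?Y p \<in> T p" "D ?Y ?X p \<in> T p" "Z p \<in> T p"
    using smooth_sectionsD(1)[OF D_vector_field[OF vX vY] UNIV_I]
      smooth_sectionsD(1)[OF D_vector_field[OF vY vX] UNIV_I] smooth_sectionsD(1)[OF sections_B'(1)[OF Z] p] by auto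
  note XY = connection_along_J[OF X Y p Z] and YX = connection_along_J[OF Y X p Z]
  note iXY = induced_pairing[OF p Z, of "connection_along A M \<Omega>bar X (app J Y)", OF XY(1)] and iYX = induced_pairing[OF p Z, of "connection_along A M \<Omega>bar Y (app J X)", OF YX(1)]
  show ?thesis
    unfolding \<Omega>_def hs_def f_def induced_connection_def induced_hs_def iXY iYX XY(2,3) YX(2,3) br
      diff_left[OF T] by auto
qed

text \<open>For the converse, the bracket is tangent to \<open>M\<close>, so it splits into a part
  in \<open>B\<close> and a part \<open>z\<close> in \<open>B'\<close>; the vanishing pairings make
  \<open>z\<close> orthogonal to its own non-degenerate fibre.\<close>

lemma integrable_iff:
  "integrable_distribution A M B \<longleftrightarrow>
    (\<forall>X\<in>\<Gamma> B. \<forall>Y\<in>\<Gamma> B. \<forall>Z\<in>\<Gamma> B'. \<forall>p\<in>M. g p (sub_bracket A M X Y p) (Z p) = 0)"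
proof (intro iffI ballI)
  fix X Y Z p assume "integrable_distribution A M B" "X \<in> \<Gamma> B" "Y \<in> \<Gamma> B" and Z: "Z \<in> \<Gamma> B'" and p: "p \<in> M"
  then have "sub_bracket A M X Y p \<in> B p"
    unfolding integrable_distribution_def sections_of_def by blast
  then show "g p (sub_bracket A M X Y p) (Z p) = 0"
    by (rule B_perp_B'[OF p _ sections_B'(2)[OF Z p]])
next
  assume *: "\<forall>X\<in>\<Gamma> B. \<forall>Y\<in>\<Gamma> B. \<forall>Z\<in>\<Gamma> B'. \<forall>p\<in>M. g p (sub_bracket A M X Y p) (Z p) = 0"
  show "integrable_distribution A M B"
    unfolding integrable_distribution_def
  proof (intro ballI)
    fix X Y assume X: "X \<in> \<Gamma> B" and Y: "Y \<in> \<Gamma> B"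
    note tX = sections_B(1)[OF X] and tY = sections_B(1)[OF Y]
    have "sub_bracket A M X Y p \<in> B p" if p: "p \<in> M" for p
    proof -
      interpret symmetric_form "T p" "g p" by (rule metric_form)
      obtain x s where xs: "sub_bracket A M X Y p = x + s" "x \<in> R p" "s \<in> S p"
        using sub_bracket_tangent[OF tX tY p] unfolding orthogonality(9)[OF p] bundle_sum_def by blast
      obtain b z where bz: "s = b + z" "b \<in> Bo J S p" "z \<in> B' p"
        using xs(3) unfolding screen_sum(1)[OF p] bundle_sum_def by blast
      have bxB: "b + x \<in> B p" using bz(2) xs(2) unfolding bundle_sum_def by blast
      have eq: "sub_bracket A M X Y p = (b + x) + z" using xs(1) bz(1) by (simp add: algebra_simps)
      have T: "b + x \<in> T p" "z \<in> T p"
        using bxB bz(3) fibre_subsets[OF p] orthogonality(6)[OF p] tangent_TM[OF p] by blast+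
      have "g p z w = 0" if w: "w \<in> B' p" for w
      proof -
        \<comment> \<open>The assumption speaks of sections, so the test vector \<open>w\<close> is
          first realised as the value of a section of \<open>B'\<close>.\<close>
        obtain k where k: "subbundle A M k B'" using screen_genericD(3) by (elim exE)
        obtain Z where Z: "Z \<in> \<Gamma> B'" "Z p = w" by (rule section_through[OF k p w])
        have wT: "w \<in> T p" using smooth_sectionsD(1)[OF sections_B'(1)[OF Z(1)] p] Z(2) by simp
        have "g p (sub_bracket A M X Y p) w = 0" using * X Y Z p by blast
        then show ?thesis
          unfolding eq add_left[OF T wT] using B_perp_B'[OF p bxB w] by simp
      qed
      then have "z = 0" using screen_sum(3)[OF p] bz(3) unfolding nondegenerate_on_def by blast
      then show ?thesis using eq bxB by simp
    qed
    then show "sub_bracket A M X Y \<in> \<Gamma> B"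
      using sub_bracket_smooth[OF tX tY] by (simp add: sections_of_def)
  qed
qed

end

theorem theorem5p9:
  fixes A :: "('a::{t2_space, second_countable_topology}, 'b::euclidean_space) atlas"
    and g :: "'a form" and J :: "'a endo" and D :: "'a connection"
    and l m :: "'a \<Rightarrow> real" and \<eta> :: "'a vfield"
    and M :: "'a set" and S S' L B' B :: "'a \<Rightarrow> 'a tvec set"
    and n r q :: nat
    and \<Omega>bar \<Omega> hs :: "'a connection" and f :: "'a vfield \<Rightarrow> 'a vfield"
  assumes "locally_bronze A q g J D"
    and "lm_data A g l m \<eta>"
    and "lightlike_submanifold A g n r M"
    and "lightlike_frame_choice A g r M S S' L"
    and "screen_generic A g J M S S' L B'"
  defines "B \<equiv> bundle_sum (Bo J S) (radical_bundle A g M)"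
    and "\<Omega>bar \<equiv> lm_connection g J D l m \<eta>"
    and "\<Omega> \<equiv> induced_connection A M L S' \<Omega>bar"
    and "hs \<equiv> induced_hs A M L S' \<Omega>bar"
    and "f \<equiv> f_part A J M L S'"
  shows "integrable_distribution A M B \<longleftrightarrow>
    (\<forall>X\<in>sections_of A M B. \<forall>Y\<in>sections_of A M B. \<forall>Z\<in>sections_of A M B'. \<forall>p\<in>M.
       g p (\<Omega> X (app J Y) p) (f Z p) + g p (hs X (app J Y) p) (app J Z p)
         + 3 * g p (\<Omega> Y (app J X) p) (Z p)
     = g p (\<Omega> Y (app J X) p) (f Z p) + g p (hs Y (app J X) p) (app J Z p)
         + 3 * g p (\<Omega> X (app J Y) p) (Z p))"
proof -
  interpret screen_generic_submanifold A g J D l m \<eta> M S S' L B' n r q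
    by unfold_locales fact+
  show ?thesis
    unfolding B_def \<Omega>_def hs_def f_def \<Omega>bar_def integrable_iff
    by (intro ball_cong refl) (rule condition_iff[symmetric])
qed

end
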